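(* Let $(M,g,\mathcal{E})$ be an embedded ambient structure and let $TM=\mathcal{H}M\oplus\mathcal{V}M$ be an orthogonal bundle decomposition. For $x\in M$ and $\xi,\eta,\phi\in\mathcal{H}_xM$, let $A_\xi$ be the operator $A_\xi\omega=\mathrm{V}\nabla_\xi(\mathrm{H}\omega)=\Gamma_{\mathcal{V}}(\xi,\mathrm{H}\omega)$ for $\omega\in\mathcal{E}$, and let $A^\dagger_\xi$ be its adjoint (so $A_\xi^\dagger\omega=-\mathrm{H}\nabla_\xi(\mathrm{V}\omega)=-\Gamma_{\mathcal{H}}(\xi,\mathrm{V}\omega)$ for $\omega\in T_xM$), all evaluated at $x$. Set $$R^{\mathcal{H}}_{\xi\eta}\phi := 2A^\dagger_\phi A_\xi\eta-(D_\xi\Gamma_{\mathcal{H}})(\eta,\phi)+(D_\eta\Gamma_{\mathcal{H}})(\xi,\phi)-\Gamma_{\mathcal{H}}(\xi,\Gamma_{\mathcal{H}}(\eta,\phi))+\Gamma_{\mathcal{H}}(\eta,\Gamma_{\mathcal{H}}(\xi,\phi)).$$ Then $(R^{\mathcal{H}}_{\xi\eta}\phi)_x\in\mathcal{H}_xM$, and $R^{\mathcal{H}}$ satisfies the O'Neill equation $$R^{\mathcal{H}}_{\xi\eta}\phi=\mathrm{H}R^M_{\xi\eta}\phi+2A_\phi^\dagger A_\xi\eta-A_\xi^\dagger A_\eta\phi+A_\eta^\dagger A_\xi\phi,$$ where $R^M$ is the curvature tensor of $M$. Consequently, if $\mathcal{H}M$ is the horizontal bundle of a Riemannian submersion $q:M\to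 B$, then $R^{\mathcal{H}}$ is the horizontal lift of the Riemannian curvature tensor of $B$. Alternatively, $$R^{\mathcal{H}}_{\xi\eta}\phi=2A^\dagger_\phi A_\xi\eta-(D_\xi(\mathrm{H}\mathring{\Gamma}))(\eta,\phi)+(D_\eta(\mathrm{H}\mathring{\Gamma}))(\xi,\phi)-\Gamma_{\mathcal{H}}(\xi,\Gamma_{\mathcal{H}}(\eta,\phi))+\Gamma_{\mathcal{H}}(\eta,\Gamma_{\mathcal{H}}(\xi,\phi)).$$
   Context: $\mathcal{E}$ is a finite-dimensional real inner product space. An embedded ambient structure $(M,g,\mathcal{E})$ consists of a Riemannian manifold $M$ differentiably embedded as a submanifold of $\mathcal{E}$ (so $T_xM\subset\mathcal{E}$, and vector fields are $\mathcal{E}$-valued functions) and a metric operator $g$: a smooth map $g:M\to L(\mathcal{E},\mathcal{E})$ with each $g_x$ (self-adjoint) positive-definite and $\langle\xi,g_x\eta\rangle_{\mathcal{E}}$ equal to the Riemannian inner product of $\xi,\eta\in T_xM$. $\Pi_x,\mathrm{H}_x,\mathrm{V}_x$ denote the projections of $\mathcal{E}$ onto $T_xM$, $\mathcal{H}_xM$, $\mathcal{V}_xM$, orthogonal for $\langle\cdot,g_x\cdot\rangle_{\mathcal{E}}$; they are smooth $L(\mathcal{E},\mathcal{E})$-valued functions on $M$ and $\Pi=\mathrm{H}+\mathrm{V}$. $D_\xi$ is the directional derivative of vector- or operator-valued functions on $M$. A Christoffel function is a smooth $\Gamma:M\to L(\mathcal{E}\otimes\mathcal{E},\mathcal{E})$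 with $\nabla_XY=D_XY+\Gamma(X,Y)$ for all vector fields $X,Y$, $\nabla$ being the Levi-Civita connection; fix one. $\mathring{\Gamma}$, $\Gamma_{\mathcal{H}}$, $\Gamma_{\mathcal{V}}$ are smooth maps $M\to L(\mathcal{E}\otimes\mathcal{E},\mathcal{E})$ satisfying, for $\xi\in T_xM$ and all $\omega\in\mathcal{E}$: $\mathring{\Gamma}(\xi,\omega)=(D_\xi\Pi)\omega+\Gamma(\xi,\omega)$, $\Gamma_{\mathcal{H}}(\xi,\omega)=-(D_\xi\mathrm{H})\omega+\mathrm{H}\mathring{\Gamma}(\xi,\omega)$, $\Gamma_{\mathcal{V}}(\xi,\omega)=-(D_\xi\mathrm{V})\omega+\mathrm{V}\mathring{\Gamma}(\xi,\omega)$. In $(D_\xi\Gamma_{\mathcal{H}})(\eta,\phi)$ and $(D_\xi(\mathrm{H}\mathring{\Gamma}))(\eta,\phi)$ the operator-valued function is differentiated with $\eta,\phi\in\mathcal{E}$ held fixed. For a Riemannian submersion $q:M\to B$, the vertical bundle is $\mathcal{V}M=\ker dq$ and the horizontal bundle $\mathcal{H}M$ is its orthogonal complement in $TM$. Curvature sign convention: $R_{X,Y}Z=\nabla_{[X,Y]}Z-\nabla_X\nabla_YZ+\nabla_Y\nabla_XZ$. *)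

theory Defs
  imports "HOL-Analysis.Analysis"
begin

section \<open>Calculus on subsets of a Euclidean space\<close>

primrec C_k_on ::
    "nat \<Rightarrow> ('a::euclidean_space \<Rightarrow> 'b::real_normed_vector) \<Rightarrow> 'a set \<Rightarrow> bool" where
  "C_k_on 0 = (\<lambda>f U. continuous_on U f)"
| "C_k_on (Suc n) = (\<lambda>f U. (\<forall>x\<in>U. f differentiable (at x)) \<and>
      (\<forall>v. C_k_on n (\<lambda>x. frechet_derivative f (at x) v) U))"

text \<open>Smoothness on an arbitrary subset \<open>S\<close> (in practice a submanifold): local existence of
  smooth extensions to open subsets of the surrounding space.\<close>

definition smooth_map :: "'a::euclidean_space set \<Rightarrow> ('a \<Rightarrow> 'b::real_normed_vector) \<Rightarrow> bool" where
  "smooth_map S f \<longleftrightarrow> (\<forall>x\<in>S. \<exists>U F. open U \<and> x \<in> U \<and> (\<forall>n. C_k_on n F U) \<and> (\<forall>y\<in>S \<inter> U. F y = f y))"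

definition embedded_submanifold :: "'a::euclidean_space set \<Rightarrow> bool" where
  "embedded_submanifold M \<longleftrightarrow> (\<exists>d. \<forall>x\<in>M. \<exists>U W \<Phi> \<Psi> K.
      open U \<and> x \<in> U \<and> open (W :: 'a set) \<and> homeomorphism U W \<Phi> \<Psi> \<and>
      smooth_map U \<Phi> \<and> smooth_map W \<Psi> \<and>
      subspace K \<and> dim K = d \<and> \<Phi> ` (U \<inter> M) = W \<inter> K)"

definition tangent_space :: "'a::euclidean_space set \<Rightarrow> 'a \<Rightarrow> 'a set" where
  "tangent_space S x = {v. \<exists>(\<gamma> :: real \<Rightarrow> 'a) e. e > 0 \<and> smooth_map {-e<..<e} \<gamma> \<and>
      \<gamma> ` {-e<..<e} \<subseteq> S \<and> \<gamma> 0 = x \<and> (\<gamma> has_vector_derivative v) (at 0)}"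

text \<open>The directional derivative \<open>D\<^sub>\<xi> f\<close> at \<open>x\<close>. A derivative of \<open>f\<close> within \<open>S\<close> is in general not
  unique as a linear map, but its value on vectors \<open>\<xi>\<close> tangent to \<open>S\<close> is: it is the derivative of
  \<open>f \<circ> \<gamma>\<close> for every curve \<open>\<gamma>\<close> in \<open>S\<close> with velocity \<open>\<xi>\<close>. It is only used for such \<open>\<xi>\<close>.\<close>

definition dir_deriv ::
    "'a::euclidean_space set \<Rightarrow> ('a \<Rightarrow> 'b::real_normed_vector) \<Rightarrow> 'a \<Rightarrow> 'a \<Rightarrow> 'b" where
  "dir_deriv S f x \<xi> = frechet_derivative f (at x within S) \<xi>"


section \<open>Riemannian metrics, connections and curvature on submanifolds\<close>

definition vector_field :: "'a::euclidean_space set \<Rightarrow> ('a \<Rightarrow> 'a) \<Rightarrow> bool" where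
  "vector_field S X \<longleftrightarrow> smooth_map S X \<and> (\<forall>x\<in>S. X x \<in> tangent_space S x)"

definition lie_bracket ::
    "'a::euclidean_space set \<Rightarrow> ('a \<Rightarrow> 'a) \<Rightarrow> ('a \<Rightarrow> 'a) \<Rightarrow> 'a \<Rightarrow> 'a" where
  "lie_bracket S X Y = (\<lambda>x. dir_deriv S Y x (X x) - dir_deriv S X x (Y x))"

definition inner_product_on :: "'a::real_vector set \<Rightarrow> ('a \<Rightarrow> 'a \<Rightarrow> real) \<Rightarrow> bool" where
  "inner_product_on T b \<longleftrightarrow>
     (\<forall>u\<in>T. \<forall>v\<in>T. \<forall>w\<in>T. b (u + v) w = b u w + b v w) \<and>
     (\<forall>a. \<forall>u\<in>T. \<forall>v\<in>T. b (a *\<^sub>R u) v = a * b u v) \<and>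
     (\<forall>u\<in>T. \<forall>v\<in>T. b u v = b v u) \<and>
     (\<forall>u\<in>T. u \<noteq> 0 \<longrightarrow> b u u > 0)"

definition riemannian_metric ::
    "'a::euclidean_space set \<Rightarrow> ('a \<Rightarrow> 'a \<Rightarrow> 'a \<Rightarrow> real) \<Rightarrow> bool" where
  "riemannian_metric S m \<longleftrightarrow>
     (\<forall>x\<in>S. inner_product_on (tangent_space S x) (m x)) \<and>
     (\<forall>X Y. vector_field S X \<and> vector_field S Y \<longrightarrow> smooth_map S (\<lambda>x. m x (X x) (Y x)))"

definition affine_connection ::
    "'a::euclidean_space set \<Rightarrow> (('a \<Rightarrow> 'a) \<Rightarrow> ('a \<Rightarrow> 'a) \<Rightarrow> 'a \<Rightarrow> 'a) \<Rightarrow> bool" where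
  "affine_connection S nab \<longleftrightarrow>
     (\<forall>X Y. vector_field S X \<and> vector_field S Y \<longrightarrow> vector_field S (nab X Y)) \<and>
     (\<forall>X X' Y. vector_field S X \<and> vector_field S X' \<and> vector_field S Y \<longrightarrow>
        (\<forall>x\<in>S. nab (\<lambda>y. X y + X' y) Y x = nab X Y x + nab X' Y x)) \<and>
     (\<forall>X Y f. vector_field S X \<and> vector_field S Y \<and> smooth_map S (f :: 'a \<Rightarrow> real) \<longrightarrow>
        (\<forall>x\<in>S. nab (\<lambda>y. f y *\<^sub>R X y) Y x = f x *\<^sub>R nab X Y x)) \<and>
     (\<forall>X Y Y'. vector_field S X \<and> vector_field S Y \<and> vector_field S Y' \<longrightarrow>
        (\<forall>x\<in>S. nab X (\<lambda>y. Y y + Y' y) x = nab X Y x + nab X Y' x)) \<and>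
     (\<forall>X Y f. vector_field S X \<and> vector_field S Y \<and> smooth_map S (f :: 'a \<Rightarrow> real) \<longrightarrow>
        (\<forall>x\<in>S. nab X (\<lambda>y. f y *\<^sub>R Y y) x = f x *\<^sub>R nab X Y x + dir_deriv S f x (X x) *\<^sub>R Y x))"

definition levi_civita ::
    "'a::euclidean_space set \<Rightarrow> ('a \<Rightarrow> 'a \<Rightarrow> 'a \<Rightarrow> real) \<Rightarrow>
     (('a \<Rightarrow> 'a) \<Rightarrow> ('a \<Rightarrow> 'a) \<Rightarrow> 'a \<Rightarrow> 'a) \<Rightarrow> bool" where
  "levi_civita S m nab \<longleftrightarrow> affine_connection S nab \<and>
     (\<forall>X Y. vector_field S X \<and> vector_field S Y \<longrightarrow>
        (\<forall>x\<in>S. nab X Y x - nab Y X x = lie_bracket S X Y x)) \<and>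
     (\<forall>X Y Z. vector_field S X \<and> vector_field S Y \<and> vector_field S Z \<longrightarrow>
        (\<forall>x\<in>S. dir_deriv S (\<lambda>y. m y (Y y) (Z y)) x (X x)
                 = m x (nab X Y x) (Z x) + m x (Y x) (nab X Z x)))"

text \<open>\<open>\<nabla>\<^sub>\<xi> Y\<close> for a single tangent vector \<open>\<xi>\<close> at \<open>x\<close>, and the curvature tensor on tangent vectors at
  \<open>x\<close>, are the common values of \<open>\<nabla>\<^sub>X Y\<close> and of \<open>R\<^sub>X\<^sub>Y Z\<close> at \<open>x\<close> over all vector fields extending the
  given vectors.\<close>

definition cov_deriv_at ::
    "'a::euclidean_space set \<Rightarrow> (('a \<Rightarrow> 'a) \<Rightarrow> ('a \<Rightarrow> 'a) \<Rightarrow> 'a \<Rightarrow> 'a) \<Rightarrow>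
     'a \<Rightarrow> 'a \<Rightarrow> ('a \<Rightarrow> 'a) \<Rightarrow> 'a" where
  "cov_deriv_at S nab x \<xi> Y = (THE r. \<forall>X. vector_field S X \<and> X x = \<xi> \<longrightarrow> nab X Y x = r)"

definition curvature_field ::
    "'a::euclidean_space set \<Rightarrow> (('a \<Rightarrow> 'a) \<Rightarrow> ('a \<Rightarrow> 'a) \<Rightarrow> 'a \<Rightarrow> 'a) \<Rightarrow>
     ('a \<Rightarrow> 'a) \<Rightarrow> ('a \<Rightarrow> 'a) \<Rightarrow> ('a \<Rightarrow> 'a) \<Rightarrow> 'a \<Rightarrow> 'a" where
  "curvature_field S nab X Y Z =
     (\<lambda>x. nab (lie_bracket S X Y) Z x - nab X (nab Y Z) x + nab Y (nab X Z) x)"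

definition curvature_tensor ::
    "'a::euclidean_space set \<Rightarrow> (('a \<Rightarrow> 'a) \<Rightarrow> ('a \<Rightarrow> 'a) \<Rightarrow> 'a \<Rightarrow> 'a) \<Rightarrow>
     'a \<Rightarrow> 'a \<Rightarrow> 'a \<Rightarrow> 'a \<Rightarrow> 'a" where
  "curvature_tensor S nab x \<xi> \<eta> \<phi> = (THE r. \<forall>X Y Z.
      vector_field S X \<and> vector_field S Y \<and> vector_field S Z \<and> X x = \<xi> \<and> Y x = \<eta> \<and> Z x = \<phi> \<longrightarrow>
      curvature_field S nab X Y Z x = r)"


section \<open>Embedded ambient structures and bundle decompositions\<close>

definition embedded_ambient_structure ::
    "'a::euclidean_space set \<Rightarrow> ('a \<Rightarrow> 'a \<Rightarrow> 'a \<Rightarrow> real) \<Rightarrow> ('a \<Rightarrow> 'a \<Rightarrow>\<^sub>L 'a) \<Rightarrow> bool" where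
  "embedded_ambient_structure M m g \<longleftrightarrow>
     embedded_submanifold M \<and> riemannian_metric M m \<and> smooth_map M g \<and>
     (\<forall>x\<in>M. (\<forall>u w. u \<bullet> g x w = g x u \<bullet> w) \<and> (\<forall>u. u \<noteq> 0 \<longrightarrow> u \<bullet> g x u > 0) \<and>
        (\<forall>\<xi>\<in>tangent_space M x. \<forall>\<eta>\<in>tangent_space M x. \<xi> \<bullet> g x \<eta> = m x \<xi> \<eta>))"

text \<open>\<open>P\<close> is the field of projections of the whole Euclidean space onto the fibres \<open>F x\<close>,
  orthogonal with respect to \<open>\<langle>\<cdot>, g\<^sub>x \<cdot>\<rangle>\<close>, and it is smooth. A family of subspaces \<open>F\<close> is a smooth
  subbundle precisely when this projection field is smooth.\<close>

definition projection_field ::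
    "'a::euclidean_space set \<Rightarrow> ('a \<Rightarrow> 'a \<Rightarrow>\<^sub>L 'a) \<Rightarrow> ('a \<Rightarrow> 'a set) \<Rightarrow> ('a \<Rightarrow> 'a \<Rightarrow>\<^sub>L 'a) \<Rightarrow> bool" where
  "projection_field M g F P \<longleftrightarrow> smooth_map M P \<and>
     (\<forall>x\<in>M. \<forall>w. P x w \<in> F x \<and> (\<forall>s\<in>F x. s \<bullet> g x (w - P x w) = 0))"

definition orthogonal_decomposition ::
    "'a::euclidean_space set \<Rightarrow> ('a \<Rightarrow> 'a \<Rightarrow> 'a \<Rightarrow> real) \<Rightarrow> ('a \<Rightarrow> 'a set) \<Rightarrow> ('a \<Rightarrow> 'a set) \<Rightarrow> bool" where
  "orthogonal_decomposition M m HM VM \<longleftrightarrow> (\<forall>x\<in>M. subspace (HM x) \<and> subspace (VM x) \<and>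
     tangent_space M x = {h + v | h v. h \<in> HM x \<and> v \<in> VM x} \<and>
     (\<forall>h\<in>HM x. \<forall>v\<in>VM x. m x h v = 0))"

definition christoffel_function ::
    "'a::euclidean_space set \<Rightarrow> (('a \<Rightarrow> 'a) \<Rightarrow> ('a \<Rightarrow> 'a) \<Rightarrow> 'a \<Rightarrow> 'a) \<Rightarrow>
     ('a \<Rightarrow> 'a \<Rightarrow>\<^sub>L 'a \<Rightarrow>\<^sub>L 'a) \<Rightarrow> bool" where
  "christoffel_function M nab \<Gamma> \<longleftrightarrow> smooth_map M \<Gamma> \<and>
     (\<forall>X Y. vector_field M X \<and> vector_field M Y \<longrightarrow>
        (\<forall>x\<in>M. nab X Y x = dir_deriv M Y x (X x) + \<Gamma> x (X x) (Y x)))"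

text \<open>Adjoint of an operator on the whole Euclidean space for the inner product \<open>\<langle>\<cdot>, G \<cdot>\<rangle>\<close>.\<close>

definition metric_adjoint :: "('a::euclidean_space \<Rightarrow>\<^sub>L 'a) \<Rightarrow> ('a \<Rightarrow> 'a) \<Rightarrow> 'a \<Rightarrow> 'a" where
  "metric_adjoint G f = (SOME f'. \<forall>u w. f u \<bullet> G w = u \<bullet> G (f' w))"

text \<open>\<open>A\<^sub>\<xi> \<omega> = V \<nabla>\<^sub>\<xi> (H \<omega>)\<close>, where \<open>\<omega>\<close> is a constant vector and \<open>H \<omega>\<close> the vector field
  \<open>y \<mapsto> H\<^sub>y \<omega>\<close>.\<close>

definition oneill_A ::
    "'a::euclidean_space set \<Rightarrow> (('a \<Rightarrow> 'a) \<Rightarrow> ('a \<Rightarrow> 'a) \<Rightarrow> 'a \<Rightarrow> 'a) \<Rightarrow>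
     ('a \<Rightarrow> 'a \<Rightarrow>\<^sub>L 'a) \<Rightarrow> ('a \<Rightarrow> 'a \<Rightarrow>\<^sub>L 'a) \<Rightarrow> 'a \<Rightarrow> 'a \<Rightarrow> 'a \<Rightarrow> 'a" where
  "oneill_A M nab H V x \<xi> \<omega> = V x (cov_deriv_at M nab x \<xi> (\<lambda>y. H y \<omega>))"

definition oneill_A_adj ::
    "'a::euclidean_space set \<Rightarrow> ('a \<Rightarrow> 'a \<Rightarrow>\<^sub>L 'a) \<Rightarrow> (('a \<Rightarrow> 'a) \<Rightarrow> ('a \<Rightarrow> 'a) \<Rightarrow> 'a \<Rightarrow> 'a) \<Rightarrow>
     ('a \<Rightarrow> 'a \<Rightarrow>\<^sub>L 'a) \<Rightarrow> ('a \<Rightarrow> 'a \<Rightarrow>\<^sub>L 'a) \<Rightarrow> 'a \<Rightarrow> 'a \<Rightarrow> 'a \<Rightarrow> 'a" where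
  "oneill_A_adj M g nab H V x \<xi> = metric_adjoint (g x) (oneill_A M nab H V x \<xi>)"

definition horizontal_curvature ::
    "'a::euclidean_space set \<Rightarrow> ('a \<Rightarrow> 'a \<Rightarrow>\<^sub>L 'a) \<Rightarrow> (('a \<Rightarrow> 'a) \<Rightarrow> ('a \<Rightarrow> 'a) \<Rightarrow> 'a \<Rightarrow> 'a) \<Rightarrow>
     ('a \<Rightarrow> 'a \<Rightarrow>\<^sub>L 'a) \<Rightarrow> ('a \<Rightarrow> 'a \<Rightarrow>\<^sub>L 'a) \<Rightarrow> ('a \<Rightarrow> 'a \<Rightarrow>\<^sub>L 'a \<Rightarrow>\<^sub>L 'a) \<Rightarrow>
     'a \<Rightarrow> 'a \<Rightarrow> 'a \<Rightarrow> 'a \<Rightarrow> 'a" where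
  "horizontal_curvature M g nab H V \<Gamma>H x \<xi> \<eta> \<phi> =
     2 *\<^sub>R oneill_A_adj M g nab H V x \<phi> (oneill_A M nab H V x \<xi> \<eta>)
     - dir_deriv M (\<lambda>y. \<Gamma>H y \<eta> \<phi>) x \<xi> + dir_deriv M (\<lambda>y. \<Gamma>H y \<xi> \<phi>) x \<eta>
     - \<Gamma>H x \<xi> (\<Gamma>H x \<eta> \<phi>) + \<Gamma>H x \<eta> (\<Gamma>H x \<xi> \<phi>)"


section \<open>Abstract Riemannian manifolds and Riemannian submersions\<close>

text \<open>A manifold \<open>B\<close> is a topological space with an atlas of charts onto relatively open subsets
  of a fixed linear subspace \<open>L\<close> of a Euclidean space, \<open>dim L\<close> being the dimension of \<open>B\<close>. (Taking
  \<open>L\<close> instead of the whole type includes dimension zero, since Euclidean space types have positive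
  dimension.) Tensors on \<open>B\<close> are given by their representatives in the charts: a tangent vector at
  \<open>b\<close> is the family of its representatives in \<open>L\<close>, indexed by the charts around \<open>b\<close>.\<close>

type_synonym ('b, 'f) chart = "'b set \<times> ('b \<Rightarrow> 'f)"

definition smooth_atlas ::
    "'b topology \<Rightarrow> 'f::euclidean_space set \<Rightarrow> ('b, 'f) chart set \<Rightarrow> bool" where
  "smooth_atlas B L A \<longleftrightarrow> Hausdorff_space B \<and> second_countable B \<and> subspace L \<and>
     (\<Union>(U, c)\<in>A. U) = topspace B \<and>
     (\<forall>(U, c)\<in>A. openin B U \<and> openin (top_of_set L) (c ` U) \<and>
        homeomorphic_map (subtopology B U) (top_of_set (c ` U)) c) \<and>
     (\<forall>(U, c)\<in>A. \<forall>(U', c')\<in>A. smooth_map (c ` (U \<inter> U')) (c' \<circ> inv_into U c))"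

text \<open>The last condition says that the chart representatives of the metric transform under the
  coordinate changes \<open>\<tau> = c' \<circ> c\<^sup>-\<^sup>1\<close> as a covariant tensor.\<close>

definition riemannian_manifold ::
    "'b topology \<Rightarrow> 'f::euclidean_space set \<Rightarrow> ('b, 'f) chart set \<Rightarrow>
     (('b, 'f) chart \<Rightarrow> 'f \<Rightarrow> 'f \<Rightarrow> 'f \<Rightarrow> real) \<Rightarrow> bool" where
  "riemannian_manifold B L A mB \<longleftrightarrow> smooth_atlas B L A \<and>
     (\<forall>(U, c)\<in>A. riemannian_metric (c ` U) (mB (U, c))) \<and>
     (\<forall>(U, c)\<in>A. \<forall>(U', c')\<in>A. \<forall>b\<in>U \<inter> U'. \<forall>u\<in>L. \<forall>v\<in>L.
        let \<tau> = c' \<circ> inv_into U c; d\<tau> = dir_deriv (c ` (U \<inter> U')) \<tau> (c b)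
        in mB (U, c) (c b) u v = mB (U', c') (c' b) (d\<tau> u) (d\<tau> v))"

text \<open>The Levi-Civita connection of \<open>B\<close>, given by its restrictions to the chart domains.\<close>

definition levi_civita_charts ::
    "('b, 'f::euclidean_space) chart set \<Rightarrow> (('b, 'f) chart \<Rightarrow> 'f \<Rightarrow> 'f \<Rightarrow> 'f \<Rightarrow> real) \<Rightarrow>
     (('b, 'f) chart \<Rightarrow> ('f \<Rightarrow> 'f) \<Rightarrow> ('f \<Rightarrow> 'f) \<Rightarrow> 'f \<Rightarrow> 'f) \<Rightarrow> bool" where
  "levi_civita_charts A mB nabB \<longleftrightarrow>
     (\<forall>(U, c)\<in>A. levi_civita (c ` U) (mB (U, c)) (nabB (U, c)))"

definition curvature_charts ::
    "(('b, 'f::euclidean_space) chart \<Rightarrow> ('f \<Rightarrow> 'f) \<Rightarrow> ('f \<Rightarrow> 'f) \<Rightarrow> 'f \<Rightarrow> 'f) \<Rightarrow> 'b \<Rightarrow>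
     (('b, 'f) chart \<Rightarrow> 'f) \<Rightarrow> (('b, 'f) chart \<Rightarrow> 'f) \<Rightarrow> (('b, 'f) chart \<Rightarrow> 'f) \<Rightarrow> ('b, 'f) chart \<Rightarrow> 'f" where
  "curvature_charts nabB b u v w = (\<lambda>(U, c).
     curvature_tensor (c ` U) (nabB (U, c)) (c b) (u (U, c)) (v (U, c)) (w (U, c)))"

definition differential_charts ::
    "'a::euclidean_space set \<Rightarrow> ('a \<Rightarrow> 'b) \<Rightarrow> 'a \<Rightarrow> 'a \<Rightarrow> ('b, 'f::euclidean_space) chart \<Rightarrow> 'f" where
  "differential_charts M q x \<xi> = (\<lambda>(U, c). dir_deriv M (c \<circ> q) x \<xi>)"

definition vertical_space ::
    "'a::euclidean_space set \<Rightarrow> ('b, 'f::euclidean_space) chart set \<Rightarrow> ('a \<Rightarrow> 'b) \<Rightarrow> 'a \<Rightarrow> 'a set" where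
  "vertical_space M A q x = {\<xi> \<in> tangent_space M x.
     \<forall>(U, c)\<in>A. q x \<in> U \<longrightarrow> differential_charts M q x \<xi> (U, c) = 0}"

definition horizontal_space ::
    "'a::euclidean_space set \<Rightarrow> ('a \<Rightarrow> 'a \<Rightarrow> 'a \<Rightarrow> real) \<Rightarrow> ('b, 'f::euclidean_space) chart set \<Rightarrow>
     ('a \<Rightarrow> 'b) \<Rightarrow> 'a \<Rightarrow> 'a set" where
  "horizontal_space M m A q x =
     {\<xi> \<in> tangent_space M x. \<forall>\<eta>\<in>vertical_space M A q x. m x \<xi> \<eta> = 0}"

definition riemannian_submersion ::
    "'a::euclidean_space set \<Rightarrow> ('a \<Rightarrow> 'a \<Rightarrow> 'a \<Rightarrow> real) \<Rightarrow>
     'b topology \<Rightarrow> 'f::euclidean_space set \<Rightarrow> ('b, 'f) chart set \<Rightarrow>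
     (('b, 'f) chart \<Rightarrow> 'f \<Rightarrow> 'f \<Rightarrow> 'f \<Rightarrow> real) \<Rightarrow> ('a \<Rightarrow> 'b) \<Rightarrow> bool" where
  "riemannian_submersion M m B L A mB q \<longleftrightarrow>
     continuous_map (top_of_set M) B q \<and>
     (\<forall>(U, c)\<in>A. smooth_map (M \<inter> q -` U) (c \<circ> q)) \<and>
     (\<forall>x\<in>M. \<forall>(U, c)\<in>A. q x \<in> U \<longrightarrow>
        (\<lambda>\<xi>. differential_charts M q x \<xi> (U, c)) ` tangent_space M x = L \<and>
        (\<forall>\<xi>\<in>horizontal_space M m A q x. \<forall>\<eta>\<in>horizontal_space M m A q x.
           mB (U, c) (c (q x)) (differential_charts M q x \<xi> (U, c)) (differential_charts M q x \<eta> (U, c))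
             = m x \<xi> \<eta>))"

definition is_horizontal_lift ::
    "'a::euclidean_space set \<Rightarrow> ('a \<Rightarrow> 'a \<Rightarrow> 'a \<Rightarrow> real) \<Rightarrow> ('b, 'f::euclidean_space) chart set \<Rightarrow>
     ('a \<Rightarrow> 'b) \<Rightarrow> 'a \<Rightarrow> (('b, 'f) chart \<Rightarrow> 'f) \<Rightarrow> 'a \<Rightarrow> bool" where
  "is_horizontal_lift M m A q x w \<xi> \<longleftrightarrow> \<xi> \<in> horizontal_space M m A q x \<and>
     (\<forall>(U, c)\<in>A. q x \<in> U \<longrightarrow> differential_charts M q x \<xi> (U, c) = w (U, c))"

end

theory Submission
  imports Defs
begin

text \<open>
The horizontal bundle carries the connection \<open>Z \<mapsto> H \<nabla>\<^sub>X Z\<close>. Differentiating \<open>H Z = Z\<close> shows that for horizontal \<open>Z\<close>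
it equals \<open>D\<^sub>X Z + \<Gamma>H(X, Z)\<close>, while differentiating \<open>H U = 0\<close> shows \<open>H \<nabla>\<^sub>X U = \<Gamma>H(X, U)\<close> for vertical \<open>U\<close>
(\<open>projected_covariant_derivative\<close>). Thus \<open>\<Gamma>H\<close> is at the same time a Christoffel function of the
horizontal connection and, up to sign, the adjoint \<open>A\<^sup>*\<close> of O'Neill's tensor; in the same way \<open>\<Gamma>V\<close> gives \<open>A\<close>.

Every connection of the form \<open>D\<^sub>X Z + C(X, Z)\<close> has the curvature
\<open>- (D\<^sub>\<xi> C)(\<eta>, \<phi>) + (D\<^sub>\<eta> C)(\<xi>, \<phi>) - C(\<xi>, C(\<eta>, \<phi>)) + C(\<eta>, C(\<xi>, \<phi>))\<close>, because the second derivatives of \<open>Z\<close>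
cancel (\<open>bundle_curvature\<close>). For \<open>C = \<Gamma>\<close> this is the curvature of \<open>M\<close>; for \<open>C = \<Gamma>H\<close> it is the given
expression \<open>R\<^sup>H\<close> without its first term \<open>2 A\<^sup>*\<^sub>\<phi> A\<^sub>\<xi> \<eta>\<close>. Splitting \<open>\<nabla>\<^sub>Y Z\<close> into horizontal and vertical
parts inside \<open>H \<nabla>\<^sub>X \<nabla>\<^sub>Y Z\<close> relates the two curvatures (\<open>connection_H_curvature\<close>), which is the O'Neill
equation. In the alternative expression \<open>\<Gamma>H\<close> is replaced by \<open>H \<Gamma>0\<close>; their difference is a first derivative
of \<open>H\<close>, and its contribution vanishes by the symmetry of second derivatives (\<open>dir_deriv_H_Gamma0\<close>).

For a Riemannian submersion let \<open>f\<close> be the submersion followed by a chart of the base, and compare the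
connection of the base, pulled back along \<open>f\<close>, with that of \<open>M\<close> by means of the Hessian \<open>\<nabla>df\<close>. It is
symmetric since both connections are torsion-free. Since both are metric and \<open>df\<close> is isometric on
horizontal vectors, \<open>\<langle>\<nabla>df(\<xi>, \<eta>), df \<phi>\<rangle>\<close> is skew in horizontal \<open>\<eta>\<close> and \<open>\<phi>\<close>. Hence \<open>\<nabla>df\<close> vanishes on pairs of
horizontal vectors (\<open>hessian_horizontal\<close>), it equals \<open>df A\<^sup>*\<^sub>\<xi> v\<close> if the second argument \<open>v\<close> is vertical
(\<open>hessian_vertical\<close>), and \<open>A\<close> is skew on horizontal vectors (\<open>A_alternating\<close>). For horizontal fields \<open>X\<close>,
\<open>Y\<close>, \<open>Z\<close> the pullback connection applied to \<open>df Z\<close> is therefore \<open>df\<close> of the horizontal connection, except in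
the direction of the vertical part \<open>2 A\<^sub>\<xi> \<eta>\<close> of \<open>[X, Y]\<close>. That direction produces \<open>df (2 A\<^sup>*\<^sub>\<phi> A\<^sub>\<xi> \<eta>)\<close>, the first
term of \<open>R\<^sup>H\<close>, so the curvature of the base is \<open>df R\<^sup>H\<close> (\<open>horizontal_lift_curvature\<close>). Working
with the pullback connection makes it possible to use horizontal projections of constant vectors for
\<open>X\<close>, \<open>Y\<close>, \<open>Z\<close>, instead of horizontal lifts of fields on the base.
\<close>

section \<open>Smooth maps on subsets of a Euclidean space\<close>

lemma frechet_derivative_apply:
  "(f has_derivative f') (at x) \<Longrightarrow> frechet_derivative f (at x) v = f' v"
  by (metis frechet_derivative_at)

lemmas has_frechet_derivative = frechet_derivative_works[THEN iffD1]

lemma C_k_on_cong: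
  assumes "open U" "\<And>x. x \<in> U \<Longrightarrow> f x = g x" "C_k_on n f U"
  shows "C_k_on n g U"
  using assms(2,3)
proof (induction n arbitrary: f g)
  case 0
  then show ?case using continuous_on_eq by auto
next
  case (Suc n)
  have d: "(g has_derivative frechet_derivative f (at x)) (at x)" if "x \<in> U" for x
    by (rule has_derivative_transform_within_open[OF has_frechet_derivative assms(1) that])
      (use Suc.prems that in auto)
  have "C_k_on n (\<lambda>x. frechet_derivative g (at x) v) U" for v
    by (rule Suc.IH[of "\<lambda>x. frechet_derivative f (at x) v"])
      (use Suc.prems(2) frechet_derivative_apply[OF d] in simp_all)
  then show ?case using differentiableI[OF d] by auto
qed

lemma C_k_on_subset: "C_k_on n f U \<Longrightarrow> V \<subseteq> U \<Longrightarrow> C_k_on n f V"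
  by (induction n arbitrary: f) (auto intro: continuous_on_subset)

lemma C_k_on_const: "C_k_on n (\<lambda>x. c) U"
  by (induction n arbitrary: c) auto

lemma C_k_on_ident: "C_k_on n (\<lambda>x. x) U"
  by (cases n) (auto simp: C_k_on_const)

lemma C_k_on_add:
  assumes "open U" "C_k_on n f U" "C_k_on n g U"
  shows "C_k_on n (\<lambda>x. f x + g x) U"
  using assms(2,3)
proof (induction n arbitrary: f g)
  case 0
  then show ?case by (simp add: continuous_on_add)
next
  case (Suc n)
  let ?D = "\<lambda>h x. frechet_derivative h (at x)"
  have fg: "f differentiable (at x)" "g differentiable (at x)" if "x \<in> U" for x
    using Suc.prems that by auto
  have d: "((\<lambda>x. f x + g x) has_derivative (\<lambda>v. ?D f x v + ?D g x v)) (at x)" if "x \<in> U" for x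
    by (rule has_derivative_add[OF has_frechet_derivative[OF fg(1)[OF that]]
          has_frechet_derivative[OF fg(2)[OF that]]])
  have D: "C_k_on n (\<lambda>x. ?D f x v) U" "C_k_on n (\<lambda>x. ?D g x v) U" for v
    using Suc.prems by auto
  have "C_k_on n (\<lambda>x. ?D f x v + ?D g x v) U" for v
    by (rule Suc.IH[OF D])
  then have "C_k_on n (\<lambda>x. ?D (\<lambda>x. f x + g x) x v) U" for v
    by (rule C_k_on_cong[OF assms(1), rotated]) (simp add: frechet_derivative_apply[OF d])
  moreover have "\<forall>x\<in>U. (\<lambda>x. f x + g x) differentiable (at x)"
    using differentiableI[OF d] by blast
  ultimately show ?case by simp
qed

text \<open>The hypothesis that the factors are of class \<open>C\<^sup>k\<close> for every \<open>k\<close> passes to their derivatives, so the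
induction hypothesis applies to both terms of the product rule.\<close>

lemma C_k_on_bilinear:
  assumes "bounded_bilinear b" "open U" "\<And>n. C_k_on n f U" "\<And>n. C_k_on n g U"
  shows "C_k_on n (\<lambda>x. b (f x) (g x)) U"
  using assms(3,4)
proof (induction n arbitrary: f g)
  case 0
  have "continuous_on U f" "continuous_on U g" using 0(1)[of 0] 0(2)[of 0] by simp_all
  then have "continuous_on U (\<lambda>x. b (f x) (g x))" by (rule bounded_bilinear.continuous_on[OF assms(1)])
  then show ?case by simp
next
  case (Suc n)
  let ?D = "\<lambda>h x. frechet_derivative h (at x)"
  have fg: "f differentiable (at x)" "g differentiable (at x)" if "x \<in> U" for x
    using Suc.prems(1)[of "Suc 0"] Suc.prems(2)[of "Suc 0"] that by simp_all
  have d: "((\<lambda>x. b (f x) (g x)) has_derivative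
      (\<lambda>v. b (f x) (?D g x v) + b (?D f x v) (g x))) (at x)" if "x \<in> U" for x
    by (rule bounded_bilinear.FDERIV[OF assms(1) has_frechet_derivative[OF fg(1)[OF that]]
          has_frechet_derivative[OF fg(2)[OF that]]])
  have D: "C_k_on k (\<lambda>x. ?D f x v) U" "C_k_on k (\<lambda>x. ?D g x v) U" for k v
    using Suc.prems(1)[of "Suc k"] Suc.prems(2)[of "Suc k"] by simp_all
  have "C_k_on n (\<lambda>x. b (f x) (?D g x v) + b (?D f x v) (g x)) U" for v
    by (rule C_k_on_add[OF assms(2) Suc.IH[OF Suc.prems(1) D(2)] Suc.IH[OF D(1) Suc.prems(2)]])
  then have "C_k_on n (\<lambda>x. ?D (\<lambda>x. b (f x) (g x)) x v) U" for v
    by (rule C_k_on_cong[OF assms(2), rotated]) (simp add: frechet_derivative_apply[OF d])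
  moreover have "\<forall>x\<in>U. (\<lambda>x. b (f x) (g x)) differentiable (at x)"
    using differentiableI[OF d] by blast
  ultimately show ?case by simp
qed

lemma C_k_on_bounded_linear:
  assumes "bounded_linear h" "open U" "C_k_on n f U"
  shows "C_k_on n (\<lambda>x. h (f x)) U"
  using assms(3)
proof (induction n arbitrary: f)
  case 0
  then show ?case using bounded_linear.continuous_on[OF assms(1)] by auto
next
  case (Suc n)
  have d: "((\<lambda>x. h (f x)) has_derivative (\<lambda>v. h (frechet_derivative f (at x) v))) (at x)"
    if "x \<in> U" for x
    by (rule bounded_linear.has_derivative[OF assms(1) has_frechet_derivative]) (use Suc.prems that in auto)
  have "C_k_on n (\<lambda>x. h (frechet_derivative f (at x) v)) U" for v
    using Suc by auto
  then have "C_k_on n (\<lambda>x. frechet_derivative (\<lambda>x. h (f x)) (at x) v) U" for v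
    by (rule C_k_on_cong[OF assms(2), rotated]) (simp add: frechet_derivative_apply[OF d])
  moreover have "\<forall>x\<in>U. (\<lambda>x. h (f x)) differentiable (at x)"
    using differentiableI[OF d] by blast
  ultimately show ?case by simp
qed

lemma smooth_map_cong:
  assumes "\<And>x. x \<in> S \<Longrightarrow> f x = g x"
  shows "smooth_map S f \<longleftrightarrow> smooth_map S g"
proof -
  have "(\<forall>y\<in>S \<inter> U. F y = f y) \<longleftrightarrow> (\<forall>y\<in>S \<inter> U. F y = g y)" for U F
    using assms by auto
  then show ?thesis by (simp add: smooth_map_def)
qed

lemma smooth_mapE:
  assumes "smooth_map S f" "x \<in> S"
  obtains U F where "open U" "x \<in> U" "\<And>n. C_k_on n F U" "\<And>y. y \<in> S \<Longrightarrow> y \<in> U \<Longrightarrow> F y = f y"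
proof -
  obtain U F where "open U \<and> x \<in> U \<and> (\<forall>n. C_k_on n F U) \<and> (\<forall>y\<in>S \<inter> U. F y = f y)"
    using bspec[OF assms(1)[unfolded smooth_map_def] assms(2)] by (elim exE)
  then show ?thesis by (intro that[of U F]) simp_all
qed

lemma smooth_mapI:
  assumes "\<And>x. x \<in> S \<Longrightarrow> \<exists>U F. open U \<and> x \<in> U \<and> (\<forall>n. C_k_on n F U) \<and> (\<forall>y\<in>S \<inter> U. F y = f y)"
  shows "smooth_map S f"
  unfolding smooth_map_def by (rule ballI[OF assms])

lemma smooth_map_subset:
  assumes "smooth_map S f" "T \<subseteq> S"
  shows "smooth_map T f"
proof (rule smooth_mapI)
  fix x assume "x \<in> T"
  then have "x \<in> S" using assms(2) by auto
  then obtain U F where "open U" "x \<in> U" "\<And>n. C_k_on n F U" "\<And>y. y \<in> S \<Longrightarrow> y \<in> U \<Longrightarrow> F y = f y"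
    using smooth_mapE[OF assms(1)] by metis
  then show "\<exists>U F. open U \<and> x \<in> U \<and> (\<forall>n. C_k_on n F U) \<and> (\<forall>y\<in>T \<inter> U. F y = f y)"
    using assms(2) by (intro exI[of _ U] exI[of _ F]) auto
qed

lemma smooth_map_const: "smooth_map S (\<lambda>x. c)"
  unfolding smooth_map_def by (intro ballI exI[of _ UNIV] exI[of _ "\<lambda>x. c"]) (simp add: C_k_on_const)

lemma smooth_map_ident: "smooth_map S (\<lambda>x. x)"
  unfolding smooth_map_def by (intro ballI exI[of _ UNIV] exI[of _ "\<lambda>x. x"]) (simp add: C_k_on_ident)

lemma smooth_map_bounded_linear:
  assumes "bounded_linear h" "smooth_map S f"
  shows "smooth_map S (\<lambda>x. h (f x))"
  unfolding smooth_map_def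
proof
  fix x assume "x \<in> S"
  then obtain U F where "open U" "x \<in> U" "\<forall>n. C_k_on n F U" "\<forall>y\<in>S \<inter> U. F y = f y"
    using assms(2) unfolding smooth_map_def by metis
  then show "\<exists>U F. open U \<and> x \<in> U \<and> (\<forall>n. C_k_on n F U) \<and> (\<forall>y\<in>S \<inter> U. F y = h (f y))"
    by (intro exI[of _ U] exI[of _ "\<lambda>x. h (F x)"]) (auto intro!: C_k_on_bounded_linear[OF assms(1)])
qed

text \<open>Local extensions of two maps have different domains; both are restricted to the intersection. Sums
and bounded bilinear products are the instances used below.\<close>

lemma smooth_map_binary:
  fixes S :: "'a::euclidean_space set"
  assumes b: "\<And>(U :: 'a set) F G n. open U \<Longrightarrow> (\<And>n. C_k_on n F U) \<Longrightarrow> (\<And>n. C_k_on n G U) \<Longrightarrow>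
      C_k_on n (\<lambda>x. b (F x) (G x)) U"
    and "smooth_map S f" "smooth_map S g"
  shows "smooth_map S (\<lambda>x. b (f x) (g x))"
  unfolding smooth_map_def
proof
  fix x assume x: "x \<in> S"
  obtain U F where U: "open U" "x \<in> U" "\<forall>n. C_k_on n F U" "\<forall>y\<in>S \<inter> U. F y = f y"
    using assms(2) x unfolding smooth_map_def by metis
  obtain W G where W: "open W" "x \<in> W" "\<forall>n. C_k_on n G W" "\<forall>y\<in>S \<inter> W. G y = g y"
    using assms(3) x unfolding smooth_map_def by metis
  have "C_k_on n (\<lambda>x. b (F x) (G x)) (U \<inter> W)" for n
    by (rule b) (use U W C_k_on_subset[of _ F U "U \<inter> W"] C_k_on_subset[of _ G W "U \<inter> W"] in auto)
  then show "\<exists>U F. open U \<and> x \<in> U \<and> (\<forall>n. C_k_on n F U) \<and> (\<forall>y\<in>S \<inter> U. F y = b (f y) (g y))"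
    using U W by (intro exI[of _ "U \<inter> W"] exI[of _ "\<lambda>x. b (F x) (G x)"]) auto
qed

lemma smooth_map_bilinear:
  assumes "bounded_bilinear b" "smooth_map S f" "smooth_map S g"
  shows "smooth_map S (\<lambda>x. b (f x) (g x))"
  by (rule smooth_map_binary[OF _ assms(2,3)]) (rule C_k_on_bilinear[OF assms(1)])

lemma smooth_map_add:
  "smooth_map S f \<Longrightarrow> smooth_map S g \<Longrightarrow> smooth_map S (\<lambda>x. f x + g x)"
  by (rule smooth_map_binary[where b = "(+)"]) (rule C_k_on_add)

lemma smooth_map_diff:
  assumes "smooth_map S f" "smooth_map S g"
  shows "smooth_map S (\<lambda>x. f x - g x)"
  using smooth_map_add[OF assms(1) smooth_map_bounded_linear[OF bounded_linear_minus[OF bounded_linear_ident] assms(2)]]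
  by simp

lemma smooth_map_sum:
  "(\<And>i. i \<in> I \<Longrightarrow> smooth_map S (f i)) \<Longrightarrow> smooth_map S (\<lambda>x. \<Sum>i\<in>I. f i x)"
  by (induction I rule: infinite_finite_induct) (auto intro: smooth_map_const smooth_map_add)

lemmas smooth_map_blinfun_apply = smooth_map_bilinear[OF bounded_bilinear_blinfun_apply]

lemma smooth_map_differentiable:
  assumes "smooth_map S f" "x \<in> S"
  shows "f differentiable (at x within S)"
proof -
  obtain U F where U: "open U" "x \<in> U" "\<forall>n. C_k_on n F U" "\<forall>y\<in>S \<inter> U. F y = f y"
    using assms unfolding smooth_map_def by metis
  then have "F differentiable (at x)" using U(3)[rule_format, of "Suc 0"] by auto
  then obtain D where "(F has_derivative D) (at x within S)"
    using differentiable_def has_derivative_at_withinI by blast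
  moreover obtain e where "e > 0" "ball x e \<subseteq> U" using U openE by blast
  ultimately have "(f has_derivative D) (at x within S)"
    using has_derivative_transform_within[of F D x S e f] U(4) assms(2)
    by (auto simp: subset_iff dist_commute)
  then show ?thesis using differentiableI by blast
qed

section \<open>Directional derivatives along tangent vectors\<close>

lemma has_derivative_dir_deriv:
  "f differentiable (at x within S) \<Longrightarrow> (f has_derivative dir_deriv S f x) (at x within S)"
  unfolding dir_deriv_def[abs_def] by (simp add: frechet_derivative_works)

text \<open>A derivative within \<open>S\<close> is composed with a curve in \<open>S\<close> that has velocity \<open>v\<close>; the derivative of the
composition at an interior point of an interval is unique, and it is the value at \<open>v\<close>. All
differentiation rules for \<open>dir_deriv\<close> follow from this and from the rules for \<open>has_derivative\<close>.\<close>

lemma dir_deriv_eq: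
  assumes "(f has_derivative D) (at x within S)" "v \<in> tangent_space S x"
  shows "dir_deriv S f x v = D v"
proof -
  obtain \<gamma> :: "real \<Rightarrow> 'a" and e where e: "e > 0" "\<gamma> ` {-e<..<e} \<subseteq> S" "\<gamma> 0 = x"
    "(\<gamma> has_vector_derivative v) (at 0)"
    using assms(2) unfolding tangent_space_def by auto
  have gv: "(\<gamma> has_derivative (\<lambda>t. t *\<^sub>R v)) (at 0 within {-e<..<e})"
    using e(4) has_derivative_at_withinI unfolding has_vector_derivative_def by blast
  have *: "((\<lambda>t. f (\<gamma> t)) has_derivative (\<lambda>t. E (t *\<^sub>R v))) (at 0)"
    if "(f has_derivative E) (at x within S)" for E
  proof -
    have "(f has_derivative E) (at (\<gamma> 0) within \<gamma> ` {-e<..<e})"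
      using that e(2,3) by (auto intro: has_derivative_subset)
    then have "((\<lambda>t. f (\<gamma> t)) has_derivative (\<lambda>t. E (t *\<^sub>R v))) (at 0 within {-e<..<e})"
      by (rule has_derivative_in_compose[OF gv])
    then show ?thesis using e(1) at_within_open[of "0::real" "{-e<..<e}"] by simp
  qed
  have "(\<lambda>t. dir_deriv S f x (t *\<^sub>R v)) = (\<lambda>t. D (t *\<^sub>R v))"
    by (rule has_derivative_unique[OF *[OF has_derivative_dir_deriv[OF differentiableI[OF assms(1)]]]
          *[OF assms(1)]])
  then show ?thesis by (metis scaleR_one)
qed

lemma dir_deriv_cong:
  assumes "\<And>y. y \<in> S \<Longrightarrow> f y = g y" "x \<in> S"
  shows "dir_deriv S f x = dir_deriv S g x"
proof -
  have "(f has_derivative D) (at x within S) \<longleftrightarrow> (g has_derivative D) (at x within S)" for D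
    using has_derivative_transform[of x S f g] has_derivative_transform[of x S g f] assms by auto
  then show ?thesis by (simp add: dir_deriv_def[abs_def] frechet_derivative_def)
qed

lemma bounded_linear_dir_deriv:
  "f differentiable (at x within S) \<Longrightarrow> bounded_linear (dir_deriv S f x)"
  using has_derivative_dir_deriv has_derivative_bounded_linear by blast

lemma dir_deriv_const: "v \<in> tangent_space S x \<Longrightarrow> dir_deriv S (\<lambda>y. c) x v = 0"
  by (rule dir_deriv_eq[OF has_derivative_const])

lemma dir_deriv_add:
  assumes "f differentiable (at x within S)" "g differentiable (at x within S)" "v \<in> tangent_space S x"
  shows "dir_deriv S (\<lambda>y. f y + g y) x v = dir_deriv S f x v + dir_deriv S g x v"
  by (rule dir_deriv_eq[OF has_derivative_add assms(3)]) (use assms has_derivative_dir_deriv in auto)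

lemma dir_deriv_diff:
  assumes "f differentiable (at x within S)" "g differentiable (at x within S)" "v \<in> tangent_space S x"
  shows "dir_deriv S (\<lambda>y. f y - g y) x v = dir_deriv S f x v - dir_deriv S g x v"
  by (rule dir_deriv_eq[OF has_derivative_diff assms(3)]) (use assms has_derivative_dir_deriv in auto)

lemma dir_deriv_bilinear:
  assumes "bounded_bilinear b" "f differentiable (at x within S)" "g differentiable (at x within S)"
    "v \<in> tangent_space S x"
  shows "dir_deriv S (\<lambda>y. b (f y) (g y)) x v = b (f x) (dir_deriv S g x v) + b (dir_deriv S f x v) (g x)"
  by (rule dir_deriv_eq[OF bounded_bilinear.FDERIV[OF assms(1)] assms(4)])
    (use assms has_derivative_dir_deriv in auto)

lemma dir_deriv_bounded_linear:
  assumes "bounded_linear h" "f differentiable (at x within S)" "v \<in> tangent_space S x"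
  shows "dir_deriv S (\<lambda>y. h (f y)) x v = h (dir_deriv S f x v)"
  by (rule dir_deriv_eq[OF bounded_linear.has_derivative[OF assms(1)] assms(3)])
    (use assms has_derivative_dir_deriv in auto)

lemmas dir_deriv_blinfun_apply = dir_deriv_bilinear[OF bounded_bilinear_blinfun_apply]

lemma dir_deriv_apply_const:
  "f differentiable (at x within S) \<Longrightarrow> v \<in> tangent_space S x \<Longrightarrow>
   dir_deriv S (\<lambda>y. blinfun_apply (f y) w) x v = dir_deriv S f x v w"
  by (rule dir_deriv_bounded_linear[OF bounded_linear_apply_blinfun])

lemma differentiable_bilinear:
  assumes "bounded_bilinear b" "f differentiable (at x within S)" "g differentiable (at x within S)"
  shows "(\<lambda>y. b (f y) (g y)) differentiable (at x within S)"
  using bounded_bilinear.FDERIV[OF assms(1)] assms(2,3) unfolding differentiable_def by blast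

lemmas differentiable_blinfun_apply = differentiable_bilinear[OF bounded_bilinear_blinfun_apply]

section \<open>Symmetry of second derivatives\<close>

text \<open>The second difference is the increment over \<open>[0, 1]\<close> of
\<open>t \<mapsto> F (x + s u + t s v) - F (x + t s v)\<close>. Inserting the first order expansion of \<open>F'\<close> at \<open>x\<close> into its
derivative leaves \<open>s\<^sup>2 F'' u v\<close> and a remainder of order \<open>o(s\<^sup>2)\<close>, and the mean value inequality carries
this over to the increment.\<close>

lemma second_difference_estimate:
  fixes F :: "'a::real_normed_vector \<Rightarrow> 'b::real_normed_vector"
  assumes "open U" "x \<in> U"
    and F: "\<And>y. y \<in> U \<Longrightarrow> (F has_derivative blinfun_apply (F' y)) (at y)"
    and F': "(F' has_derivative F'') (at x)" and "e > 0"
  shows "\<exists>\<delta>>0. \<forall>s. 0 < s \<and> s < \<delta> \<longrightarrow>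
    norm (F (x + s *\<^sub>R u + s *\<^sub>R v) - F (x + s *\<^sub>R u) - F (x + s *\<^sub>R v) + F x
      - s\<^sup>2 *\<^sub>R blinfun_apply (F'' u) v) \<le> s\<^sup>2 * e"
proof -
  define K where "K = norm u + norm v"
  define e' where "e' = e / (2 * K * norm v + 1)"
  have K: "K \<ge> 0" "K \<ge> norm u" "K \<ge> norm v" by (auto simp: K_def)
  have pos: "2 * K * norm v + 1 > 0" using K by (smt (verit) mult_nonneg_nonneg norm_ge_zero)
  then have e': "e' > 0" using \<open>e > 0\<close> by (simp add: e'_def)
  have lin: "linear F''" using F' has_derivative_linear by blast
  obtain r where r: "r > 0" "ball x r \<subseteq> U" using assms(1,2) openE by blast
  obtain d where d: "d > 0" "\<And>y. norm (y - x) < d \<Longrightarrow> norm (F' y - F' x - F'' (y - x)) \<le> e' * norm (y - x)"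
    using F' e' unfolding has_derivative_at_alt by blast
  define \<delta> where "\<delta> = min r d / (K + 1)"
  have "\<delta> > 0" using r d K by (simp add: \<delta>_def)
  moreover have "norm (F (x + s *\<^sub>R u + s *\<^sub>R v) - F (x + s *\<^sub>R u) - F (x + s *\<^sub>R v) + F x
      - s\<^sup>2 *\<^sub>R blinfun_apply (F'' u) v) \<le> s\<^sup>2 * e" if s: "0 < s" "s < \<delta>" for s
  proof -
    have sK: "s * K < r" "s * K < d"
    proof -
      have "s * (K + 1) < min r d" using s K by (simp add: \<delta>_def pos_less_divide_eq)
      then show "s * K < r" "s * K < d" using s by (simp_all add: algebra_simps)
    qed
    have small: "norm (a *\<^sub>R (s *\<^sub>R u) + (t * s) *\<^sub>R v) \<le> s * K" if "a \<in> {0..1}" "t \<in> {0..1}" for a t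
    proof -
      have "norm (a *\<^sub>R (s *\<^sub>R u) + (t * s) *\<^sub>R v) \<le> a * (s * norm u) + t * (s * norm v)"
        using that s by (intro norm_triangle_le) (auto simp: abs_mult)
      also have "\<dots> \<le> 1 * (s * norm u) + 1 * (s * norm v)"
        using that s by (intro add_mono mult_right_mono) auto
      finally show ?thesis by (simp add: K_def algebra_simps)
    qed
    \<comment> \<open>The increment of \<open>h\<close> over \<open>[0, 1]\<close> is the error to be estimated.\<close>
    define h where "h t = F (x + s *\<^sub>R u + (t * s) *\<^sub>R v) - F (x + (t * s) *\<^sub>R v)
        - t *\<^sub>R (s\<^sup>2 *\<^sub>R blinfun_apply (F'' u) v)" for t
    define h' where "h' t = F' (x + s *\<^sub>R u + (t * s) *\<^sub>R v) (s *\<^sub>R v) - F' (x + (t * s) *\<^sub>R v) (s *\<^sub>R v)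
        - s\<^sup>2 *\<^sub>R blinfun_apply (F'' u) v" for t
    have h: "(h has_derivative (\<lambda>r. r *\<^sub>R h' t)) (at t within {0..1})" if t: "t \<in> {0..1}" for t
    proof -
      have "x + s *\<^sub>R u + (t * s) *\<^sub>R v \<in> U" "x + (t * s) *\<^sub>R v \<in> U"
        using small[OF _ t, of 1] small[OF _ t, of 0] sK r(2)
        by (auto simp: dist_norm subset_iff mem_ball norm_minus_commute add.assoc)
      note F1 = has_derivative_compose[where f = "\<lambda>t. x + s *\<^sub>R u + (t * s) *\<^sub>R v", OF _ F[OF this(1)]]
        and F2 = has_derivative_compose[where f = "\<lambda>t. x + (t * s) *\<^sub>R v", OF _ F[OF this(2)]]
      have "(h has_derivative (\<lambda>r. F' (x + s *\<^sub>R u + (t * s) *\<^sub>R v) ((r * s) *\<^sub>R v)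
          - F' (x + (t * s) *\<^sub>R v) ((r * s) *\<^sub>R v) - r *\<^sub>R (s\<^sup>2 *\<^sub>R blinfun_apply (F'' u) v))) (at t within {0..1})"
        unfolding h_def by (rule has_derivative_diff[OF has_derivative_diff[OF F1 F2]])
          (auto intro!: derivative_eq_intros)
      moreover have "(\<lambda>r. F' (x + s *\<^sub>R u + (t * s) *\<^sub>R v) ((r * s) *\<^sub>R v)
          - F' (x + (t * s) *\<^sub>R v) ((r * s) *\<^sub>R v) - r *\<^sub>R (s\<^sup>2 *\<^sub>R blinfun_apply (F'' u) v))
          = (\<lambda>r. r *\<^sub>R h' t)"
        by (auto simp: h'_def blinfun.scaleR_right algebra_simps)
      ultimately show ?thesis by simp
    qed
    have h'_le: "norm (h' t) \<le> s\<^sup>2 * e" if t: "t \<in> {0..1}" for t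
    proof -
      let ?y = "x + s *\<^sub>R u + (t * s) *\<^sub>R v" and ?z = "x + (t * s) *\<^sub>R v"
      let ?R = "\<lambda>y. F' y - F' x - F'' (y - x)"
      have b: "norm (?y - x) \<le> s * K" "norm (?z - x) \<le> s * K"
        using small[OF _ t, of 1] small[OF _ t, of 0] by (auto simp: add.assoc)
      have R: "norm (?R y) \<le> e' * (s * K)" if "norm (y - x) \<le> s * K" for y
        using d(2)[of y] that sK e' by (smt (verit) mult_left_mono)
      have rearrange: "a - c - p - (b - c - q) = a - b - w" if "p - q = w" for a b c p q w :: "'a \<Rightarrow>\<^sub>L 'b"
        using that by auto
      have "(?y - x) - (?z - x) = s *\<^sub>R u" by simp
      then have "F'' (?y - x) - F'' (?z - x) = s *\<^sub>R F'' u"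
        by (metis linear_diff[OF lin] linear_scale[OF lin])
      then have RR: "?R ?y - ?R ?z = F' ?y - F' ?z - s *\<^sub>R F'' u"
        by (rule rearrange)
      have "h' t = (?R ?y - ?R ?z) (s *\<^sub>R v)"
        unfolding RR by (simp add: h'_def blinfun.diff_left blinfun.scaleR_left blinfun.scaleR_right power2_eq_square
            scaleR_diff_right)
      also have "norm \<dots> \<le> norm (?R ?y - ?R ?z) * norm (s *\<^sub>R v)" by (rule norm_blinfun)
      also have "\<dots> \<le> (e' * (s * K) + e' * (s * K)) * (s * norm v)"
      proof (rule mult_mono)
        show "norm (?R ?y - ?R ?z) \<le> e' * (s * K) + e' * (s * K)"
          by (rule order_trans[OF norm_triangle_ineq4 add_mono[OF R[OF b(1)] R[OF b(2)]]])
      qed (use s e' K in auto)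
      also have "\<dots> = s\<^sup>2 * (e' * (2 * K * norm v))" by (simp add: power2_eq_square algebra_simps)
      also have "\<dots> \<le> s\<^sup>2 * (e' * (2 * K * norm v + 1))" using e' by (intro mult_left_mono) auto
      also have "\<dots> = s\<^sup>2 * e" using pos by (simp add: e'_def)
      finally show ?thesis .
    qed
    have "norm (h 1 - h 0) \<le> s\<^sup>2 * e * norm (1 - 0 :: real)"
    proof (rule differentiable_bound[OF _ h])
      show "onorm (\<lambda>r. r *\<^sub>R h' t) \<le> s\<^sup>2 * e" if "t \<in> {0..1}" for t
      proof (rule onorm_bound)
        fix r :: real
        show "norm (r *\<^sub>R h' t) \<le> s\<^sup>2 * e * norm r"
          using h'_le[OF that] mult_right_mono[of "norm (h' t)" "s\<^sup>2 * e" "\<bar>r\<bar>"] by (simp add: mult.commute)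
      qed (use \<open>e > 0\<close> in auto)
    qed auto
    then show ?thesis by (simp add: h_def algebra_simps)
  qed
  ultimately show ?thesis by blast
qed

text \<open>The second difference is symmetric in \<open>u\<close> and \<open>v\<close>, and it approximates both \<open>s\<^sup>2 F'' u v\<close> and
\<open>s\<^sup>2 F'' v u\<close> up to \<open>o(s\<^sup>2)\<close>.\<close>

lemma symmetric_second_derivative:
  fixes F :: "'a::real_normed_vector \<Rightarrow> 'b::real_normed_vector"
  assumes "open U" "x \<in> U"
    and "\<And>y. y \<in> U \<Longrightarrow> (F has_derivative blinfun_apply (F' y)) (at y)"
    and "(F' has_derivative F'') (at x)"
  shows "blinfun_apply (F'' u) v = blinfun_apply (F'' v) u"
proof -
  have "norm (F'' u v - F'' v u) \<le> 0 + e" if "e > 0" for e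
  proof -
    have half: "e / 2 > 0" using that by simp
    obtain d1 where d1: "d1 > 0" "\<And>s. 0 < s \<and> s < d1 \<Longrightarrow>
      norm (F (x + s *\<^sub>R u + s *\<^sub>R v) - F (x + s *\<^sub>R u) - F (x + s *\<^sub>R v) + F x - s\<^sup>2 *\<^sub>R F'' u v) \<le> s\<^sup>2 * (e/2)"
      using second_difference_estimate[OF assms half, of u v] by blast
    obtain d2 where d2: "d2 > 0" "\<And>s. 0 < s \<and> s < d2 \<Longrightarrow>
      norm (F (x + s *\<^sub>R v + s *\<^sub>R u) - F (x + s *\<^sub>R v) - F (x + s *\<^sub>R u) + F x - s\<^sup>2 *\<^sub>R F'' v u) \<le> s\<^sup>2 * (e/2)"
      using second_difference_estimate[OF assms half, of v u] by blast
    define s where "s = min d1 d2 / 2"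
    have s: "0 < s" "s < d1" "s < d2" using d1 d2 by (auto simp: s_def)
    define Q where "Q = F (x + s *\<^sub>R u + s *\<^sub>R v) - F (x + s *\<^sub>R u) - F (x + s *\<^sub>R v) + F x"
    have Q1: "norm (Q - s\<^sup>2 *\<^sub>R F'' u v) \<le> s\<^sup>2 * (e/2)" using d1(2) s by (simp add: Q_def)
    have "F (x + s *\<^sub>R v + s *\<^sub>R u) - F (x + s *\<^sub>R v) - F (x + s *\<^sub>R u) + F x = Q"
      by (simp add: Q_def ac_simps)
    then have Q2: "norm (Q - s\<^sup>2 *\<^sub>R F'' v u) \<le> s\<^sup>2 * (e/2)" using d2(2)[of s] s by simp
    have "norm ((Q - s\<^sup>2 *\<^sub>R F'' v u) - (Q - s\<^sup>2 *\<^sub>R F'' u v)) \<le> s\<^sup>2 * (e/2) + s\<^sup>2 * (e/2)"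
      by (rule order_trans[OF norm_triangle_ineq4 add_mono[OF Q2 Q1]])
    moreover have "(Q - s\<^sup>2 *\<^sub>R F'' v u) - (Q - s\<^sup>2 *\<^sub>R F'' u v) = s\<^sup>2 *\<^sub>R (F'' u v - F'' v u)"
      by (simp add: scaleR_diff_right)
    ultimately have "s\<^sup>2 * norm (F'' u v - F'' v u) \<le> s\<^sup>2 * e" by (simp add: mult.commute)
    then show ?thesis using s by simp
  qed
  then have "norm (F'' u v - F'' v u) \<le> 0" using field_le_epsilon[of "norm (F'' u v - F'' v u)" 0] by blast
  then show ?thesis by simp
qed

section \<open>Second order calculus on a subset\<close>

text \<open>Operators are assembled from their values on the standard basis; since \<open>rank_one i\<close> is bounded linear,
smoothness of those values gives smoothness of the operator-valued map.\<close>

definition rank_one :: "'a::euclidean_space \<Rightarrow> 'b::real_normed_vector \<Rightarrow> 'a \<Rightarrow>\<^sub>L 'b" where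
  "rank_one i w = blinfun_scaleR_left w o\<^sub>L blinfun_inner_left i"

lemma rank_one_apply [simp]: "rank_one i w v = (v \<bullet> i) *\<^sub>R w"
  by (simp add: rank_one_def blinfun_inner_left.rep_eq)

lemma bounded_linear_rank_one: "bounded_linear (rank_one i)"
  unfolding rank_one_def[abs_def]
  by (rule bounded_linear_compose[OF bounded_bilinear.bounded_linear_left[OF bounded_bilinear_blinfun_compose]
        bounded_linear_blinfun_scaleR_left])

lemma sum_rank_one_apply:
  assumes "linear f"
  shows "(\<Sum>i\<in>Basis. rank_one i (f i)) v = f v"
proof -
  have "f v = f (\<Sum>i\<in>Basis. (v \<bullet> i) *\<^sub>R i)" by (simp add: euclidean_representation)
  also have "\<dots> = (\<Sum>i\<in>Basis. (v \<bullet> i) *\<^sub>R f i)"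
    by (simp add: linear_sum[OF assms] linear_scale[OF assms])
  finally show ?thesis by (simp add: blinfun.sum_left)
qed

lemma C_k_on_derivativeE:
  fixes F :: "'a::euclidean_space \<Rightarrow> 'b::real_normed_vector"
  assumes "open U" "\<And>n. C_k_on n F U"
  obtains F' :: "'a \<Rightarrow> 'a \<Rightarrow>\<^sub>L 'b"
  where "\<And>y. y \<in> U \<Longrightarrow> (F has_derivative blinfun_apply (F' y)) (at y)" "\<And>n. C_k_on n F' U"
proof -
  let ?D = "\<lambda>y. frechet_derivative F (at y)"
  have F: "F differentiable (at y)" if "y \<in> U" for y
    using assms(2)[of "Suc 0"] that by simp
  define F' where "F' y = (\<Sum>i\<in>Basis. rank_one i (?D y i))" for y
  have "?D y v = F' y v" if "y \<in> U" for y v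
    unfolding F'_def by (rule sum_rank_one_apply[OF linear_frechet_derivative[OF F[OF that]], symmetric])
  then have "(F has_derivative blinfun_apply (F' y)) (at y)" if "y \<in> U" for y
    using has_frechet_derivative[OF F[OF that]] that
    by (metis (no_types, lifting) ext)
  moreover have "C_k_on n F' U" for n
  proof -
    have D: "C_k_on n (\<lambda>y. ?D y i) U" for i
      using assms(2)[of "Suc n"] by simp
    have "C_k_on n (\<lambda>y. \<Sum>i\<in>I. rank_one i (?D y i)) U"
      if "finite I" for I :: "'a set"
      using that
    proof (induction I rule: finite_induct)
      case empty
      then show ?case by (simp add: C_k_on_const)
    next
      case (insert i I)
      show ?case
        unfolding sum.insert[OF insert.hyps]
        by (rule C_k_on_add[OF assms(1) C_k_on_bounded_linear[OF bounded_linear_rank_one assms(1) D] insert.IH])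
    qed
    then show ?thesis unfolding F'_def[abs_def] by simp
  qed
  ultimately show ?thesis by (rule that)
qed

lemma has_derivative_restrict:
  assumes "(F has_derivative D) (at y)" "open U" "y \<in> U" "y \<in> S" "\<And>z. z \<in> S \<Longrightarrow> z \<in> U \<Longrightarrow> F z = f z"
  shows "(f has_derivative D) (at y within S)"
proof -
  obtain e where e: "e > 0" "ball y e \<subseteq> U" using assms(2,3) openE by blast
  show ?thesis
  proof (rule has_derivative_transform_within[OF has_derivative_at_withinI[OF assms(1)] e(1) assms(4)])
    fix z assume "z \<in> S" "dist z y < e"
    then show "F z = f z" using assms(5) e(2) by (auto simp: dist_commute subset_iff)
  qed
qed

text \<open>A local smooth extension supplies a differentiable operator field \<open>F'\<close> that represents the derivative
of \<open>f\<close> within \<open>S\<close> at every nearby point of \<open>S\<close>, together with a symmetric second derivative at \<open>x\<close>.\<close>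

lemma smooth_map_second_order:
  fixes f :: "'a::euclidean_space \<Rightarrow> 'b::real_normed_vector"
  assumes "smooth_map S f" "x \<in> S"
  obtains U F' F'' where "open U" "x \<in> U" "\<And>n. C_k_on n F' U"
    "\<And>y. y \<in> S \<Longrightarrow> y \<in> U \<Longrightarrow> (f has_derivative blinfun_apply (F' y)) (at y within S)"
    "(F' has_derivative blinfun_apply F'') (at x)" "\<And>u v. blinfun_apply (blinfun_apply F'' u) v = F'' v u"
proof -
  obtain U F where U: "open U" "x \<in> U" "\<And>n. C_k_on n F U" "\<And>y. y \<in> S \<Longrightarrow> y \<in> U \<Longrightarrow> F y = f y"
    using smooth_mapE[OF assms] by metis
  obtain F' :: "'a \<Rightarrow> 'a \<Rightarrow>\<^sub>L 'b" where F': "\<And>y. y \<in> U \<Longrightarrow> (F has_derivative blinfun_apply (F' y)) (at y)"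
    "\<And>n. C_k_on n F' U"
    using C_k_on_derivativeE[OF U(1,3)] by metis
  obtain F'' :: "'a \<Rightarrow> 'a \<Rightarrow>\<^sub>L 'a \<Rightarrow>\<^sub>L 'b"
    where F'': "\<And>y. y \<in> U \<Longrightarrow> (F' has_derivative blinfun_apply (F'' y)) (at y)"
    using C_k_on_derivativeE[OF U(1) F'(2)] by metis
  show ?thesis
  proof (rule that[OF U(1,2) F'(2) has_derivative_restrict[OF F'(1) U(1)] F''[OF U(2)]])
    show "blinfun_apply (blinfun_apply (F'' x) u) v = F'' x v u" for u v
      by (rule symmetric_second_derivative[OF U(1,2) F'(1) F''[OF U(2)]])
  qed (use U in auto)
qed

lemma smooth_map_dir_deriv:
  fixes f :: "'a::euclidean_space \<Rightarrow> 'b::real_normed_vector"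
  assumes "smooth_map S f" "smooth_map S X" "\<And>y. y \<in> S \<Longrightarrow> X y \<in> tangent_space S y"
  shows "smooth_map S (\<lambda>y. dir_deriv S f y (X y))"
proof (rule smooth_mapI)
  fix x assume x: "x \<in> S"
  obtain U F' and F'' :: "'a \<Rightarrow>\<^sub>L 'a \<Rightarrow>\<^sub>L 'b" where U: "open U" "x \<in> U" "\<And>n. C_k_on n F' U"
    "\<And>y. y \<in> S \<Longrightarrow> y \<in> U \<Longrightarrow> (f has_derivative blinfun_apply (F' y)) (at y within S)"
    using smooth_map_second_order[OF assms(1) x] by metis
  obtain W G where W: "open W" "x \<in> W" "\<And>n. C_k_on n G W" "\<And>y. y \<in> S \<Longrightarrow> y \<in> W \<Longrightarrow> G y = X y"
    using smooth_mapE[OF assms(2) x] by metis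
  have "C_k_on n (\<lambda>y. blinfun_apply (F' y) (G y)) (U \<inter> W)" for n
    by (rule C_k_on_bilinear[OF bounded_bilinear_blinfun_apply open_Int[OF U(1) W(1)]])
      (use C_k_on_subset[OF U(3)] C_k_on_subset[OF W(3)] in auto)
  moreover have "blinfun_apply (F' y) (G y) = dir_deriv S f y (X y)" if "y \<in> S" "y \<in> U \<inter> W" for y
    using dir_deriv_eq[OF U(4) assms(3)] W(4) that by simp
  ultimately show "\<exists>U F. open U \<and> x \<in> U \<and> (\<forall>n. C_k_on n F U) \<and> (\<forall>y\<in>S \<inter> U. F y = dir_deriv S f y (X y))"
    using U(1,2) W(1,2) by (intro exI[of _ "U \<inter> W"] exI[of _ "\<lambda>y. blinfun_apply (F' y) (G y)"]) auto
qed

text \<open>Second order chain rule: the derivative of \<open>D\<^sub>X f\<close> is a symmetric bilinear form in the two directions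
plus the first derivative of \<open>f\<close> applied to the derivative of \<open>X\<close>. The form \<open>D2\<close> and the operator \<open>D\<close>
depend on the chosen extension of \<open>f\<close>, because the derivative of \<open>X\<close> need not be tangent.\<close>

lemma dir_deriv_dir_derivE:
  fixes f :: "'a::euclidean_space \<Rightarrow> 'b::real_normed_vector"
  assumes "smooth_map S f" "x \<in> S"
  obtains D :: "'a \<Rightarrow>\<^sub>L 'b" and D2 :: "'a \<Rightarrow>\<^sub>L 'a \<Rightarrow>\<^sub>L 'b" where
    "\<And>v. v \<in> tangent_space S x \<Longrightarrow> dir_deriv S f x v = D v"
    "\<And>u v. D2 u v = D2 v u"
    "\<And>X v. X differentiable (at x within S) \<Longrightarrow> (\<And>y. y \<in> S \<Longrightarrow> X y \<in> tangent_space S y) \<Longrightarrow>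
      v \<in> tangent_space S x \<Longrightarrow>
      (\<lambda>y. dir_deriv S f y (X y)) differentiable (at x within S) \<and>
      dir_deriv S (\<lambda>y. dir_deriv S f y (X y)) x v = D2 v (X x) + D (dir_deriv S X x v)"
proof -
  obtain U F' F'' where U: "open U" "x \<in> U" 
    "\<And>y. y \<in> S \<Longrightarrow> y \<in> U \<Longrightarrow> (f has_derivative blinfun_apply (F' y)) (at y within S)"
    "(F' has_derivative blinfun_apply F'') (at x)"
    and sym: "\<And>u v. blinfun_apply (blinfun_apply F'' u) v = F'' v u"
    using smooth_map_second_order[OF assms] by metis
  obtain e where e: "e > 0" "ball x e \<subseteq> U" using U openE by blast
  show ?thesis
  proof (rule that[OF _ sym])
    show "dir_deriv S f x v = F' x v" if "v \<in> tangent_space S x" for v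
      by (rule dir_deriv_eq[OF U(3)[OF assms(2) U(2)] that])
    show "(\<lambda>y. dir_deriv S f y (X y)) differentiable (at x within S) \<and>
        dir_deriv S (\<lambda>y. dir_deriv S f y (X y)) x v = F'' v (X x) + F' x (dir_deriv S X x v)"
      if X: "X differentiable (at x within S)" and T: "\<And>y. y \<in> S \<Longrightarrow> X y \<in> tangent_space S y"
        and v: "v \<in> tangent_space S x" for X v
    proof -
      have "((\<lambda>y. F' y (X y)) has_derivative (\<lambda>h. F' x (dir_deriv S X x h) + F'' h (X x))) (at x within S)"
        by (rule bounded_bilinear.FDERIV[OF bounded_bilinear_blinfun_apply
              has_derivative_at_withinI[OF U(4)] has_derivative_dir_deriv[OF X]])
      then have "((\<lambda>y. dir_deriv S f y (X y)) has_derivative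
          (\<lambda>h. F' x (dir_deriv S X x h) + F'' h (X x))) (at x within S)"
      proof (rule has_derivative_transform_within[OF _ e(1) assms(2)])
        fix z assume z: "z \<in> S" "dist z x < e"
        then have "z \<in> U" using e(2) by (auto simp: dist_commute subset_iff)
        then show "F' z (X z) = dir_deriv S f z (X z)"
          using dir_deriv_eq[OF U(3) T] z(1) by simp
      qed
      from dir_deriv_eq[OF this v] differentiableI[OF this] show ?thesis by (simp add: add.commute)
    qed
  qed
qed

text \<open>\<open>X Y f - Y X f = [X, Y] f\<close>: the symmetric second order terms cancel.\<close>

lemma dir_deriv_commutator:
  fixes f :: "'a::euclidean_space \<Rightarrow> 'b::real_normed_vector"
  assumes "smooth_map S f" "x \<in> S" "X differentiable (at x within S)" "Y differentiable (at x within S)"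
    and X: "\<And>y. y \<in> S \<Longrightarrow> X y \<in> tangent_space S y" and Y: "\<And>y. y \<in> S \<Longrightarrow> Y y \<in> tangent_space S y"
    and "lie_bracket S X Y x \<in> tangent_space S x"
  shows "dir_deriv S (\<lambda>y. dir_deriv S f y (Y y)) x (X x) - dir_deriv S (\<lambda>y. dir_deriv S f y (X y)) x (Y x)
    = dir_deriv S f x (lie_bracket S X Y x)"
proof (rule dir_deriv_dir_derivE[OF assms(1,2)])
  fix D :: "'a \<Rightarrow>\<^sub>L 'b" and D2 :: "'a \<Rightarrow>\<^sub>L 'a \<Rightarrow>\<^sub>L 'b"
  assume D: "\<And>v. v \<in> tangent_space S x \<Longrightarrow> dir_deriv S f x v = D v"
    and sym: "\<And>u v. D2 u v = D2 v u"
    and D2: "\<And>X v. X differentiable (at x within S) \<Longrightarrow> (\<And>y. y \<in> S \<Longrightarrow> X y \<in> tangent_space S y) \<Longrightarrow>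
      v \<in> tangent_space S x \<Longrightarrow>
      (\<lambda>y. dir_deriv S f y (X y)) differentiable (at x within S) \<and>
      dir_deriv S (\<lambda>y. dir_deriv S f y (X y)) x v = D2 v (X x) + D (dir_deriv S X x v)"
  have "dir_deriv S (\<lambda>y. dir_deriv S f y (Y y)) x (X x) = D2 (X x) (Y x) + D (dir_deriv S Y x (X x))"
    using D2[OF assms(4) Y X[OF assms(2)]] by blast
  moreover have "dir_deriv S (\<lambda>y. dir_deriv S f y (X y)) x (Y x) = D2 (X x) (Y x) + D (dir_deriv S X x (Y x))"
    using D2[OF assms(3) X Y[OF assms(2)]] sym[of "X x" "Y x"] by simp
  ultimately show ?thesis
    using D[OF assms(7)] by (simp add: lie_bracket_def blinfun.diff_right)
qed

section \<open>Curvature of a connection on a trivial bundle\<close>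

text \<open>The curvature formula of a connection \<open>Z \<mapsto> D\<^sub>X Z + C(X, Z)\<close> on the trivial bundle with fibre \<open>'b\<close>. In the
expansion the second derivatives of \<open>Z\<close> combine to \<open>[X, Y] Z\<close>, and all terms with first derivatives
of \<open>X\<close>, \<open>Y\<close> and \<open>Z\<close> cancel. It is applied to the Levi-Civita connection, to the connection
\<open>H \<nabla>\<close> of the horizontal bundle, and to the pullback of the connection of the base along a submersion.\<close>

lemma bundle_curvature:
  fixes Z :: "'a::euclidean_space \<Rightarrow> 'b::real_normed_vector" and C :: "'a \<Rightarrow> 'a \<Rightarrow>\<^sub>L 'b \<Rightarrow>\<^sub>L 'b"
  assumes Z: "smooth_map S Z" and x: "x \<in> S"
    and XY: "smooth_map S X" "smooth_map S Y"
    and X: "\<And>y. y \<in> S \<Longrightarrow> X y \<in> tangent_space S y" and Y: "\<And>y. y \<in> S \<Longrightarrow> Y y \<in> tangent_space S y"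
    and C: "C differentiable (at x within S)"
    and br: "lie_bracket S X Y x \<in> tangent_space S x"
  defines "cov \<equiv> \<lambda>X Z y. dir_deriv S Z y (X y) + C y (X y) (Z y)"
  shows "cov (lie_bracket S X Y) Z x - cov X (cov Y Z) x + cov Y (cov X Z) x =
    - dir_deriv S C x (X x) (Y x) (Z x) + dir_deriv S C x (Y x) (X x) (Z x)
    - C x (X x) (C x (Y x) (Z x)) + C x (Y x) (C x (X x) (Z x))"
proof -
  have *: "dir_deriv S (cov Y Z) x v = dir_deriv S (\<lambda>y. dir_deriv S Z y (Y y)) x v
      + (C x (Y x) (dir_deriv S Z x v) + (C x (dir_deriv S Y x v) + dir_deriv S C x v (Y x)) (Z x))"
    if Ys: "smooth_map S Y" and YT: "\<And>y. y \<in> S \<Longrightarrow> Y y \<in> tangent_space S y" and v: "v \<in> tangent_space S x"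
    for Y v
  proof -
    note d = smooth_map_differentiable[OF smooth_map_dir_deriv[OF Z Ys YT] x]
    note dY = smooth_map_differentiable[OF Ys x] and dZ = smooth_map_differentiable[OF Z x]
    note CY = differentiable_blinfun_apply[OF C dY]
    show ?thesis
      unfolding cov_def
      by (simp add: dir_deriv_add[OF d differentiable_blinfun_apply[OF CY dZ] v]
          dir_deriv_blinfun_apply[OF CY dZ v] dir_deriv_blinfun_apply[OF C dY v])
  qed
  have comm: "dir_deriv S (\<lambda>y. dir_deriv S Z y (Y y)) x (X x) =
      dir_deriv S (\<lambda>y. dir_deriv S Z y (X y)) x (Y x) + dir_deriv S Z x (lie_bracket S X Y x)"
    using dir_deriv_commutator[OF Z x smooth_map_differentiable[OF XY(1) x]
        smooth_map_differentiable[OF XY(2) x] X Y br] by (simp add: algebra_simps)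
  have exp: "cov X (cov Y Z) x = dir_deriv S (cov Y Z) x (X x) + C x (X x) (dir_deriv S Z x (Y x) + C x (Y x) (Z x))"
    "cov Y (cov X Z) x = dir_deriv S (cov X Z) x (Y x) + C x (Y x) (dir_deriv S Z x (X x) + C x (X x) (Z x))"
    "cov (lie_bracket S X Y) Z x = dir_deriv S Z x (lie_bracket S X Y x)
      + C x (dir_deriv S Y x (X x) - dir_deriv S X x (Y x)) (Z x)"
    by (simp_all add: cov_def lie_bracket_def)
  note dYZ = *[OF XY(2) _ X[OF x]] and dXZ = *[OF XY(1) _ Y[OF x]]
  show ?thesis
    unfolding exp dYZ[OF Y, simplified] dXZ[OF X, simplified] comm
    by (simp add: blinfun.add_left blinfun.add_right blinfun.diff_left blinfun.diff_right)
qed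

section \<open>Tangent spaces of open subsets and of linear subspaces\<close>

lemma tangent_space_mono:
  assumes "S \<subseteq> T"
  shows "tangent_space S x \<subseteq> tangent_space T x"
  using assms unfolding tangent_space_def by fast

lemma at_within_Int_open:
  assumes "open U" "x \<in> U"
  shows "at x within S \<inter> U = at x within S"
  by (rule at_within_nhd[OF assms(2,1)]) auto

lemma dir_deriv_Int_open:
  "open U \<Longrightarrow> x \<in> U \<Longrightarrow> dir_deriv (S \<inter> U) f x = dir_deriv S f x"
  by (simp add: dir_deriv_def[abs_def] at_within_Int_open)

lemma tangent_space_Int_open:
  assumes U: "open U" "x \<in> U"
  shows "tangent_space (S \<inter> U) x = tangent_space S x"
proof
  show "tangent_space (S \<inter> U) x \<subseteq> tangent_space S x" by (rule tangent_space_mono) simp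
  show "tangent_space S x \<subseteq> tangent_space (S \<inter> U) x"
  proof
    fix v assume "v \<in> tangent_space S x"
    then obtain \<gamma> :: "real \<Rightarrow> 'a" and e where \<gamma>: "e > 0" "smooth_map {-e<..<e} \<gamma>"
      "\<gamma> ` {-e<..<e} \<subseteq> S" "\<gamma> 0 = x" "(\<gamma> has_vector_derivative v) (at 0)"
      unfolding tangent_space_def by auto
    have "isCont \<gamma> 0" using \<gamma>(5) has_vector_derivative_continuous by blast
    then obtain d where d: "d > 0" "\<And>t. \<bar>t\<bar> < d \<Longrightarrow> \<gamma> t \<in> U"
      using U \<gamma>(4) unfolding continuous_at_open eventually_at
      by (metis (no_types, lifting) U(1) U(2) \<gamma>(4) dist_real_def diff_zero continuous_at_ball openE subsetD dist_commute
          mem_ball)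
    define e' where "e' = min d e"
    have "{-e'<..<e'} \<subseteq> {-e<..<e}" by (auto simp: e'_def)
    then have "smooth_map {-e'<..<e'} \<gamma>" "\<gamma> ` {-e'<..<e'} \<subseteq> S \<inter> U" "e' > 0"
      using \<gamma>(1,2,3) d by (auto intro: smooth_map_subset simp: e'_def image_subset_iff abs_less_iff)
    then show "v \<in> tangent_space (S \<inter> U) x" using \<gamma>(4,5) unfolding tangent_space_def by blast
  qed
qed

lemma subspace_projectionE:
  fixes L :: "'a::euclidean_space set"
  assumes "subspace L"
  obtains \<pi> :: "'a \<Rightarrow>\<^sub>L 'a" where "\<And>v. \<pi> v \<in> L" "\<And>v. v \<in> L \<Longrightarrow> \<pi> v = v"
    "\<And>s v. s \<in> L \<Longrightarrow> s \<bullet> \<pi> v = s \<bullet> v"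
proof -
  obtain B where B: "B \<subseteq> L" "pairwise orthogonal B" "\<And>x. x \<in> B \<Longrightarrow> norm x = 1" "independent B" "span B = L"
    using orthonormal_basis_subspace[OF assms] by metis
  have fin: "finite B" using B(4) independent_imp_finite by blast
  define p where "p v = (\<Sum>b\<in>B. (v \<bullet> b) *\<^sub>R b)" for v
  have "linear p" unfolding p_def[abs_def]
    by (intro linearI) (auto simp: inner_add_left algebra_simps sum.distrib scaleR_sum_right)
  then have bl: "bounded_linear p" by (simp add: linear_conv_bounded_linear)
  have expand: "p v = v" if "v \<in> L" for v
    unfolding p_def using orthonormal_basis_expand[of B v] B that fin by auto
  show ?thesis
  proof (rule that[of "Blinfun p"])
    show "Blinfun p v \<in> L" for v
      using B(1) assms unfolding bounded_linear_Blinfun_apply[OF bl] p_def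
      by (auto intro!: subspace_sum subspace_scale)
    show "Blinfun p v = v" if "v \<in> L" for v
      unfolding bounded_linear_Blinfun_apply[OF bl] by (rule expand[OF that])
    show "s \<bullet> Blinfun p v = s \<bullet> v" if "s \<in> L" for s v
    proof -
      have "s \<bullet> p v = p s \<bullet> v" by (simp add: p_def inner_sum_left inner_sum_right inner_commute mult.commute)
      then show ?thesis unfolding bounded_linear_Blinfun_apply[OF bl] by (simp add: expand[OF that])
    qed
  qed
qed

text \<open>A projection \<open>\<pi>\<close> onto \<open>L\<close> agrees with the identity on \<open>L\<close>, so both have the same derivative along a
tangent vector \<open>v\<close>, that is \<open>\<pi> v = v\<close>. Conversely, \<open>v \<in> L\<close> is the velocity of a straight line.\<close>

lemma tangent_space_subspace:
  fixes L :: "'a::euclidean_space set"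
  assumes "subspace L" "y \<in> L"
  shows "tangent_space L y = L"
proof
  obtain \<pi> :: "'a \<Rightarrow>\<^sub>L 'a" where \<pi>: "\<And>v. \<pi> v \<in> L" "\<And>v. v \<in> L \<Longrightarrow> \<pi> v = v"
    using subspace_projectionE[OF assms(1)] by metis
  show "tangent_space L y \<subseteq> L"
  proof
    fix v assume v: "v \<in> tangent_space L y"
    have "dir_deriv L (\<lambda>z. \<pi> z) y v = \<pi> v"
      by (rule dir_deriv_eq[OF bounded_linear.has_derivative[OF blinfun.bounded_linear_right has_derivative_ident] v])
    moreover have "dir_deriv L (\<lambda>z. \<pi> z) y = dir_deriv L (\<lambda>z. z) y"
      by (rule dir_deriv_cong) (use \<pi>(2) assms in auto)
    moreover have "dir_deriv L (\<lambda>z. z) y v = v"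
      by (rule dir_deriv_eq[OF has_derivative_ident v])
    ultimately have "\<pi> v = v" by simp
    then show "v \<in> L" using \<pi>(1) by metis
  qed
  show "L \<subseteq> tangent_space L y"
  proof
    fix v assume v: "v \<in> L"
    have "smooth_map {-1<..<1} (\<lambda>t::real. y + t *\<^sub>R v)"
      by (rule smooth_map_add[OF smooth_map_const
            smooth_map_bounded_linear[OF bounded_linear_scaleR_left smooth_map_ident]])
    moreover have "((\<lambda>t::real. y + t *\<^sub>R v) has_vector_derivative v) (at 0)"
      unfolding has_vector_derivative_def by (auto intro!: derivative_eq_intros)
    moreover have "(\<lambda>t::real. y + t *\<^sub>R v) ` {-1<..<1} \<subseteq> L"
      using assms v by (auto intro!: subspace_add subspace_scale)
    ultimately show "v \<in> tangent_space L y"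
      unfolding tangent_space_def
      by (intro CollectI exI[of _ "\<lambda>t::real. y + t *\<^sub>R v"] exI[of _ 1]) auto
  qed
qed

lemma tangent_space_open_in_subspace:
  fixes L :: "'a::euclidean_space set"
  assumes "subspace L" "openin (top_of_set L) N" "y \<in> N"
  shows "tangent_space N y = L"
proof -
  obtain U where U: "open U" "N = L \<inter> U" using assms(2) by (auto simp: openin_open)
  then show ?thesis using tangent_space_Int_open[of U y L] tangent_space_subspace[OF assms(1)] assms(3) by auto
qed

section \<open>The Levi-Civita connection in terms of a Christoffel function\<close>

text \<open>The operator \<open>P x\<close> is any smooth family of projections onto the tangent spaces; it turns constant
vectors into vector fields with prescribed values. The operator \<open>g x\<close> represents the metric on tangent
vectors only. This generality covers both the ambient manifold and the images of charts of the base,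
where \<open>P\<close> is constant.\<close>

locale levi_civita_submanifold =
  fixes S :: "'a::euclidean_space set"
    and P :: "'a \<Rightarrow> 'a \<Rightarrow>\<^sub>L 'a"
    and m :: "'a \<Rightarrow> 'a \<Rightarrow> 'a \<Rightarrow> real"
    and g :: "'a \<Rightarrow> 'a \<Rightarrow>\<^sub>L 'a"
    and nab :: "('a \<Rightarrow> 'a) \<Rightarrow> ('a \<Rightarrow> 'a) \<Rightarrow> 'a \<Rightarrow> 'a"
    and \<Gamma> :: "'a \<Rightarrow> 'a \<Rightarrow>\<^sub>L 'a \<Rightarrow>\<^sub>L 'a"
  assumes smooth_P: "smooth_map S P"
    and P_tangent: "x \<in> S \<Longrightarrow> P x w \<in> tangent_space S x"
    and P_ident: "x \<in> S \<Longrightarrow> v \<in> tangent_space S x \<Longrightarrow> P x v = v"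
    and smooth_g: "smooth_map S g"
    and m_eq: "x \<in> S \<Longrightarrow> u \<in> tangent_space S x \<Longrightarrow> v \<in> tangent_space S x \<Longrightarrow> m x u v = u \<bullet> g x v"
    and levi_civita: "levi_civita S m nab"
    and christoffel: "christoffel_function S nab \<Gamma>"
begin

abbreviation T where "T \<equiv> tangent_space S"
abbreviation D where "D \<equiv> dir_deriv S"

lemma subspace_tangent_space: "x \<in> S \<Longrightarrow> subspace (T x)"
proof -
  assume x: "x \<in> S"
  have "T x = range (P x)" using P_tangent[OF x] P_ident[OF x] by (auto simp: image_iff) metis
  then show ?thesis
    by (simp add: linear_subspace_image bounded_linear.linear[OF blinfun.bounded_linear_right])
qed

lemma vector_fieldD:
  "vector_field S X \<Longrightarrow> smooth_map S X" "vector_field S X \<Longrightarrow> x \<in> S \<Longrightarrow> X x \<in> T x"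
  unfolding vector_field_def by auto

lemma vector_field_apply:
  assumes "smooth_map S Q" "\<And>y w. y \<in> S \<Longrightarrow> blinfun_apply (Q y) w \<in> T y"
  shows "vector_field S (\<lambda>y. blinfun_apply (Q y) w)"
  using assms smooth_map_blinfun_apply[OF assms(1) smooth_map_const] unfolding vector_field_def by auto

lemma vector_field_P: "vector_field S (\<lambda>y. P y w)"
  using vector_field_apply[OF smooth_P P_tangent] by blast

lemma affine: "affine_connection S nab"
  by (rule conjunct1[OF levi_civita[unfolded levi_civita_def]])

lemma nab_vector_field: "vector_field S X \<Longrightarrow> vector_field S Y \<Longrightarrow> vector_field S (nab X Y)"
  using conjunct1[OF affine[unfolded affine_connection_def], rule_format] by simp

lemma smooth_Gamma: "smooth_map S \<Gamma>"
  by (rule conjunct1[OF christoffel[unfolded christoffel_function_def]])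

lemma nab_eq:
  "vector_field S X \<Longrightarrow> vector_field S Y \<Longrightarrow> x \<in> S \<Longrightarrow> nab X Y x = D Y x (X x) + \<Gamma> x (X x) (Y x)"
  using conjunct2[OF christoffel[unfolded christoffel_function_def], rule_format] by simp

lemma covariant_derivative_tangent:
  assumes "vector_field S Y" "x \<in> S" "\<xi> \<in> T x"
  shows "D Y x \<xi> + \<Gamma> x \<xi> (Y x) \<in> T x"
  using nab_eq[OF vector_field_P assms(1,2), of \<xi>] P_ident[OF assms(2,3)]
    vector_fieldD(2)[OF nab_vector_field[OF vector_field_P assms(1)] assms(2), of \<xi>] by simp

lemma cov_deriv_at_eq:
  assumes "vector_field S Y" "x \<in> S" "\<xi> \<in> T x"
  shows "cov_deriv_at S nab x \<xi> Y = D Y x \<xi> + \<Gamma> x \<xi> (Y x)"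
  unfolding cov_deriv_at_def
proof (rule the_equality)
  show "\<forall>X. vector_field S X \<and> X x = \<xi> \<longrightarrow> nab X Y x = D Y x \<xi> + \<Gamma> x \<xi> (Y x)"
    using nab_eq assms by auto
  fix r assume "\<forall>X. vector_field S X \<and> X x = \<xi> \<longrightarrow> nab X Y x = r"
  then have "nab (\<lambda>y. P y \<xi>) Y x = r" using vector_field_P P_ident[OF assms(2,3)] by blast
  then show "r = D Y x \<xi> + \<Gamma> x \<xi> (Y x)"
    using nab_eq[OF vector_field_P assms(1,2), of \<xi>] P_ident[OF assms(2,3)] by simp
qed

lemma torsion_free:
  "vector_field S X \<Longrightarrow> vector_field S Y \<Longrightarrow> x \<in> S \<Longrightarrow> lie_bracket S X Y x = nab X Y x - nab Y X x"
  using conjunct1[OF conjunct2[OF levi_civita[unfolded levi_civita_def]], rule_format] by simp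

lemma vector_field_lie_bracket:
  assumes "vector_field S X" "vector_field S Y"
  shows "vector_field S (lie_bracket S X Y)"
proof -
  note n = nab_vector_field[OF assms] nab_vector_field[OF assms(2,1)]
  have "smooth_map S (lie_bracket S X Y) \<longleftrightarrow> smooth_map S (\<lambda>x. nab X Y x - nab Y X x)"
    by (rule smooth_map_cong) (rule torsion_free[OF assms])
  then have "smooth_map S (lie_bracket S X Y)"
    using smooth_map_diff[OF vector_fieldD(1)[OF n(1)] vector_fieldD(1)[OF n(2)]] by simp
  moreover have "lie_bracket S X Y x \<in> T x" if "x \<in> S" for x
    using subspace_diff[OF subspace_tangent_space[OF that]] vector_fieldD(2)[OF n(1) that]
      vector_fieldD(2)[OF n(2) that] torsion_free[OF assms that] by simp
  ultimately show ?thesis unfolding vector_field_def by blast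
qed

text \<open>Vanishing of the torsion for the two fields \<open>P \<xi>\<close> and \<open>P \<eta>\<close>: the derivative terms are their Lie
bracket.\<close>

lemma Gamma_symmetric:
  assumes "x \<in> S" "\<xi> \<in> T x" "\<eta> \<in> T x"
  shows "\<Gamma> x \<xi> \<eta> = \<Gamma> x \<eta> \<xi>"
  using torsion_free[OF vector_field_P vector_field_P assms(1), of \<xi> \<eta>]
    nab_eq[OF vector_field_P vector_field_P assms(1), of \<xi> \<eta>]
    nab_eq[OF vector_field_P vector_field_P assms(1), of \<eta> \<xi>]
    P_ident[OF assms(1,2)] P_ident[OF assms(1,3)]
  by (simp add: lie_bracket_def)

lemma metric_compatible:
  assumes Y: "vector_field S Y" and Z: "vector_field S Z" and x: "x \<in> S" "\<xi> \<in> T x"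
  shows "D (\<lambda>y. Y y \<bullet> g y (Z y)) x \<xi> =
    (D Y x \<xi> + \<Gamma> x \<xi> (Y x)) \<bullet> g x (Z x) + Y x \<bullet> g x (D Z x \<xi> + \<Gamma> x \<xi> (Z x))"
proof -
  note T = vector_fieldD(2)[OF Y] vector_fieldD(2)[OF Z]
  let ?X = "\<lambda>y. P y \<xi>"
  have X: "?X x = \<xi>" using P_ident x by blast
  have "D (\<lambda>y. Y y \<bullet> g y (Z y)) x = D (\<lambda>y. m y (Y y) (Z y)) x"
    by (rule dir_deriv_cong[OF _ x(1)]) (simp add: m_eq T)
  moreover have "D (\<lambda>y. m y (Y y) (Z y)) x (?X x) = m x (nab ?X Y x) (Z x) + m x (Y x) (nab ?X Z x)"
    by (rule conjunct2[OF conjunct2[OF levi_civita[unfolded levi_civita_def]], rule_format])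
      (simp_all add: vector_field_P Y Z x)
  moreover have "nab ?X Y x = D Y x \<xi> + \<Gamma> x \<xi> (Y x)" "nab ?X Z x = D Z x \<xi> + \<Gamma> x \<xi> (Z x)"
    using nab_eq[OF vector_field_P Y x(1), of \<xi>] nab_eq[OF vector_field_P Z x(1), of \<xi>] X by simp_all
  ultimately show ?thesis
    using X m_eq[OF x(1)] T[OF x(1)] covariant_derivative_tangent[OF Y x] covariant_derivative_tangent[OF Z x]
    by simp
qed

lemma curvature_field_eq:
  assumes X: "vector_field S X" and Y: "vector_field S Y" and Z: "vector_field S Z" and x: "x \<in> S"
  shows "curvature_field S nab X Y Z x =
    - D \<Gamma> x (X x) (Y x) (Z x) + D \<Gamma> x (Y x) (X x) (Z x)
    - \<Gamma> x (X x) (\<Gamma> x (Y x) (Z x)) + \<Gamma> x (Y x) (\<Gamma> x (X x) (Z x))"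
proof -
  let ?N = "\<lambda>X Z y. D Z y (X y) + \<Gamma> y (X y) (Z y)"
  have "nab X (nab Y Z) x = ?N X (?N Y Z) x" if X: "vector_field S X" and Y: "vector_field S Y" for X Y
  proof -
    have "D (nab Y Z) x = D (?N Y Z) x" by (rule dir_deriv_cong[OF nab_eq[OF Y Z] x])
    then show ?thesis by (simp add: nab_eq[OF X nab_vector_field[OF Y Z] x] nab_eq[OF Y Z x])
  qed
  then have "curvature_field S nab X Y Z x =
      ?N (lie_bracket S X Y) Z x - ?N X (?N Y Z) x + ?N Y (?N X Z) x"
    using X Y by (simp add: curvature_field_def nab_eq[OF vector_field_lie_bracket[OF X Y] Z x])
  then show ?thesis
    using bundle_curvature[OF vector_fieldD(1)[OF Z] x vector_fieldD(1)[OF X] vector_fieldD(1)[OF Y]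
        vector_fieldD(2)[OF X] vector_fieldD(2)[OF Y] smooth_map_differentiable[OF smooth_Gamma x]
        vector_fieldD(2)[OF vector_field_lie_bracket[OF X Y] x]] by simp
qed

lemma curvature_tensor_eq:
  assumes x: "x \<in> S" and "\<xi> \<in> T x" "\<eta> \<in> T x" "\<phi> \<in> T x"
  shows "curvature_tensor S nab x \<xi> \<eta> \<phi> =
    - D \<Gamma> x \<xi> \<eta> \<phi> + D \<Gamma> x \<eta> \<xi> \<phi> - \<Gamma> x \<xi> (\<Gamma> x \<eta> \<phi>) + \<Gamma> x \<eta> (\<Gamma> x \<xi> \<phi>)" (is "_ = ?R")
  unfolding curvature_tensor_def
proof (rule the_equality)
  show "\<forall>X Y Z. vector_field S X \<and> vector_field S Y \<and> vector_field S Z \<and> X x = \<xi> \<and> Y x = \<eta> \<and> Z x = \<phi>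
      \<longrightarrow> curvature_field S nab X Y Z x = ?R"
    using curvature_field_eq x by blast
  fix r assume "\<forall>X Y Z. vector_field S X \<and> vector_field S Y \<and> vector_field S Z \<and> X x = \<xi> \<and> Y x = \<eta> \<and> Z x = \<phi>
      \<longrightarrow> curvature_field S nab X Y Z x = r"
  from this[rule_format, of "\<lambda>y. P y \<xi>" "\<lambda>y. P y \<eta>" "\<lambda>y. P y \<phi>"]
  have "curvature_field S nab (\<lambda>y. P y \<xi>) (\<lambda>y. P y \<eta>) (\<lambda>y. P y \<phi>) x = r"
    using vector_field_P P_ident assms by blast
  then show "r = ?R" using curvature_field_eq[OF vector_field_P vector_field_P vector_field_P x] P_ident assms by simp
qed

text \<open>Let \<open>Q\<close> factor through \<open>P\<close>. Differentiating \<open>Y = P Y\<close> and applying \<open>Q\<close> gives \<open>Q (D\<^sub>\<xi> P) Y = 0\<close>, hence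
\<open>Q \<nabla>\<^sub>\<xi> Y = Q D\<^sub>\<xi> Y + Q \<Gamma>0(\<xi>, Y)\<close>. The term \<open>Q D\<^sub>\<xi> Y\<close> is then found by differentiating \<open>Q Y = Y\<close> in the
first case and \<open>Q Y = 0\<close> in the second. So \<open>\<Gamma>Q\<close> is a Christoffel function for the connection induced on
the image of \<open>Q\<close>, and on sections of the kernel of \<open>Q\<close> it gives the second fundamental form.\<close>

lemma projected_covariant_derivative:
  assumes Q: "smooth_map S Q" "\<And>y w. y \<in> S \<Longrightarrow> blinfun_apply (Q y) (P y w) = Q y w"
    and x: "x \<in> S" "\<xi> \<in> T x"
    and \<Gamma>0: "\<And>\<omega>. blinfun_apply G0 \<omega> = D P x \<xi> \<omega> + \<Gamma> x \<xi> \<omega>"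
    and \<Gamma>Q: "\<And>\<omega>. blinfun_apply GQ \<omega> = - D Q x \<xi> \<omega> + Q x (blinfun_apply G0 \<omega>)"
    and Y: "vector_field S Y"
  shows "(\<And>y. y \<in> S \<Longrightarrow> Q y (Y y) = Y y) \<Longrightarrow> Q x (D Y x \<xi> + \<Gamma> x \<xi> (Y x)) = D Y x \<xi> + GQ (Y x)"
    and "(\<And>y. y \<in> S \<Longrightarrow> Q y (Y y) = 0) \<Longrightarrow> Q x (D Y x \<xi> + \<Gamma> x \<xi> (Y x)) = GQ (Y x)"
proof -
  note d = smooth_map_differentiable[OF vector_fieldD(1)[OF Y] x(1)]
  have prod: "D (\<lambda>y. R y (Y y)) x \<xi> = R x (D Y x \<xi>) + D R x \<xi> (Y x)" if "smooth_map S R"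
    for R :: "'a \<Rightarrow> 'a \<Rightarrow>\<^sub>L 'a"
    by (rule dir_deriv_blinfun_apply[OF smooth_map_differentiable[OF that x(1)] d x(2)])
  have "D (\<lambda>y. P y (Y y)) x = D Y x"
    by (rule dir_deriv_cong[OF _ x(1)]) (use P_ident vector_fieldD(2)[OF Y] in auto)
  then have "D Y x \<xi> = P x (D Y x \<xi>) + D P x \<xi> (Y x)" using prod[OF smooth_P] by simp
  then have "Q x (D Y x \<xi>) = Q x (D Y x \<xi>) + Q x (D P x \<xi> (Y x))"
    using Q(2)[OF x(1)] by (metis blinfun.add_right)
  then have *: "Q x (D Y x \<xi> + \<Gamma> x \<xi> (Y x)) = Q x (D Y x \<xi>) + Q x (G0 (Y x))"
    by (simp add: \<Gamma>0 blinfun.add_right)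
  note QY = prod[OF Q(1)]
  show "Q x (D Y x \<xi> + \<Gamma> x \<xi> (Y x)) = D Y x \<xi> + GQ (Y x)" if "\<And>y. y \<in> S \<Longrightarrow> Q y (Y y) = Y y"
  proof -
    have "Q x (D Y x \<xi>) = D Y x \<xi> - D Q x \<xi> (Y x)"
      using QY dir_deriv_cong[of S "\<lambda>y. Q y (Y y)" Y x, OF that x(1)] by (metis add_diff_cancel_right')
    then show ?thesis by (simp add: * \<Gamma>Q)
  qed
  show "Q x (D Y x \<xi> + \<Gamma> x \<xi> (Y x)) = GQ (Y x)" if "\<And>y. y \<in> S \<Longrightarrow> Q y (Y y) = 0"
  proof -
    have "D (\<lambda>y. Q y (Y y)) x \<xi> = 0"
      using dir_deriv_const[OF x(2), of "0 :: 'a"] dir_deriv_cong[OF that x(1)] by simp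
    then have "Q x (D Y x \<xi>) = - D Q x \<xi> (Y x)" using QY by (simp add: eq_neg_iff_add_eq_0)
    then show ?thesis by (simp add: * \<Gamma>Q)
  qed
qed

end

section \<open>Orthogonal splittings and the O'Neill tensor\<close>

lemma metric_nondegenerate:
  fixes G :: "'a::euclidean_space \<Rightarrow>\<^sub>L 'a"
  assumes "\<And>u. u \<noteq> 0 \<Longrightarrow> u \<bullet> G u > 0" "\<And>u. u \<bullet> G a = u \<bullet> G b"
  shows "a = b"
proof -
  have "(a - b) \<bullet> G (a - b) = 0" using assms(2) by (simp add: blinfun.diff_right inner_diff_right)
  then show ?thesis using assms(1)[of "a - b"] by fastforce
qed

text \<open>The adjoint is \<open>G\<^sup>-\<^sup>1 f\<^sup>T G\<close> with the Euclidean transpose \<open>f\<^sup>T\<close>; positivity makes \<open>G\<close> injective, hence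
invertible.\<close>

lemma metric_adjoint:
  fixes G :: "'a::euclidean_space \<Rightarrow>\<^sub>L 'a"
  assumes pos: "\<And>u. u \<noteq> 0 \<Longrightarrow> u \<bullet> G u > 0" and "linear f"
  shows "f u \<bullet> G w = u \<bullet> G (metric_adjoint G f w)"
proof -
  have lin: "linear G" by (rule bounded_linear.linear[OF blinfun.bounded_linear_right])
  have "inj G"
    using metric_nondegenerate[of G, OF pos] by (metis injI)
  then have "surj G" using linear_injective_imp_surjective[OF lin] by blast
  then have "\<forall>u w. f u \<bullet> G w = u \<bullet> G (inv G (adjoint f (G w)))"
    using adjoint_works[OF assms(2)] by (simp add: surj_f_inv_f)
  then have "\<exists>f'. \<forall>u w. f u \<bullet> G w = u \<bullet> G (f' w)" by (rule exI[of _ "\<lambda>w. inv G (adjoint f (G w))"])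
  then show ?thesis unfolding metric_adjoint_def by (rule someI2_ex) blast
qed

locale orthogonal_splitting = levi_civita_submanifold +
  fixes HM VM :: "'a \<Rightarrow> 'a set"
    and H V :: "'a \<Rightarrow> 'a \<Rightarrow>\<^sub>L 'a"
    and \<Gamma>0 \<Gamma>H \<Gamma>V :: "'a \<Rightarrow> 'a \<Rightarrow>\<^sub>L 'a \<Rightarrow>\<^sub>L 'a"
  assumes g_symmetric: "x \<in> S \<Longrightarrow> u \<bullet> g x w = g x u \<bullet> w"
    and g_positive: "x \<in> S \<Longrightarrow> u \<noteq> 0 \<Longrightarrow> u \<bullet> g x u > 0"
    and P_orthogonal: "x \<in> S \<Longrightarrow> s \<in> tangent_space S x \<Longrightarrow> s \<bullet> g x (w - P x w) = 0"
    and decomposition: "orthogonal_decomposition S m HM VM"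
    and projH: "projection_field S g HM H"
    and projV: "projection_field S g VM V"
    and smooth_Gamma0: "smooth_map S \<Gamma>0"
    and smooth_GammaH: "smooth_map S \<Gamma>H"
    and Gamma0: "\<And>x \<xi> \<omega>. x \<in> S \<Longrightarrow> \<xi> \<in> tangent_space S x \<Longrightarrow>
        \<Gamma>0 x \<xi> \<omega> = dir_deriv S P x \<xi> \<omega> + \<Gamma> x \<xi> \<omega>"
    and GammaH: "\<And>x \<xi> \<omega>. x \<in> S \<Longrightarrow> \<xi> \<in> tangent_space S x \<Longrightarrow>
        \<Gamma>H x \<xi> \<omega> = - dir_deriv S H x \<xi> \<omega> + H x (\<Gamma>0 x \<xi> \<omega>)"
    and GammaV: "\<And>x \<xi> \<omega>. x \<in> S \<Longrightarrow> \<xi> \<in> tangent_space S x \<Longrightarrow>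
        \<Gamma>V x \<xi> \<omega> = - dir_deriv S V x \<xi> \<omega> + V x (\<Gamma>0 x \<xi> \<omega>)"
begin

lemma HM_subspace: "x \<in> S \<Longrightarrow> subspace (HM x)" and VM_subspace: "x \<in> S \<Longrightarrow> subspace (VM x)"
  and tangent_eq: "x \<in> S \<Longrightarrow> T x = {h + v |h v. h \<in> HM x \<and> v \<in> VM x}"
  using decomposition unfolding orthogonal_decomposition_def by auto

lemma HM_tangent: "x \<in> S \<Longrightarrow> h \<in> HM x \<Longrightarrow> h \<in> T x"
  using tangent_eq[of x] subspace_0[OF VM_subspace] by (force intro: exI[of _ h])

lemma VM_tangent: "x \<in> S \<Longrightarrow> v \<in> VM x \<Longrightarrow> v \<in> T x"
  using tangent_eq[of x] subspace_0[OF HM_subspace] by (force intro: exI[of _ v])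

lemma HM_VM_orthogonal:
  assumes "x \<in> S" "h \<in> HM x" "v \<in> VM x"
  shows "h \<bullet> g x v = 0" "v \<bullet> g x h = 0"
proof -
  show "h \<bullet> g x v = 0"
    using decomposition assms m_eq[OF assms(1) HM_tangent[OF assms(1,2)] VM_tangent[OF assms(1,3)]]
    unfolding orthogonal_decomposition_def by metis
  then show "v \<bullet> g x h = 0" using g_symmetric[OF assms(1), of v h] by (simp add: inner_commute)
qed

lemma projection_unique:
  assumes "projection_field S g F Q" "x \<in> S" "subspace (F x)" "u \<in> F x" "\<And>s. s \<in> F x \<Longrightarrow> s \<bullet> g x (w - u) = 0"
  shows "Q x w = u"
proof (rule ccontr)
  assume ne: "Q x w \<noteq> u"
  have Q: "Q x w \<in> F x" "\<And>s. s \<in> F x \<Longrightarrow> s \<bullet> g x (w - Q x w) = 0"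
    using assms(1,2) unfolding projection_field_def by auto
  let ?d = "Q x w - u"
  have d: "?d \<in> F x" using subspace_diff[OF assms(3) Q(1) assms(4)] .
  have "?d \<bullet> g x (w - u) - ?d \<bullet> g x (w - Q x w) = 0" using assms(5) Q(2) d by simp
  then have "?d \<bullet> g x ?d = 0" by (simp add: blinfun.diff_right inner_diff_right)
  then show False using g_positive[OF assms(2), of ?d] ne by simp
qed

lemma smooth_H: "smooth_map S H" and H_in: "x \<in> S \<Longrightarrow> H x w \<in> HM x"
  and H_orthogonal: "x \<in> S \<Longrightarrow> s \<in> HM x \<Longrightarrow> s \<bullet> g x (w - H x w) = 0"
  using projH unfolding projection_field_def by auto

lemma smooth_V: "smooth_map S V" and V_in: "x \<in> S \<Longrightarrow> V x w \<in> VM x"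
  and V_orthogonal: "x \<in> S \<Longrightarrow> s \<in> VM x \<Longrightarrow> s \<bullet> g x (w - V x w) = 0"
  using projV unfolding projection_field_def by auto

lemma H_ident: "x \<in> S \<Longrightarrow> h \<in> HM x \<Longrightarrow> H x h = h"
  by (rule projection_unique[OF projH _ HM_subspace]) auto

lemma V_ident: "x \<in> S \<Longrightarrow> v \<in> VM x \<Longrightarrow> V x v = v"
  by (rule projection_unique[OF projV _ VM_subspace]) auto

lemma H_vertical: "x \<in> S \<Longrightarrow> v \<in> VM x \<Longrightarrow> H x v = 0"
  by (rule projection_unique[OF projH _ HM_subspace]) (auto simp: HM_VM_orthogonal subspace_0 HM_subspace)

lemma V_horizontal: "x \<in> S \<Longrightarrow> h \<in> HM x \<Longrightarrow> V x h = 0"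
  by (rule projection_unique[OF projV _ VM_subspace]) (auto simp: HM_VM_orthogonal subspace_0 VM_subspace)

lemma H_P: assumes "x \<in> S" shows "H x (P x w) = H x w"
proof (rule projection_unique[OF projH assms HM_subspace[OF assms] H_in[OF assms]])
  fix s assume s: "s \<in> HM x"
  have "s \<bullet> g x (P x w - H x w) = s \<bullet> g x (w - H x w) - s \<bullet> g x (w - P x w)"
    by (simp add: blinfun.diff_right inner_diff_right)
  then show "s \<bullet> g x (P x w - H x w) = 0"
    using H_orthogonal[OF assms s] P_orthogonal[OF assms HM_tangent[OF assms s]] by simp
qed

lemma V_P: assumes "x \<in> S" shows "V x (P x w) = V x w"
proof (rule projection_unique[OF projV assms VM_subspace[OF assms] V_in[OF assms]])
  fix s assume s: "s \<in> VM x"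
  have "s \<bullet> g x (P x w - V x w) = s \<bullet> g x (w - V x w) - s \<bullet> g x (w - P x w)"
    by (simp add: blinfun.diff_right inner_diff_right)
  then show "s \<bullet> g x (P x w - V x w) = 0"
    using V_orthogonal[OF assms s] P_orthogonal[OF assms VM_tangent[OF assms s]] by simp
qed

lemma H_plus_V: assumes "x \<in> S" "t \<in> T x" shows "H x t + V x t = t"
proof -
  obtain h v where "t = h + v" "h \<in> HM x" "v \<in> VM x" using tangent_eq assms by auto
  then show ?thesis
    by (simp add: blinfun.add_right H_ident V_ident H_vertical V_horizontal assms(1))
qed

lemma inner_H: assumes "x \<in> S" "h \<in> HM x" shows "h \<bullet> g x (H x w) = h \<bullet> g x w"
  using H_orthogonal[OF assms, of w] by (simp add: blinfun.diff_right inner_diff_right)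

lemma inner_V: assumes "x \<in> S" "v \<in> VM x" shows "v \<bullet> g x (V x w) = v \<bullet> g x w"
  using V_orthogonal[OF assms, of w] by (simp add: blinfun.diff_right inner_diff_right)

lemma g_commute: "x \<in> S \<Longrightarrow> u \<bullet> g x w = w \<bullet> g x u"
  by (metis g_symmetric inner_commute)

lemma vector_field_H: "vector_field S (\<lambda>y. H y w)" and vector_field_V: "vector_field S (\<lambda>y. V y w)"
  using vector_field_apply smooth_H smooth_V H_in V_in HM_tangent VM_tangent by blast+

lemma H_nabla_horizontal:
  assumes "vector_field S Y" "\<And>y. y \<in> S \<Longrightarrow> Y y \<in> HM y" "x \<in> S" "\<xi> \<in> T x"
  shows "H x (D Y x \<xi> + \<Gamma> x \<xi> (Y x)) = D Y x \<xi> + \<Gamma>H x \<xi> (Y x)"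
  by (rule projected_covariant_derivative(1)[where Q = H, OF smooth_H H_P assms(3,4) Gamma0[OF assms(3,4)]
        GammaH[OF assms(3,4)] assms(1)]) (use H_ident assms(2) in auto)

lemma H_nabla_vertical:
  assumes "vector_field S Y" "\<And>y. y \<in> S \<Longrightarrow> Y y \<in> VM y" "x \<in> S" "\<xi> \<in> T x"
  shows "H x (D Y x \<xi> + \<Gamma> x \<xi> (Y x)) = \<Gamma>H x \<xi> (Y x)"
  by (rule projected_covariant_derivative(2)[where Q = H, OF smooth_H H_P assms(3,4) Gamma0[OF assms(3,4)]
        GammaH[OF assms(3,4)] assms(1)]) (use H_vertical assms(2) in auto)

lemma V_nabla_horizontal:
  assumes "vector_field S Y" "\<And>y. y \<in> S \<Longrightarrow> Y y \<in> HM y" "x \<in> S" "\<xi> \<in> T x"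
  shows "V x (D Y x \<xi> + \<Gamma> x \<xi> (Y x)) = \<Gamma>V x \<xi> (Y x)"
  by (rule projected_covariant_derivative(2)[where Q = V, OF smooth_V V_P assms(3,4) Gamma0[OF assms(3,4)]
        GammaV[OF assms(3,4)] assms(1)]) (use V_horizontal assms(2) in auto)

abbreviation A where "A \<equiv> oneill_A S nab H V"
abbreviation A_adj where "A_adj \<equiv> oneill_A_adj S g nab H V"

lemma A_eq_cov: "x \<in> S \<Longrightarrow> \<xi> \<in> T x \<Longrightarrow> A x \<xi> \<omega> = V x (D (\<lambda>y. H y \<omega>) x \<xi> + \<Gamma> x \<xi> (H x \<omega>))"
  unfolding oneill_A_def by (simp add: cov_deriv_at_eq vector_field_H)

lemma A_eq: "x \<in> S \<Longrightarrow> \<xi> \<in> T x \<Longrightarrow> A x \<xi> \<omega> = \<Gamma>V x \<xi> (H x \<omega>)"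
  using A_eq_cov V_nabla_horizontal[OF vector_field_H H_in] by simp

lemma A_vertical: "x \<in> S \<Longrightarrow> A x \<xi> \<omega> \<in> VM x"
  unfolding oneill_A_def by (rule V_in)

lemma A_adjoint:
  assumes "x \<in> S" "\<xi> \<in> T x"
  shows "A x \<xi> u \<bullet> g x w = u \<bullet> g x (A_adj x \<xi> w)"
  unfolding oneill_A_adj_def
proof (rule metric_adjoint[OF g_positive[OF assms(1)]])
  have "A x \<xi> = (\<lambda>\<omega>. \<Gamma>V x \<xi> (H x \<omega>))" using A_eq[OF assms] by auto
  then show "linear (A x \<xi>)"
    by (simp add: bounded_linear.linear bounded_linear_compose[OF blinfun.bounded_linear_right blinfun.bounded_linear_right])
qed

text \<open>The fields \<open>H u\<close> and \<open>V \<omega>\<close> are orthogonal everywhere, so \<open>0 = \<langle>\<nabla>\<^sub>\<xi> (H u), V \<omega>\<rangle> + \<langle>H u, \<nabla>\<^sub>\<xi> (V \<omega>)\<rangle>\<close>. The first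
product is \<open>\<langle>A\<^sub>\<xi> u, \<omega>\<rangle>\<close>, the second one is \<open>\<langle>u, H \<nabla>\<^sub>\<xi> (V \<omega>)\<rangle>\<close>.\<close>

lemma A_adj_eq_cov:
  assumes x: "x \<in> S" "\<xi> \<in> T x" and \<omega>: "\<omega> \<in> T x"
  shows "A_adj x \<xi> \<omega> = - H x (cov_deriv_at S nab x \<xi> (\<lambda>y. V y \<omega>))"
proof (rule metric_nondegenerate[of "g x", OF g_positive[OF x(1)]])
  fix u
  let ?Y = "\<lambda>y. H y u" and ?U = "\<lambda>y. V y \<omega>"
  let ?nY = "D ?Y x \<xi> + \<Gamma> x \<xi> (?Y x)" and ?nU = "D ?U x \<xi> + \<Gamma> x \<xi> (?U x)"
  have "D (\<lambda>y. ?Y y \<bullet> g y (?U y)) x \<xi> = D (\<lambda>y. 0) x \<xi>"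
    by (subst dir_deriv_cong[OF _ x(1)]) (simp_all add: HM_VM_orthogonal(1) H_in V_in)
  then have 0: "?nY \<bullet> g x (?U x) + ?Y x \<bullet> g x ?nU = 0"
    using metric_compatible[OF vector_field_H vector_field_V x, of u \<omega>] dir_deriv_const[OF x(2)] by simp
  have "u \<bullet> g x (A_adj x \<xi> \<omega>) = V x ?nY \<bullet> g x \<omega>"
    using A_adjoint[OF x] A_eq_cov[OF x] by simp
  also have "\<dots> = V x ?nY \<bullet> g x (?U x)" using inner_V[OF x(1) V_in[OF x(1)]] by simp
  also have "\<dots> = ?U x \<bullet> g x (V x ?nY)" by (rule g_commute[OF x(1)])
  also have "\<dots> = ?nY \<bullet> g x (?U x)" using inner_V[OF x(1) V_in[OF x(1)]] g_commute[OF x(1)] by simp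
  also have "\<dots> = - (?Y x \<bullet> g x (H x ?nU))" using 0 inner_H[OF x(1) H_in[OF x(1)]] by simp
  also have "\<dots> = - (u \<bullet> g x (H x ?nU))"
    using inner_H[OF x(1) H_in[OF x(1)]] g_commute[OF x(1)] by metis
  finally show "u \<bullet> g x (A_adj x \<xi> \<omega>) = u \<bullet> g x (- H x (cov_deriv_at S nab x \<xi> ?U))"
    by (simp add: cov_deriv_at_eq[OF vector_field_V x] blinfun.minus_right)
qed

lemma A_adj_eq:
  assumes "x \<in> S" "\<xi> \<in> T x" "\<omega> \<in> T x"
  shows "A_adj x \<xi> \<omega> = - \<Gamma>H x \<xi> (V x \<omega>)"
  using A_adj_eq_cov[OF assms] H_nabla_vertical[OF vector_field_V V_in assms(1,2)]
  by (simp add: cov_deriv_at_eq[OF vector_field_V assms(1,2)])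

lemma A_adj_horizontal: "x \<in> S \<Longrightarrow> \<xi> \<in> T x \<Longrightarrow> \<omega> \<in> T x \<Longrightarrow> A_adj x \<xi> \<omega> \<in> HM x"
  using A_adj_eq_cov H_in subspace_neg[OF HM_subspace] by simp

section \<open>Curvature of the horizontal connection\<close>

abbreviation RH where "RH \<equiv> horizontal_curvature S g nab H V \<Gamma>H"
abbreviation RM where "RM \<equiv> curvature_tensor S nab"

lemma dir_deriv_GammaH:
  assumes "x \<in> S" "\<xi> \<in> T x"
  shows "D (\<lambda>y. \<Gamma>H y \<eta> \<phi>) x \<xi> = D \<Gamma>H x \<xi> \<eta> \<phi>"
proof -
  note d = smooth_map_differentiable[OF smooth_GammaH assms(1)]
  have "(\<lambda>y. \<Gamma>H y \<eta>) differentiable (at x within S)"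
    by (rule differentiable_blinfun_apply[OF d]) simp
  then show ?thesis
    using dir_deriv_apply_const[OF _ assms(2)] dir_deriv_apply_const[OF d assms(2)] by metis
qed

text \<open>The left-hand side is the curvature of \<open>Z \<mapsto> H \<nabla>\<^sub>X Z\<close> on the horizontal bundle. Splitting \<open>\<nabla>\<^sub>Y Z\<close> into its
horizontal part and its vertical part \<open>A\<^sub>Y Z\<close>, one finds
\<open>H \<nabla>\<^sub>X \<nabla>\<^sub>Y Z = H \<nabla>\<^sub>X (H \<nabla>\<^sub>Y Z) - A\<^sup>*\<^sub>X A\<^sub>Y Z\<close>, and the \<open>A\<close>-terms are the difference to \<open>H R\<^sup>M\<close>.\<close>

lemma connection_H_curvature:
  assumes x: "x \<in> S" and \<xi>: "\<xi> \<in> T x" and \<eta>: "\<eta> \<in> T x" and \<phi>: "\<phi> \<in> HM x"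
  shows "- D \<Gamma>H x \<xi> \<eta> \<phi> + D \<Gamma>H x \<eta> \<xi> \<phi> - \<Gamma>H x \<xi> (\<Gamma>H x \<eta> \<phi>) + \<Gamma>H x \<eta> (\<Gamma>H x \<xi> \<phi>)
    = H x (RM x \<xi> \<eta> \<phi>) - A_adj x \<xi> (A x \<eta> \<phi>) + A_adj x \<eta> (A x \<xi> \<phi>)"
proof -
  let ?X = "\<lambda>y. P y \<xi>" and ?Y = "\<lambda>y. P y \<eta>" and ?Z = "\<lambda>y. H y \<phi>"
  let ?N = "\<lambda>X Z y. D Z y (X y) + \<Gamma>H y (X y) (Z y)"
  have at: "?X x = \<xi>" "?Y x = \<eta>" "?Z x = \<phi>" using P_ident H_ident assms by auto
  note X = vector_field_P[of \<xi>] and Y = vector_field_P[of \<eta>] and Z = vector_field_H[of \<phi>]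
  have N: "H y (nab X Z y) = ?N X Z y"
    if "vector_field S X" "vector_field S Z" "\<And>y. y \<in> S \<Longrightarrow> Z y \<in> HM y" "y \<in> S" for X Z y
    using H_nabla_horizontal[OF that(2,3,4) vector_fieldD(2)[OF that(1,4)]] nab_eq[OF that(1,2,4)] by simp
  have second: "H x (nab X (nab Y ?Z) x) = ?N X (?N Y ?Z) x - A_adj x (X x) (A x (Y x) \<phi>)"
    if X: "vector_field S X" and Y: "vector_field S Y" for X Y
  proof -
    let ?W = "nab Y ?Z"
    let ?h = "\<lambda>y. H y (?W y)" and ?v = "\<lambda>y. V y (?W y)"
    note W = nab_vector_field[OF Y Z]
    have h: "vector_field S ?h"
      using smooth_map_blinfun_apply[OF smooth_H vector_fieldD(1)[OF W]] H_in HM_tangent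
      unfolding vector_field_def by blast
    have v: "vector_field S ?v"
      using smooth_map_blinfun_apply[OF smooth_V vector_fieldD(1)[OF W]] V_in VM_tangent
      unfolding vector_field_def by blast
    have "D ?W x = D (\<lambda>y. ?h y + ?v y) x"
      by (rule dir_deriv_cong[OF _ x]) (simp add: H_plus_V vector_fieldD(2)[OF W])
    then have "D ?W x (X x) = D ?h x (X x) + D ?v x (X x)"
      using dir_deriv_add[OF smooth_map_differentiable[OF vector_fieldD(1)[OF h] x]
          smooth_map_differentiable[OF vector_fieldD(1)[OF v] x] vector_fieldD(2)[OF X x]] by simp
    moreover have "?W x = ?h x + ?v x" by (simp add: H_plus_V vector_fieldD(2)[OF W] x)
    then have "\<Gamma> x (X x) (?W x) = \<Gamma> x (X x) (?h x) + \<Gamma> x (X x) (?v x)" by (metis blinfun.add_right)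
    ultimately have "nab X ?W x = nab X ?h x + nab X ?v x"
      by (simp add: nab_eq[OF X W x] nab_eq[OF X h x] nab_eq[OF X v x])
    moreover have "H x (nab X ?h x) = ?N X ?h x" by (rule N[OF X h H_in x])
    moreover have "D ?h x = D (?N Y ?Z) x" by (rule dir_deriv_cong[OF N[OF Y Z H_in] x])
    moreover have "?h x = ?N Y ?Z x" by (rule N[OF Y Z H_in x])
    moreover have "H x (nab X ?v x) = - A_adj x (X x) (A x (Y x) \<phi>)"
    proof -
      have "?v x = A x (Y x) \<phi>"
        using A_eq_cov[OF x vector_fieldD(2)[OF Y x]] nab_eq[OF Y Z x] by simp
      moreover have "V x (A x (Y x) \<phi>) = A x (Y x) \<phi>" by (rule V_ident[OF x A_vertical[OF x]])
      ultimately show ?thesis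
        using H_nabla_vertical[OF v V_in x vector_fieldD(2)[OF X x]] nab_eq[OF X v x]
          A_adj_eq[OF x vector_fieldD(2)[OF X x] VM_tangent[OF x A_vertical[OF x]]] by simp
    qed
    ultimately show ?thesis by (simp add: blinfun.add_right)
  qed
  note br = vector_field_lie_bracket[OF X Y]
  have "H x (RM x \<xi> \<eta> \<phi>) = H x (curvature_field S nab ?X ?Y ?Z x)"
    using curvature_tensor_eq[OF x \<xi> \<eta> HM_tangent[OF x \<phi>]] curvature_field_eq[OF X Y Z x] at by simp
  also have "\<dots> = ?N (lie_bracket S ?X ?Y) ?Z x - (?N ?X (?N ?Y ?Z) x - A_adj x \<xi> (A x \<eta> \<phi>))
      + (?N ?Y (?N ?X ?Z) x - A_adj x \<eta> (A x \<xi> \<phi>))"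
    using second[OF X Y] second[OF Y X] N[OF br Z H_in x] at
    by (simp add: curvature_field_def blinfun.add_right blinfun.diff_right)
  also have "\<dots> = (?N (lie_bracket S ?X ?Y) ?Z x - ?N ?X (?N ?Y ?Z) x + ?N ?Y (?N ?X ?Z) x)
      + A_adj x \<xi> (A x \<eta> \<phi>) - A_adj x \<eta> (A x \<xi> \<phi>)"
    by simp
  also have "?N (lie_bracket S ?X ?Y) ?Z x - ?N ?X (?N ?Y ?Z) x + ?N ?Y (?N ?X ?Z) x =
      - D \<Gamma>H x \<xi> \<eta> \<phi> + D \<Gamma>H x \<eta> \<xi> \<phi> - \<Gamma>H x \<xi> (\<Gamma>H x \<eta> \<phi>) + \<Gamma>H x \<eta> (\<Gamma>H x \<xi> \<phi>)"
    using bundle_curvature[OF vector_fieldD(1)[OF Z] x vector_fieldD(1)[OF X] vector_fieldD(1)[OF Y]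
        vector_fieldD(2)[OF X] vector_fieldD(2)[OF Y] smooth_map_differentiable[OF smooth_GammaH x]
        vector_fieldD(2)[OF br x]] at by simp
  finally show ?thesis by simp
qed

lemma RH_eq:
  assumes "x \<in> S" "\<xi> \<in> T x" "\<eta> \<in> T x"
  shows "RH x \<xi> \<eta> \<phi> = 2 *\<^sub>R A_adj x \<phi> (A x \<xi> \<eta>)
    + (- D \<Gamma>H x \<xi> \<eta> \<phi> + D \<Gamma>H x \<eta> \<xi> \<phi> - \<Gamma>H x \<xi> (\<Gamma>H x \<eta> \<phi>) + \<Gamma>H x \<eta> (\<Gamma>H x \<xi> \<phi>))"
  unfolding horizontal_curvature_def by (simp add: dir_deriv_GammaH assms)

lemma oneill_equation:
  assumes "x \<in> S" "\<xi> \<in> T x" "\<eta> \<in> T x" "\<phi> \<in> HM x"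
  shows "RH x \<xi> \<eta> \<phi> = H x (RM x \<xi> \<eta> \<phi>) + 2 *\<^sub>R A_adj x \<phi> (A x \<xi> \<eta>)
    - A_adj x \<xi> (A x \<eta> \<phi>) + A_adj x \<eta> (A x \<xi> \<phi>)"
  unfolding RH_eq[OF assms(1-3)] connection_H_curvature[OF assms] by simp

lemma RH_horizontal:
  assumes "x \<in> S" "\<xi> \<in> T x" "\<eta> \<in> T x" "\<phi> \<in> HM x"
  shows "RH x \<xi> \<eta> \<phi> \<in> HM x"
  unfolding oneill_equation[OF assms]
  by (intro subspace_add subspace_diff subspace_scale HM_subspace H_in A_adj_horizontal
      VM_tangent A_vertical assms(1-3) HM_tangent[OF assms(1,4)])

text \<open>The difference of \<open>\<Gamma>H\<close> and \<open>H \<Gamma>0\<close> sends a tangent vector \<open>v\<close> to \<open>- D\<^sub>v (H \<phi>)\<close>, and the antisymmetrised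
derivative of this vanishes by the symmetry of second derivatives of \<open>H \<phi>\<close>. Away from \<open>x\<close> the vectors
\<open>\<xi>\<close> and \<open>\<eta>\<close> need not be tangent, so the argument is run with \<open>P \<xi>\<close> and \<open>P \<eta>\<close>; the correction terms involve
only the bracket of these two fields, which is tangent.\<close>

lemma dir_deriv_H_Gamma0:
  assumes "x \<in> S" "\<xi> \<in> T x" "\<eta> \<in> T x"
  shows "- D \<Gamma>H x \<xi> \<eta> \<phi> + D \<Gamma>H x \<eta> \<xi> \<phi>
    = - D (\<lambda>y. H y (\<Gamma>0 y \<eta> \<phi>)) x \<xi> + D (\<lambda>y. H y (\<Gamma>0 y \<xi> \<phi>)) x \<eta>"
proof -
  note x = assms(1)
  let ?f = "\<lambda>y. H y \<phi>"
  note d0 = smooth_map_differentiable[OF smooth_Gamma0 x] and dG = smooth_map_differentiable[OF smooth_GammaH x]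
    and dH = smooth_map_differentiable[OF smooth_H x]
  have *: "D \<Gamma>H x \<xi> \<eta> \<phi> + \<Gamma>H x (D (\<lambda>y. P y \<eta>) x \<xi>) \<phi> =
      - D (\<lambda>y. D ?f y (P y \<eta>)) x \<xi> + D (\<lambda>y. H y (\<Gamma>0 y \<eta> \<phi>)) x \<xi> + H x (\<Gamma>0 x (D (\<lambda>y. P y \<eta>) x \<xi>) \<phi>)"
    if \<xi>: "\<xi> \<in> T x" and \<eta>: "\<eta> \<in> T x" for \<xi> \<eta>
  proof -
    let ?Y = "\<lambda>y. P y \<eta>"
    note Y = vector_field_P[of \<eta>]
    note dY = smooth_map_differentiable[OF vector_fieldD(1)[OF Y] x]
    have Yx: "?Y x = \<eta>" using P_ident x \<eta> by blast
    note smooth_f = vector_fieldD(1)[OF vector_field_H[of \<phi>]]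
    note df = smooth_map_differentiable[OF smooth_map_dir_deriv[OF smooth_f vector_fieldD(1)[OF Y]
          vector_fieldD(2)[OF Y]] x, simplified]
    have c: "(\<lambda>y. c) differentiable (at x within S)" for c :: 'a by simp
    note d0Y = differentiable_blinfun_apply[OF d0 dY] and d0e = differentiable_blinfun_apply[OF d0 c[of \<eta>]]
    note d0Yp = differentiable_blinfun_apply[OF d0Y c[of \<phi>]] and d0ep = differentiable_blinfun_apply[OF d0e c[of \<phi>]]
    have e1: "D (\<lambda>y. \<Gamma>H y (?Y y) \<phi>) x = D (\<lambda>y. H y (\<Gamma>0 y (?Y y) \<phi>) - D ?f y (?Y y)) x"
    proof (rule dir_deriv_cong[OF _ x])
      fix y assume y: "y \<in> S"
      have "D H y (?Y y) \<phi> = D ?f y (?Y y)"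
        using dir_deriv_apply_const[OF smooth_map_differentiable[OF smooth_H y] P_tangent[OF y]] by simp
      then show "\<Gamma>H y (?Y y) \<phi> = H y (\<Gamma>0 y (?Y y) \<phi>) - D ?f y (?Y y)"
        using GammaH[OF y P_tangent[OF y]] by simp
    qed
    have e2: "D (\<lambda>y. \<Gamma>H y (?Y y) \<phi>) x \<xi> = D \<Gamma>H x \<xi> \<eta> \<phi> + \<Gamma>H x (D ?Y x \<xi>) \<phi>"
      by (simp add: dir_deriv_apply_const[OF differentiable_blinfun_apply[OF dG dY] \<xi>]
          dir_deriv_blinfun_apply[OF dG dY \<xi>] Yx blinfun.add_left)
    have e3: "D (\<lambda>y. H y (\<Gamma>0 y (?Y y) \<phi>) - D ?f y (?Y y)) x \<xi> =
        D (\<lambda>y. H y (\<Gamma>0 y (?Y y) \<phi>)) x \<xi> - D (\<lambda>y. D ?f y (?Y y)) x \<xi>"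
      by (rule dir_deriv_diff[OF differentiable_blinfun_apply[OF dH d0Yp] df \<xi>])
    have e4: "D (\<lambda>y. H y (\<Gamma>0 y (?Y y) \<phi>)) x \<xi> =
        D (\<lambda>y. H y (\<Gamma>0 y \<eta> \<phi>)) x \<xi> + H x (\<Gamma>0 x (D ?Y x \<xi>) \<phi>)"
      unfolding dir_deriv_blinfun_apply[OF dH d0Yp \<xi>] dir_deriv_blinfun_apply[OF dH d0ep \<xi>]
        dir_deriv_apply_const[OF d0Y \<xi>] dir_deriv_apply_const[OF d0e \<xi>]
        dir_deriv_blinfun_apply[OF d0 dY \<xi>] dir_deriv_apply_const[OF d0 \<xi>]
      by (simp add: Yx blinfun.add_left blinfun.add_right)
    show ?thesis
      unfolding e2[symmetric] e1 e3 e4 by simp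
  qed
  let ?X = "\<lambda>y. P y \<xi>" and ?Y = "\<lambda>y. P y \<eta>"
  note X = vector_field_P[of \<xi>] and Y = vector_field_P[of \<eta>]
  let ?B = "lie_bracket S ?X ?Y x"
  have B: "?B \<in> T x" by (rule vector_fieldD(2)[OF vector_field_lie_bracket[OF X Y] x])
  have B_eq: "?B = D ?Y x \<xi> - D ?X x \<eta>" using P_ident[OF x] assms by (simp add: lie_bracket_def)
  have at: "?X x = \<xi>" "?Y x = \<eta>" using P_ident assms by auto
  have c1: "D (\<lambda>y. D ?f y (?Y y)) x \<xi> - D (\<lambda>y. D ?f y (?X y)) x \<eta> = D ?f x ?B"
    using dir_deriv_commutator[OF vector_fieldD(1)[OF vector_field_H] x
        smooth_map_differentiable[OF vector_fieldD(1)[OF X] x] smooth_map_differentiable[OF vector_fieldD(1)[OF Y] x]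
        vector_fieldD(2)[OF X] vector_fieldD(2)[OF Y] B, of \<phi>] at by simp
  have "\<Gamma>H x ?B \<phi> = H x (\<Gamma>0 x ?B \<phi>) - D ?f x ?B"
    using GammaH[OF x B] dir_deriv_apply_const[OF dH B] by simp
  then have c2: "\<Gamma>H x (D ?Y x \<xi>) \<phi> - \<Gamma>H x (D ?X x \<eta>) \<phi>
      = H x (\<Gamma>0 x (D ?Y x \<xi>) \<phi>) - H x (\<Gamma>0 x (D ?X x \<eta>) \<phi>) - D ?f x ?B"
    unfolding B_eq by (simp only: blinfun.diff_left blinfun.diff_right)
  have arith: "- a1 + a2 = - h1 + h2"
    if "a1 + g1 = - f1 + h1 + k1" "a2 + g2 = - f2 + h2 + k2" "f1 - f2 = d" "g1 - g2 = k1 - k2 - d"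
    for a1 a2 f1 f2 g1 g2 h1 h2 k1 k2 d :: 'a
  proof -
    have "a1 = - f1 + h1 + k1 - g1" "a2 = - f2 + h2 + k2 - g2" "f1 = d + f2"
      using that by (simp_all add: eq_diff_eq diff_eq_eq)
    moreover have "g1 = k1 - k2 - d + g2" using that(4) by (metis diff_add_cancel)
    ultimately show ?thesis by simp
  qed
  show ?thesis by (rule arith[OF *[OF assms(2,3)] *[OF assms(3,2)] c1 c2])
qed

end

section \<open>Riemannian submersions in a chart of the base\<close>

text \<open>Here \<open>f\<close> is a submersion followed by a chart; it is defined on the open part \<open>S \<inter> \<Omega>\<close> of the total space
and takes values in the image \<open>N\<close> of the chart, an open subset of the linear space \<open>L\<close>.\<close>

locale submersion_chart =
  orthogonal_splitting S P m g nab \<Gamma> HM VM H V \<Gamma>0 \<Gamma>H \<Gamma>V +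
  B: levi_civita_submanifold N "\<lambda>_. \<pi>" mB G nabB \<Gamma>B
  for S :: "'a::euclidean_space set" and P m g nab \<Gamma> HM VM H V \<Gamma>0 \<Gamma>H \<Gamma>V
    and N :: "'f::euclidean_space set" and \<pi> mB G nabB \<Gamma>B +
  fixes L :: "'f set" and \<Omega> :: "'a set" and f :: "'a \<Rightarrow> 'f"
  assumes open_domain: "open \<Omega>"
    and smooth_f: "smooth_map (S \<inter> \<Omega>) f"
    and f_in: "x \<in> S \<inter> \<Omega> \<Longrightarrow> f x \<in> N"
    and subspace_L: "subspace L"
    and tangent_N: "y \<in> N \<Longrightarrow> tangent_space N y = L"
    and mB_positive: "y \<in> N \<Longrightarrow> u \<in> L \<Longrightarrow> u \<noteq> 0 \<Longrightarrow> mB y u u > 0"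
    and mB_symmetric: "y \<in> N \<Longrightarrow> u \<in> L \<Longrightarrow> v \<in> L \<Longrightarrow> mB y u v = mB y v u"
    and submersion: "x \<in> S \<inter> \<Omega> \<Longrightarrow> dir_deriv S f x ` tangent_space S x = L"
    and vertical: "x \<in> S \<inter> \<Omega> \<Longrightarrow> \<xi> \<in> VM x \<Longrightarrow> dir_deriv S f x \<xi> = 0"
    and isometry: "x \<in> S \<inter> \<Omega> \<Longrightarrow> \<xi> \<in> HM x \<Longrightarrow> \<eta> \<in> HM x \<Longrightarrow>
      mB (f x) (dir_deriv S f x \<xi>) (dir_deriv S f x \<eta>) = m x \<xi> \<eta>"
begin

abbreviation S' where "S' \<equiv> S \<inter> \<Omega>"

lemma chart_domainD: "x \<in> S' \<Longrightarrow> x \<in> S" "x \<in> S' \<Longrightarrow> x \<in> \<Omega>"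
  by auto

lemma tangent_S': "x \<in> S' \<Longrightarrow> tangent_space S' x = T x"
  by (rule tangent_space_Int_open[OF open_domain]) auto

lemma dir_deriv_S': "x \<in> S' \<Longrightarrow> dir_deriv S' h x = D h x"
  by (rule dir_deriv_Int_open[OF open_domain]) auto

lemma dir_deriv_local_cong:
  assumes "\<And>y. y \<in> S' \<Longrightarrow> h y = k y" "x \<in> S'"
  shows "D h x = D k x"
  using dir_deriv_cong[of S' h k x, OF assms] by (simp only: dir_deriv_S'[OF assms(2)])

lemma differentiable_local: "smooth_map S' h \<Longrightarrow> x \<in> S' \<Longrightarrow> h differentiable (at x within S)"
  using smooth_map_differentiable[of S' h x] at_within_Int_open[OF open_domain, of x S] by auto

lemma field_differentiable: "vector_field S X \<Longrightarrow> x \<in> S' \<Longrightarrow> X differentiable (at x within S)"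
  by (rule smooth_map_differentiable[OF vector_fieldD(1)]) auto

text \<open>The differential of \<open>f\<close>, extended by means of \<open>P\<close> from the tangent space to the whole Euclidean space, so
that it becomes an operator-valued map that can be differentiated.\<close>

definition dF :: "'a \<Rightarrow> 'a \<Rightarrow>\<^sub>L 'f" where
  "dF y = (\<Sum>i\<in>Basis. rank_one i (D f y (P y i)))"

lemma dF_apply:
  assumes "x \<in> S'"
  shows "dF x u = D f x (P x u)"
proof -
  have "linear (D f x)"
    by (rule bounded_linear.linear[OF bounded_linear_dir_deriv[OF differentiable_local[OF smooth_f assms]]])
  then have "linear (D f x \<circ> P x)"
    by (rule linear_compose[OF bounded_linear.linear[OF blinfun.bounded_linear_right]])
  then show ?thesis using sum_rank_one_apply[of "D f x \<circ> P x" u] by (simp add: dF_def)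
qed

lemma dF_tangent: "x \<in> S' \<Longrightarrow> t \<in> T x \<Longrightarrow> dF x t = D f x t"
  by (simp add: dF_apply P_ident)

lemma smooth_P': "smooth_map S' P"
  by (rule smooth_map_subset[OF smooth_P]) auto

lemma smooth_Pf: "smooth_map S' (\<lambda>y. D f y (P y u))"
proof -
  have "smooth_map S' (\<lambda>y. dir_deriv S' f y (P y u))"
    by (rule smooth_map_dir_deriv[OF smooth_f smooth_map_blinfun_apply[OF smooth_P' smooth_map_const]])
      (simp add: tangent_S' P_tangent)
  then show ?thesis
    using smooth_map_cong[of S' "\<lambda>y. dir_deriv S' f y (P y u)" "\<lambda>y. D f y (P y u)"] by (simp add: dir_deriv_S')
qed

lemma smooth_dF: "smooth_map S' dF"
  unfolding dF_def[abs_def]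
  by (rule smooth_map_sum) (rule smooth_map_bounded_linear[OF bounded_linear_rank_one smooth_Pf])

lemma dF_in_L: assumes "x \<in> S'" shows "dF x u \<in> L"
  using submersion[OF assms] P_tangent[OF chart_domainD(1)[OF assms], of u] by (auto simp: dF_apply[OF assms])

lemma dF_vertical: "x \<in> S' \<Longrightarrow> v \<in> VM x \<Longrightarrow> dF x v = 0"
  by (simp add: dF_tangent VM_tangent vertical)

lemma dF_H: assumes "x \<in> S'" "t \<in> T x" shows "dF x (H x t) = dF x t"
proof -
  have "dF x t = dF x (H x t + V x t)" using H_plus_V[OF chart_domainD(1)[OF assms(1)] assms(2)] by simp
  then show ?thesis using dF_vertical[OF assms(1) V_in[OF chart_domainD(1)[OF assms(1)]]] by (simp add: blinfun.add_right)
qed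

lemma dF_onto:
  assumes "x \<in> S'" "w \<in> L"
  obtains h where "h \<in> HM x" "dF x h = w"
proof -
  obtain t where t: "t \<in> T x" "D f x t = w" using submersion[OF assms(1)] assms(2) by (metis imageE)
  show ?thesis
    by (rule that[OF H_in[OF chart_domainD(1)[OF assms(1)], of t]]) (use dF_H[OF assms(1) t(1)] dF_tangent[OF assms(1) t(1)] t(2) in simp)
qed

lemma dF_isometry:
  assumes "x \<in> S'" "\<xi> \<in> HM x" "\<eta> \<in> HM x"
  shows "dF x \<xi> \<bullet> G (f x) (dF x \<eta>) = \<xi> \<bullet> g x \<eta>"
proof -
  note x = chart_domainD(1)[OF assms(1)]
  have "dF x \<xi> \<bullet> G (f x) (dF x \<eta>) = mB (f x) (dF x \<xi>) (dF x \<eta>)"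
    using B.m_eq[OF f_in[OF assms(1)]] tangent_N[OF f_in[OF assms(1)]] dF_in_L[OF assms(1)] by simp
  also have "\<dots> = m x \<xi> \<eta>" using isometry[OF assms] assms HM_tangent[OF x] by (simp add: dF_tangent)
  also have "\<dots> = \<xi> \<bullet> g x \<eta>" by (rule m_eq[OF x HM_tangent[OF x assms(2)] HM_tangent[OF x assms(3)]])
  finally show ?thesis .
qed

text \<open>Differentiating \<open>P P = P\<close> gives \<open>P (D\<^sub>\<xi> P) \<eta> = 0\<close> for tangent \<open>\<eta>\<close>, so the tangential part of the bracket
vanishes; but the bracket is tangent.\<close>

lemma lie_bracket_P:
  assumes x: "x \<in> S" and "\<xi> \<in> T x" "\<eta> \<in> T x"
  shows "lie_bracket S (\<lambda>y. P y \<xi>) (\<lambda>y. P y \<eta>) x = 0"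
proof -
  have *: "P x (D (\<lambda>y. P y \<eta>) x \<xi>) = 0" if "\<xi> \<in> T x" "\<eta> \<in> T x" for \<xi> \<eta>
  proof -
    note d = smooth_map_differentiable[OF smooth_P x]
    have "D (\<lambda>y. P y (P y \<eta>)) x \<xi> = D (\<lambda>y. P y \<eta>) x \<xi>"
      by (subst dir_deriv_cong[OF _ x]) (simp_all add: P_ident P_tangent)
    moreover have "D (\<lambda>y. P y (P y \<eta>)) x \<xi> = P x (D (\<lambda>y. P y \<eta>) x \<xi>) + D P x \<xi> (P x \<eta>)"
      by (rule dir_deriv_blinfun_apply[OF d smooth_map_differentiable[OF vector_fieldD(1)[OF vector_field_P] x] that(1)])
    moreover have "D P x \<xi> (P x \<eta>) = D (\<lambda>y. P y \<eta>) x \<xi>"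
      using dir_deriv_apply_const[OF d that(1)] P_ident[OF x that(2)] by simp
    ultimately show ?thesis by simp
  qed
  have "lie_bracket S (\<lambda>y. P y \<xi>) (\<lambda>y. P y \<eta>) x = P x (lie_bracket S (\<lambda>y. P y \<xi>) (\<lambda>y. P y \<eta>) x)"
    using P_ident[OF x vector_fieldD(2)[OF vector_field_lie_bracket[OF vector_field_P vector_field_P] x]] by simp
  also have "\<dots> = 0"
    using *[of \<xi> \<eta>] *[of \<eta> \<xi>] assms P_ident[OF x] by (simp add: lie_bracket_def blinfun.diff_right)
  finally show ?thesis .
qed

lemma dF_symmetric:
  assumes "x \<in> S'" "\<xi> \<in> T x" "\<eta> \<in> T x"
  shows "D dF x \<xi> \<eta> = D dF x \<eta> \<xi>"
proof -
  note x = chart_domainD(1)[OF assms(1)] and d = differentiable_local[OF smooth_dF assms(1)]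
  have *: "D dF x \<xi> \<eta> = dir_deriv S' (\<lambda>y. dir_deriv S' f y (P y \<eta>)) x \<xi>" if "\<xi> \<in> T x" for \<xi> \<eta>
  proof -
    have "D dF x \<xi> \<eta> = D (\<lambda>y. dF y \<eta>) x \<xi>" by (rule dir_deriv_apply_const[OF d that, symmetric])
    also have "D (\<lambda>y. dF y \<eta>) x = D (\<lambda>y. dir_deriv S' f y (P y \<eta>)) x"
      by (rule dir_deriv_local_cong[OF _ assms(1)]) (simp add: dF_apply dir_deriv_S')
    finally show ?thesis by (simp add: dir_deriv_S'[OF assms(1)])
  qed
  have dP: "(\<lambda>y. P y u) differentiable (at x within S')" for u
    by (rule smooth_map_differentiable[OF smooth_map_blinfun_apply[OF smooth_P' smooth_map_const] assms(1)])
  have br: "lie_bracket S' (\<lambda>y. P y \<xi>) (\<lambda>y. P y \<eta>) x = 0"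
    using lie_bracket_P[OF x assms(2,3)] by (simp add: lie_bracket_def dir_deriv_S'[OF assms(1)])
  have "dir_deriv S' (\<lambda>y. dir_deriv S' f y (P y \<eta>)) x (P x \<xi>) - dir_deriv S' (\<lambda>y. dir_deriv S' f y (P y \<xi>)) x (P x \<eta>)
      = dir_deriv S' f x (lie_bracket S' (\<lambda>y. P y \<xi>) (\<lambda>y. P y \<eta>) x)"
    by (rule dir_deriv_commutator[OF smooth_f assms(1) dP dP])
      (simp_all add: br tangent_S' P_tangent chart_domainD(1) assms(1) subspace_0[OF subspace_tangent_space[OF x]] del: Int_iff)
  then show ?thesis
    unfolding br using *[OF assms(2)] *[OF assms(3)] P_ident[OF x] assms(2,3)
      dF_tangent[OF assms(1) subspace_0[OF subspace_tangent_space[OF x]]]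
    by (simp add: dir_deriv_S'[OF assms(1)])
qed

lemma GammaB_in_L:
  assumes "x \<in> S'" "u \<in> L" "v \<in> L"
  shows "\<Gamma>B (f x) u v \<in> L"
proof -
  note y = f_in[OF assms(1)]
  have v: "vector_field N (\<lambda>_. v)"
    unfolding vector_field_def using smooth_map_const assms(3) tangent_N by auto
  then show ?thesis
    using B.covariant_derivative_tangent[OF v y, of u] dir_deriv_const[of u N "f x" v] assms(2) tangent_N[OF y] by simp
qed

lemma dF_chain:
  fixes h :: "'f \<Rightarrow> 'c::real_normed_vector"
  assumes "x \<in> S'" "smooth_map N h" "\<xi> \<in> T x"
  shows "(\<lambda>y. h (f y)) differentiable (at x within S)" "D (\<lambda>y. h (f y)) x \<xi> = dir_deriv N h (f x) (dF x \<xi>)"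
proof -
  have "(f has_derivative D f x) (at x within S')"
    using has_derivative_dir_deriv[OF smooth_map_differentiable[OF smooth_f assms(1)]]
    by (simp only: dir_deriv_S'[OF assms(1)])
  moreover have "(h has_derivative dir_deriv N h (f x)) (at (f x) within f ` S')"
    by (rule has_derivative_subset[OF has_derivative_dir_deriv[OF smooth_map_differentiable[OF assms(2) f_in[OF assms(1)]]]])
      (use f_in in auto)
  ultimately have "((\<lambda>y. h (f y)) has_derivative (\<lambda>v. dir_deriv N h (f x) (D f x v))) (at x within S')"
    by (rule has_derivative_in_compose)
  then have *: "((\<lambda>y. h (f y)) has_derivative (\<lambda>v. dir_deriv N h (f x) (D f x v))) (at x within S)"
    using at_within_Int_open[OF open_domain chart_domainD(2)[OF assms(1)], of S] by simp
  show "(\<lambda>y. h (f y)) differentiable (at x within S)" by (rule differentiableI[OF *])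
  show "D (\<lambda>y. h (f y)) x \<xi> = dir_deriv N h (f x) (dF x \<xi>)"
    using dir_deriv_eq[OF * assms(3)] dF_tangent[OF assms(1,3)] by simp
qed

text \<open>The Hessian \<open>\<nabla>df\<close> of the map \<open>f\<close>, written with the Christoffel functions of the two manifolds.\<close>

definition hessian :: "'a \<Rightarrow> 'a \<Rightarrow> 'a \<Rightarrow> 'f" where
  "hessian x \<xi> \<eta> = D dF x \<xi> \<eta> + \<Gamma>B (f x) (dF x \<xi>) (dF x \<eta>) - dF x (\<Gamma> x \<xi> \<eta>)"

lemma hessian_symmetric:
  assumes "x \<in> S'" "\<xi> \<in> T x" "\<eta> \<in> T x"
  shows "hessian x \<xi> \<eta> = hessian x \<eta> \<xi>"
  using dF_symmetric[OF assms] Gamma_symmetric[OF chart_domainD(1)[OF assms(1)] assms(2,3)]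
    B.Gamma_symmetric[OF f_in[OF assms(1)], of "dF x \<xi>" "dF x \<eta>"] tangent_N[OF f_in[OF assms(1)]] dF_in_L[OF assms(1)]
  by (simp add: hessian_def)

lemma hessian_add: "hessian x \<xi> (u + v) = hessian x \<xi> u + hessian x \<xi> v"
  by (simp add: hessian_def blinfun.add_right)

text \<open>The pullback of the connection of the base, applied to \<open>df Y\<close>, differs from \<open>df (\<nabla>\<^sub>\<xi> Y)\<close> by the Hessian.\<close>

lemma pullback_derivative:
  assumes "x \<in> S'" "\<xi> \<in> T x" "vector_field S Y"
  shows "D (\<lambda>y. dF y (Y y)) x \<xi> + \<Gamma>B (f x) (dF x \<xi>) (dF x (Y x)) = hessian x \<xi> (Y x) + dF x (D Y x \<xi> + \<Gamma> x \<xi> (Y x))"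
  by (simp add: hessian_def blinfun.add_right
      dir_deriv_blinfun_apply[OF differentiable_local[OF smooth_dF assms(1)] field_differentiable[OF assms(3,1)] assms(2)])

lemma hessian_in_L:
  assumes "x \<in> S'" "\<xi> \<in> T x" "\<eta> \<in> T x"
  shows "hessian x \<xi> \<eta> \<in> L"
proof -
  note d = differentiable_local[OF smooth_dF assms(1)]
  have pi: "\<pi> u = u" if "u \<in> L" for u
    using B.P_ident[OF f_in[OF assms(1)]] tangent_N[OF f_in[OF assms(1)]] that by simp
  have "D dF x \<xi> \<eta> = D (\<lambda>y. dF y \<eta>) x \<xi>" by (rule dir_deriv_apply_const[OF d assms(2), symmetric])
  also have "\<dots> = D (\<lambda>y. \<pi> (dF y \<eta>)) x \<xi>"
    by (subst dir_deriv_local_cong[OF _ assms(1)]) (simp_all add: pi dF_in_L)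
  also have "\<dots> = \<pi> (D (\<lambda>y. dF y \<eta>) x \<xi>)"
    by (rule dir_deriv_bounded_linear[OF blinfun.bounded_linear_right _ assms(2)])
      (rule differentiable_blinfun_apply[OF d], simp)
  also have "\<dots> \<in> L" using B.P_tangent[OF f_in[OF assms(1)]] tangent_N[OF f_in[OF assms(1)]] by simp
  finally show ?thesis
    unfolding hessian_def by (intro subspace_add subspace_diff subspace_L GammaB_in_L dF_in_L assms(1))
qed

lemma B_metric_derivative:
  assumes "y \<in> N" "w \<in> L" "u \<in> L" "v \<in> L"
  shows "u \<bullet> B.D G y w v = \<Gamma>B y w u \<bullet> G y v + u \<bullet> G y (\<Gamma>B y w v)"
proof -
  have c: "vector_field N (\<lambda>_. u)" if "u \<in> L" for u
    unfolding vector_field_def using smooth_map_const that tangent_N by auto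
  have w: "w \<in> tangent_space N y" using assms tangent_N by simp
  note d = smooth_map_differentiable[OF B.smooth_g assms(1)]
  have "B.D (\<lambda>z. u \<bullet> G z v) y w = u \<bullet> B.D (\<lambda>z. G z v) y w"
    by (rule dir_deriv_bounded_linear[OF bounded_linear_inner_right _ w])
      (rule differentiable_blinfun_apply[OF d], simp)
  then show ?thesis
    using B.metric_compatible[OF c[OF assms(3)] c[OF assms(4)] assms(1) w]
    by (simp add: dir_deriv_const[OF w] dir_deriv_apply_const[OF d w])
qed

text \<open>For horizontal fields \<open>Y\<close> and \<open>Z\<close> the functions \<open>\<langle>df Y, df Z\<rangle>\<close> and \<open>\<langle>Y, Z\<rangle>\<close> agree. Their derivatives are
computed with the metric connections of the base and of the total space; by \<open>pullback_derivative\<close> the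
difference consists of the Hessian terms, since \<open>df\<close> only sees the horizontal parts of \<open>\<nabla>\<^sub>\<xi> Y\<close>
and \<open>\<nabla>\<^sub>\<xi> Z\<close> and is isometric there.\<close>

lemma hessian_skew:
  assumes x: "x \<in> S'" and \<xi>: "\<xi> \<in> T x" and \<eta>: "\<eta> \<in> HM x" and \<phi>: "\<phi> \<in> HM x"
  shows "hessian x \<xi> \<eta> \<bullet> G (f x) (dF x \<phi>) + dF x \<eta> \<bullet> G (f x) (hessian x \<xi> \<phi>) = 0"
proof -
  note xS = chart_domainD(1)[OF x] and y = f_in[OF x]
  let ?Y = "\<lambda>y. H y \<eta>" and ?Z = "\<lambda>y. H y \<phi>"
  let ?nY = "D ?Y x \<xi> + \<Gamma> x \<xi> (?Y x)" and ?nZ = "D ?Z x \<xi> + \<Gamma> x \<xi> (?Z x)"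
  let ?a = "\<lambda>y. dF y (?Y y)" and ?b = "\<lambda>y. dF y (?Z y)"
  note Y = vector_field_H[of \<eta>] and Z = vector_field_H[of \<phi>]
  have at: "?Y x = \<eta>" "?Z x = \<phi>" using H_ident[OF xS] \<eta> \<phi> by auto
  note d = differentiable_local[OF smooth_dF x]
  note da = differentiable_blinfun_apply[OF d field_differentiable[OF Y x]]
    and db = differentiable_blinfun_apply[OF d field_differentiable[OF Z x]]
    and dG = dF_chain[OF x B.smooth_g \<xi>]
  note T = covariant_derivative_tangent[OF Y xS \<xi>] covariant_derivative_tangent[OF Z xS \<xi>]
  have L: "dF x u \<in> L" for u by (rule dF_in_L[OF x])
  have "D (\<lambda>y. ?a y \<bullet> G (f y) (?b y)) x = D (\<lambda>y. ?Y y \<bullet> g y (?Z y)) x"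
    by (rule dir_deriv_local_cong[OF _ x]) (rule dF_isometry, simp_all add: H_in)
  then have "D (\<lambda>y. ?a y \<bullet> G (f y) (?b y)) x \<xi> = ?nY \<bullet> g x \<phi> + \<eta> \<bullet> g x ?nZ"
    using metric_compatible[OF Y Z xS \<xi>] at by simp
  also have "\<dots> = dF x ?nY \<bullet> G (f x) (dF x \<phi>) + dF x \<eta> \<bullet> G (f x) (dF x ?nZ)"
  proof -
    have "?nY \<bullet> g x \<phi> = H x ?nY \<bullet> g x \<phi>" using inner_H[OF xS \<phi>] g_commute[OF xS] by metis
    also have "\<dots> = dF x ?nY \<bullet> G (f x) (dF x \<phi>)"
      by (simp only: dF_H[OF x T(1), symmetric] dF_isometry[OF x H_in[OF xS] \<phi>])
    finally have 1: "?nY \<bullet> g x \<phi> = dF x ?nY \<bullet> G (f x) (dF x \<phi>)" .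
    have "\<eta> \<bullet> g x ?nZ = \<eta> \<bullet> g x (H x ?nZ)" by (rule inner_H[OF xS \<eta>, symmetric])
    also have "\<dots> = dF x \<eta> \<bullet> G (f x) (dF x ?nZ)"
      by (simp only: dF_H[OF x T(2), symmetric] dF_isometry[OF x \<eta> H_in[OF xS]])
    finally show ?thesis using 1 by simp
  qed
  finally have 1: "D (\<lambda>y. ?a y \<bullet> G (f y) (?b y)) x \<xi> = \<dots>" .
  have "D (\<lambda>y. ?a y \<bullet> G (f y) (?b y)) x \<xi> = ?a x \<bullet> D (\<lambda>y. G (f y) (?b y)) x \<xi> + D ?a x \<xi> \<bullet> G (f x) (?b x)"
    by (rule dir_deriv_bilinear[OF bounded_bilinear_inner da differentiable_blinfun_apply[OF dG(1) db] \<xi>])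
  also have "D (\<lambda>y. G (f y) (?b y)) x \<xi> = G (f x) (D ?b x \<xi>) + B.D G (f x) (dF x \<xi>) (?b x)"
    using dir_deriv_blinfun_apply[OF dG(1) db \<xi>] dG(2) by simp
  finally have "D (\<lambda>y. ?a y \<bullet> G (f y) (?b y)) x \<xi>
      = (D ?a x \<xi> + \<Gamma>B (f x) (dF x \<xi>) (dF x \<eta>)) \<bullet> G (f x) (dF x \<phi>)
      + dF x \<eta> \<bullet> G (f x) (D ?b x \<xi> + \<Gamma>B (f x) (dF x \<xi>) (dF x \<phi>))"
    using B_metric_derivative[OF y L[of \<xi>] L[of \<eta>] L[of \<phi>]] at
    by (simp add: inner_add_left inner_add_right blinfun.add_right)
  also have "\<dots> = (hessian x \<xi> \<eta> + dF x ?nY) \<bullet> G (f x) (dF x \<phi>) + dF x \<eta> \<bullet> G (f x) (hessian x \<xi> \<phi> + dF x ?nZ)"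
    using pullback_derivative[OF x \<xi> Y] pullback_derivative[OF x \<xi> Z] at by simp
  finally show ?thesis using 1 by (simp add: inner_add_left inner_add_right blinfun.add_right)
qed

lemma G_commute:
  assumes "y \<in> N" "u \<in> L" "v \<in> L"
  shows "u \<bullet> G y v = v \<bullet> G y u"
  using mB_symmetric[OF assms] B.m_eq[OF assms(1), of u v] B.m_eq[OF assms(1), of v u] tangent_N[OF assms(1)] assms
  by simp

text \<open>A trilinear form that is symmetric in the first two and skew in the last two arguments is zero; the
form is \<open>\<langle>\<nabla>df(\<xi>, \<eta>), df \<phi>\<rangle>\<close>, and the vectors \<open>df \<phi>\<close> fill the tangent space of the base.\<close>

lemma hessian_horizontal:
  assumes x: "x \<in> S'" and \<xi>: "\<xi> \<in> HM x" and \<eta>: "\<eta> \<in> HM x"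
  shows "hessian x \<xi> \<eta> = 0"
proof -
  note xS = chart_domainD(1)[OF x] and y = f_in[OF x]
  note T = HM_tangent[OF xS]
  let ?t = "\<lambda>\<xi> \<eta> \<phi>. hessian x \<xi> \<eta> \<bullet> G (f x) (dF x \<phi>)"
  have sym: "?t \<xi> \<eta> \<phi> = ?t \<eta> \<xi> \<phi>" if "\<xi> \<in> HM x" "\<eta> \<in> HM x" for \<xi> \<eta> \<phi>
    using hessian_symmetric[OF x T[OF that(1)] T[OF that(2)]] by simp
  have skew: "?t \<xi> \<eta> \<phi> = - ?t \<xi> \<phi> \<eta>" if "\<xi> \<in> HM x" "\<eta> \<in> HM x" "\<phi> \<in> HM x" for \<xi> \<eta> \<phi>
    using hessian_skew[OF x T[OF that(1)] that(2,3)]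
      G_commute[OF y dF_in_L[OF x, of \<eta>] hessian_in_L[OF x T[OF that(1)] T[OF that(3)]]] by simp
  obtain \<phi> where \<phi>: "\<phi> \<in> HM x" "dF x \<phi> = hessian x \<xi> \<eta>"
    using dF_onto[OF x hessian_in_L[OF x T[OF \<xi>] T[OF \<eta>]]] by blast
  have "?t \<xi> \<eta> \<phi> = - ?t \<xi> \<phi> \<eta>" by (rule skew[OF \<xi> \<eta> \<phi>(1)])
  also have "\<dots> = - ?t \<phi> \<xi> \<eta>" using sym[OF \<xi> \<phi>(1)] by simp
  also have "\<dots> = ?t \<phi> \<eta> \<xi>" using skew[OF \<phi>(1) \<xi> \<eta>] by simp
  also have "\<dots> = ?t \<eta> \<phi> \<xi>" by (rule sym[OF \<phi>(1) \<eta>])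
  also have "\<dots> = - ?t \<eta> \<xi> \<phi>" by (rule skew[OF \<eta> \<phi>(1) \<xi>])
  also have "\<dots> = - ?t \<xi> \<eta> \<phi>" using sym[OF \<xi> \<eta>] by simp
  finally have "hessian x \<xi> \<eta> \<bullet> G (f x) (hessian x \<xi> \<eta>) = 0" using \<phi>(2) by simp
  moreover have "mB (f x) (hessian x \<xi> \<eta>) (hessian x \<xi> \<eta>) = hessian x \<xi> \<eta> \<bullet> G (f x) (hessian x \<xi> \<eta>)"
    using B.m_eq[OF y] tangent_N[OF y] hessian_in_L[OF x T[OF \<xi>] T[OF \<eta>]] by simp
  ultimately show ?thesis
    using mB_positive[OF y hessian_in_L[OF x T[OF \<xi>] T[OF \<eta>]]] by fastforce
qed

text \<open>A vertical field is mapped to zero by \<open>df\<close>, so only \<open>- df (H \<nabla>\<^sub>\<xi> U)\<close> remains.\<close>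

lemma hessian_vertical:
  assumes x: "x \<in> S'" and \<xi>: "\<xi> \<in> T x" and v: "v \<in> VM x"
  shows "hessian x \<xi> v = dF x (A_adj x \<xi> v)"
proof -
  note xS = chart_domainD(1)[OF x]
  let ?U = "\<lambda>y. V y v"
  note U = vector_field_V[of v]
  have "D (\<lambda>y. dF y (?U y)) x = D (\<lambda>y. 0) x"
    by (rule dir_deriv_local_cong[OF _ x]) (simp add: dF_vertical V_in)
  then have "D (\<lambda>y. dF y (?U y)) x \<xi> = 0" by (simp add: dir_deriv_const[OF \<xi>])
  then have "hessian x \<xi> v = - dF x (D ?U x \<xi> + \<Gamma> x \<xi> v)"
    using pullback_derivative[OF x \<xi> U] V_ident[OF xS v] dF_vertical[OF x v]
    by (simp add: eq_neg_iff_add_eq_0)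
  also have "\<dots> = - dF x (H x (D ?U x \<xi> + \<Gamma> x \<xi> v))"
    using dF_H[OF x covariant_derivative_tangent[OF U xS \<xi>]] V_ident[OF xS v] by simp
  also have "\<dots> = dF x (A_adj x \<xi> v)"
    using A_adj_eq_cov[OF xS \<xi> VM_tangent[OF xS v]] cov_deriv_at_eq[OF U xS \<xi>] V_ident[OF xS v]
    by (simp add: blinfun.minus_right)
  finally show ?thesis .
qed

text \<open>O'Neill's tensor is skew on horizontal vectors: for vertical \<open>v\<close> the skewness of the Hessian reads
\<open>\<langle>df A\<^sup>*\<^sub>\<eta> v, df \<xi>\<rangle> + \<langle>df \<eta>, df A\<^sup>*\<^sub>\<xi> v\<rangle> = 0\<close>, which is \<open>\<langle>v, A\<^sub>\<eta> \<xi> + A\<^sub>\<xi> \<eta>\<rangle> = 0\<close>. The sum itself is taken for \<open>v\<close>.\<close>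

lemma A_alternating:
  assumes x: "x \<in> S'" and \<xi>: "\<xi> \<in> HM x" and \<eta>: "\<eta> \<in> HM x"
  shows "A x \<eta> \<xi> = - A x \<xi> \<eta>"
proof -
  note xS = chart_domainD(1)[OF x] and y = f_in[OF x]
  note T = HM_tangent[OF xS]
  let ?v = "A x \<xi> \<eta> + A x \<eta> \<xi>"
  have v: "?v \<in> VM x" by (rule subspace_add[OF VM_subspace[OF xS] A_vertical[OF xS] A_vertical[OF xS]])
  have *: "hessian x ?v \<eta> \<bullet> G (f x) (dF x \<phi>) = A x \<eta> \<phi> \<bullet> g x ?v" if "\<eta> \<in> HM x" "\<phi> \<in> HM x" for \<eta> \<phi>
  proof -
    note h = A_adj_horizontal[OF xS T[OF that(1)] VM_tangent[OF xS v]]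
    have "hessian x ?v \<eta> \<bullet> G (f x) (dF x \<phi>) = dF x (A_adj x \<eta> ?v) \<bullet> G (f x) (dF x \<phi>)"
      using hessian_symmetric[OF x VM_tangent[OF xS v] T[OF that(1)]] hessian_vertical[OF x T[OF that(1)] v] by simp
    also have "\<dots> = \<phi> \<bullet> g x (A_adj x \<eta> ?v)"
      using dF_isometry[OF x h that(2)] g_commute[OF xS] by simp
    finally show ?thesis using A_adjoint[OF xS T[OF that(1)], of \<phi> ?v] by simp
  qed
  have "A x \<xi> \<eta> \<bullet> g x ?v + A x \<eta> \<xi> \<bullet> g x ?v = 0"
    using hessian_skew[OF x VM_tangent[OF xS v] \<xi> \<eta>] *[OF \<xi> \<eta>] *[OF \<eta> \<xi>]
      G_commute[OF y dF_in_L[OF x, of \<xi>] hessian_in_L[OF x VM_tangent[OF xS v] T[OF \<eta>]]] by simp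
  then have "?v \<bullet> g x ?v = 0" by (simp add: inner_add_left)
  then have "?v = 0" using g_positive[OF xS, of ?v] by fastforce
  then show ?thesis by (simp add: eq_neg_iff_add_eq_0 add.commute)
qed

text \<open>The curvature of the pullback connection is the pullback of the curvature; the terms with second
derivatives of \<open>f\<close> cancel by symmetry.\<close>

lemma pullback_connection_curvature:
  assumes x: "x \<in> S'" and \<xi>: "\<xi> \<in> T x" and \<eta>: "\<eta> \<in> T x" and w: "w \<in> L"
  defines "C \<equiv> \<lambda>y. \<Gamma>B (f y) o\<^sub>L dF y"
  shows "C differentiable (at x within S)"
    "- D C x \<xi> \<eta> w + D C x \<eta> \<xi> w - C x \<xi> (C x \<eta> w) + C x \<eta> (C x \<xi> w)
      = curvature_tensor N nabB (f x) (dF x \<xi>) (dF x \<eta>) w"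
proof -
  note d = differentiable_local[OF smooth_dF x] and dGB = dF_chain[OF x B.smooth_Gamma]
  show "C differentiable (at x within S)"
    unfolding C_def by (rule differentiable_bilinear[OF bounded_bilinear_blinfun_compose dGB(1)[OF \<xi>] d])
  have *: "D C x \<xi> \<eta> w = \<Gamma>B (f x) (D dF x \<xi> \<eta>) w + B.D \<Gamma>B (f x) (dF x \<xi>) (dF x \<eta>) w" if "\<xi> \<in> T x" for \<xi> \<eta>
  proof -
    have "D C x \<xi> = (\<Gamma>B (f x) o\<^sub>L D dF x \<xi>) + (D (\<lambda>y. \<Gamma>B (f y)) x \<xi> o\<^sub>L dF x)"
      unfolding C_def by (rule dir_deriv_bilinear[OF bounded_bilinear_blinfun_compose dGB(1)[OF that] d that])
    then show ?thesis using dGB(2)[OF that] by (simp add: blinfun.add_left)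
  qed
  have C_apply: "C x u v = \<Gamma>B (f x) (dF x u) v" for u v by (simp add: C_def)
  have "dF x u \<in> tangent_space N (f x)" for u using dF_in_L[OF x] tangent_N[OF f_in[OF x]] by simp
  then show "- D C x \<xi> \<eta> w + D C x \<eta> \<xi> w - C x \<xi> (C x \<eta> w) + C x \<eta> (C x \<xi> w)
      = curvature_tensor N nabB (f x) (dF x \<xi>) (dF x \<eta>) w"
    using B.curvature_tensor_eq[OF f_in[OF x], of "dF x \<xi>" "dF x \<eta>" w] w tangent_N[OF f_in[OF x]]
    by (simp add: *[OF \<xi>] *[OF \<eta>] dF_symmetric[OF x \<xi> \<eta>] C_apply)
qed

text \<open>By \<open>hessian_horizontal\<close>, the pullback connection and \<open>H \<nabla>\<close> correspond to each other under \<open>df\<close> for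
horizontal fields \<open>X\<close>, \<open>Y\<close>, \<open>Z\<close>, which may be the projections of constant vectors. The curvatures differ
only because \<open>[X, Y]\<close> has the vertical part \<open>2 A\<^sub>\<xi> \<eta>\<close>; by \<open>hessian_vertical\<close> it contributes
\<open>df (2 A\<^sup>*\<^sub>\<phi> A\<^sub>\<xi> \<eta>)\<close>.\<close>

lemma horizontal_lift_curvature:
  assumes x: "x \<in> S'" and \<xi>: "\<xi> \<in> HM x" and \<eta>: "\<eta> \<in> HM x" and \<phi>: "\<phi> \<in> HM x"
  shows "curvature_tensor N nabB (f x) (dF x \<xi>) (dF x \<eta>) (dF x \<phi>) = dF x (RH x \<xi> \<eta> \<phi>)"
proof -
  note xS = chart_domainD(1)[OF x]
  note T = HM_tangent[OF xS]
  define X Y Z where XYZ: "X = (\<lambda>y. H y \<xi>)" "Y = (\<lambda>y. H y \<eta>)" "Z = (\<lambda>y. H y \<phi>)"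
  have vf: "vector_field S X" "vector_field S Y" "vector_field S Z" using vector_field_H unfolding XYZ by auto
  have hor: "X y \<in> HM y" "Y y \<in> HM y" "Z y \<in> HM y" if "y \<in> S" for y using H_in[OF that] unfolding XYZ by auto
  have at: "X x = \<xi>" "Y x = \<eta>" "Z x = \<phi>" using H_ident[OF xS] \<xi> \<eta> \<phi> unfolding XYZ by auto
  define W where "W y = dF y (Z y)" for y
  define C where "C y = \<Gamma>B (f y) o\<^sub>L dF y" for y
  define NH where "NH X Z y = D Z y (X y) + \<Gamma>H y (X y) (Z y)" for X Z y
  define NB where "NB X W y = dir_deriv S' W y (X y) + C y (X y) (W y)" for X W y
  have sub: "smooth_map S' h" if "smooth_map S h" for h :: "'a \<Rightarrow> 'a"
    by (rule smooth_map_subset[OF that]) auto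
  have smooth_W: "smooth_map S' W"
    unfolding W_def[abs_def] by (rule smooth_map_blinfun_apply[OF smooth_dF sub[OF vector_fieldD(1)[OF vf(3)]]])
  have NH: "NH X Z y = H y (nab X Z y)" if "vector_field S X" "vector_field S Z" "\<And>y. y \<in> S \<Longrightarrow> Z y \<in> HM y" "y \<in> S" for X Z y
    using H_nabla_horizontal[OF that(2,3,4) vector_fieldD(2)[OF that(1,4)]] nab_eq[OF that(1,2,4)] by (simp add: NH_def)
  have NB: "NB X (\<lambda>y. dF y (Z y)) y = hessian y (X y) (Z y) + dF y (NH X Z y)"
    if "vector_field S X" "vector_field S Z" "\<And>y. y \<in> S \<Longrightarrow> Z y \<in> HM y" "y \<in> S'" for X Z y
  proof -
    note yS = chart_domainD(1)[OF that(4)]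
    have "dF y (NH X Z y) = dF y (D Z y (X y) + \<Gamma> y (X y) (Z y))"
      using NH[OF that(1-3) yS] dF_H[OF that(4) vector_fieldD(2)[OF nab_vector_field[OF that(1,2)] yS]]
        nab_eq[OF that(1,2) yS] by simp
    then show ?thesis
      using pullback_derivative[OF that(4) vector_fieldD(2)[OF that(1) yS] that(2)]
      by (simp add: NB_def C_def dir_deriv_S'[OF that(4)])
  qed
  have NBh: "NB X (\<lambda>y. dF y (Z y)) y = dF y (NH X Z y)"
    if "vector_field S X" "\<And>y. y \<in> S \<Longrightarrow> X y \<in> HM y" "vector_field S Z" "\<And>y. y \<in> S \<Longrightarrow> Z y \<in> HM y" "y \<in> S'" for X Z y
    using NB[OF that(1,3,4,5)] hessian_horizontal[OF that(5) that(2)[OF chart_domainD(1)[OF that(5)]] that(4)[OF chart_domainD(1)[OF that(5)]]]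
    by simp
  have second: "NB X (NB Y W) x = dF x (NH X (NH Y Z) x)"
    if X: "vector_field S X" "\<And>y. y \<in> S \<Longrightarrow> X y \<in> HM y" and Y: "vector_field S Y" "\<And>y. y \<in> S \<Longrightarrow> Y y \<in> HM y" for X Y
  proof -
    let ?N = "\<lambda>y. H y (nab Y Z y)"
    note W = nab_vector_field[OF Y(1) vf(3)]
    have N: "vector_field S ?N"
      using smooth_map_blinfun_apply[OF smooth_H vector_fieldD(1)[OF W]] H_in HM_tangent
      unfolding vector_field_def by blast
    have eq: "NH Y Z y = ?N y" if "y \<in> S" for y by (rule NH[OF Y(1) vf(3) hor(3) that])
    have eqB: "NB Y W y = dF y (?N y)" if "y \<in> S'" for y
      using NBh[OF Y vf(3) hor(3) that] eq[OF chart_domainD(1)[OF that]] by (simp add: W_def[abs_def])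
    have "NB X (NB Y W) x = NB X (\<lambda>y. dF y (?N y)) x"
      using dir_deriv_cong[of S' "NB Y W" "\<lambda>y. dF y (?N y)" x, OF eqB x] eqB[OF x] by (simp add: NB_def)
    also have "\<dots> = dF x (NH X ?N x)" by (rule NBh[OF X N H_in x])
    also have "NH X ?N x = NH X (NH Y Z) x"
      using dir_deriv_cong[of S "NH Y Z" ?N x, OF eq xS] eq[OF xS] by (simp add: NH_def)
    finally show ?thesis .
  qed
  note br = vector_field_lie_bracket[OF vf(1,2)]
  let ?B = "lie_bracket S X Y"
  have VB: "V x (?B x) = 2 *\<^sub>R A x \<xi> \<eta>"
  proof -
    have "V x (nab X Y x) = A x \<xi> \<eta>" "V x (nab Y X x) = A x \<eta> \<xi>"
      using A_eq_cov[OF xS T[OF \<xi>], of \<eta>] A_eq_cov[OF xS T[OF \<eta>], of \<xi>] nab_eq[OF vf(1,2) xS] nab_eq[OF vf(2,1) xS] at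
      unfolding XYZ by simp_all
    then show ?thesis
      using torsion_free[OF vf(1,2) xS] A_alternating[OF x \<xi> \<eta>] by (simp add: blinfun.diff_right scaleR_2)
  qed
  have Bx: "?B x \<in> T x" by (rule vector_fieldD(2)[OF br xS])
  have hessian_bracket: "hessian x (?B x) \<phi> = dF x (2 *\<^sub>R A_adj x \<phi> (A x \<xi> \<eta>))"
  proof -
    have "hessian x (?B x) \<phi> = hessian x \<phi> (H x (?B x) + V x (?B x))"
      using hessian_symmetric[OF x Bx T[OF \<phi>]] H_plus_V[OF xS Bx] by simp
    also have "\<dots> = dF x (A_adj x \<phi> (V x (?B x)))"
      using hessian_horizontal[OF x \<phi> H_in[OF xS]] hessian_vertical[OF x T[OF \<phi>] V_in[OF xS]] by (simp add: hessian_add)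
    also have "A_adj x \<phi> (V x (?B x)) = 2 *\<^sub>R A_adj x \<phi> (A x \<xi> \<eta>)"
      using A_adj_eq[OF xS T[OF \<phi>] VM_tangent[OF xS V_in[OF xS]], of "?B x"]
        A_adj_eq[OF xS T[OF \<phi>] VM_tangent[OF xS A_vertical[OF xS]], of \<xi> \<eta>] VB
      by (metis (no_types, lifting) V_ident[OF xS V_in[OF xS]] V_ident[OF xS A_vertical[OF xS]] blinfun.scaleR_right scaleR_minus_right)
    finally show ?thesis .
  qed
  have brS': "lie_bracket S' X Y x = ?B x" by (simp add: lie_bracket_def dir_deriv_S'[OF x])
  have "curvature_tensor N nabB (f x) (dF x \<xi>) (dF x \<eta>) (dF x \<phi>)
      = - D C x \<xi> \<eta> (W x) + D C x \<eta> \<xi> (W x) - C x \<xi> (C x \<eta> (W x)) + C x \<eta> (C x \<xi> (W x))"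
    using pullback_connection_curvature(2)[OF x T[OF \<xi>] T[OF \<eta>] dF_in_L[OF x, of \<phi>]] at
    by (simp add: C_def[abs_def] W_def)
  also have "\<dots> = NB (lie_bracket S' X Y) W x - NB X (NB Y W) x + NB Y (NB X W) x"
  proof -
    have Cd: "C differentiable (at x within S')"
      using pullback_connection_curvature(1)[OF x T[OF \<xi>] T[OF \<eta>] dF_in_L[OF x, of \<phi>]]
        at_within_Int_open[OF open_domain chart_domainD(2)[OF x], of S] by (simp add: C_def[abs_def])
    have tan: "X y \<in> tangent_space S' y" "Y y \<in> tangent_space S' y" if "y \<in> S'" for y
      using tangent_S'[OF that] vector_fieldD(2)[OF vf(1)] vector_fieldD(2)[OF vf(2)] that by auto
    have "lie_bracket S' X Y x \<in> tangent_space S' x" using brS' Bx tangent_S'[OF x] by simp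
    from bundle_curvature[OF smooth_W x sub[OF vector_fieldD(1)[OF vf(1)]] sub[OF vector_fieldD(1)[OF vf(2)]]
        tan(1) tan(2) Cd this]
    show ?thesis using at by (simp add: NB_def[abs_def] dir_deriv_S'[OF x])
  qed
  also have "NB (lie_bracket S' X Y) W x = NB ?B W x" using brS' by (simp add: NB_def)
  also have "NB ?B W x = dF x (2 *\<^sub>R A_adj x \<phi> (A x \<xi> \<eta>)) + dF x (NH ?B Z x)"
    using NB[OF br vf(3) hor(3) x] hessian_bracket at by (simp add: W_def[abs_def])
  also have "NB X (NB Y W) x = dF x (NH X (NH Y Z) x)" by (rule second[OF vf(1) hor(1) vf(2) hor(2)])
  also have "NB Y (NB X W) x = dF x (NH Y (NH X Z) x)" by (rule second[OF vf(2) hor(2) vf(1) hor(1)])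
  also have "dF x (2 *\<^sub>R A_adj x \<phi> (A x \<xi> \<eta>)) + dF x (NH ?B Z x) - dF x (NH X (NH Y Z) x) + dF x (NH Y (NH X Z) x)
      = dF x (2 *\<^sub>R A_adj x \<phi> (A x \<xi> \<eta>) + (NH ?B Z x - NH X (NH Y Z) x + NH Y (NH X Z) x))"
    by (simp add: blinfun.add_right blinfun.diff_right)
  also have "NH ?B Z x - NH X (NH Y Z) x + NH Y (NH X Z) x =
      - D \<Gamma>H x \<xi> \<eta> \<phi> + D \<Gamma>H x \<eta> \<xi> \<phi> - \<Gamma>H x \<xi> (\<Gamma>H x \<eta> \<phi>) + \<Gamma>H x \<eta> (\<Gamma>H x \<xi> \<phi>)"
    using bundle_curvature[OF vector_fieldD(1)[OF vf(3)] xS vector_fieldD(1)[OF vf(1)] vector_fieldD(1)[OF vf(2)]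
        vector_fieldD(2)[OF vf(1)] vector_fieldD(2)[OF vf(2)] smooth_map_differentiable[OF smooth_GammaH xS] Bx] at
    by (simp add: NH_def[abs_def])
  finally show ?thesis using RH_eq[OF xS T[OF \<xi>] T[OF \<eta>]] by simp
qed

end

section \<open>Vertical spaces as orthogonal complements\<close>

text \<open>Let \<open>\<pi>\<close> be the Euclidean projection onto \<open>W\<close>. The required \<open>w\<close> solves \<open>\<pi> G w = \<pi> G v\<close> in \<open>W\<close>. The operator
\<open>\<pi> G\<close> on \<open>W\<close>, completed by the identity on the Euclidean complement, is injective by positivity and
therefore surjective.\<close>

lemma metric_projection_exists:
  fixes G :: "'a::euclidean_space \<Rightarrow>\<^sub>L 'a"
  assumes W: "subspace W" and pos: "\<And>u. u \<noteq> 0 \<Longrightarrow> u \<bullet> G u > 0"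
  obtains w where "w \<in> W" "\<And>s. s \<in> W \<Longrightarrow> s \<bullet> G (v - w) = 0"
proof -
  obtain \<pi> :: "'a \<Rightarrow>\<^sub>L 'a" where \<pi>: "\<And>v. \<pi> v \<in> W" "\<And>v. v \<in> W \<Longrightarrow> \<pi> v = v"
    and inner: "\<And>s v. s \<in> W \<Longrightarrow> s \<bullet> \<pi> v = s \<bullet> v"
    using subspace_projectionE[OF W] by metis
  define h where "h = (\<pi> o\<^sub>L G o\<^sub>L \<pi>) + (id_blinfun - \<pi>)"
  have \<pi>h: "\<pi> (h w) = \<pi> (G (\<pi> w))" for w
    by (simp add: h_def blinfun.add_left blinfun.diff_left blinfun.add_right blinfun.diff_right \<pi>)
  have "w = 0" if "h w = 0" for w
  proof -
    have "\<pi> w \<bullet> G (\<pi> w) = \<pi> w \<bullet> \<pi> (G (\<pi> w))" by (rule inner[OF \<pi>(1), symmetric])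
    also have "\<pi> (G (\<pi> w)) = 0" using \<pi>h[of w] that by simp
    finally have "\<pi> w = 0" using pos[of "\<pi> w"] by fastforce
    then show ?thesis using that by (simp add: h_def blinfun.add_left blinfun.diff_left)
  qed
  moreover have lin: "linear h" by (rule bounded_linear.linear[OF blinfun.bounded_linear_right])
  ultimately have "inj h" by (simp add: linear_injective_0)
  then have "surj h" using linear_injective_imp_surjective[OF lin] by blast
  then obtain w where "h w = \<pi> (G v)" by (metis surjD)
  then have eq: "\<pi> (G (\<pi> w)) = \<pi> (G v)" using \<pi>h[of w] \<pi> by simp
  show ?thesis
  proof (rule that[OF \<pi>(1)])
    fix s assume s: "s \<in> W"
    have "s \<bullet> G (v - \<pi> w) = s \<bullet> \<pi> (G v) - s \<bullet> \<pi> (G (\<pi> w))"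
      by (simp add: inner[OF s] blinfun.diff_right inner_diff_right)
    then show "s \<bullet> G (v - \<pi> w) = 0" using eq by simp
  qed
qed

text \<open>One inclusion of the double complement identity: for vertical \<open>v\<close> let \<open>w\<close> be its orthogonal projection to
\<open>W\<close>. Then \<open>v - w\<close> is horizontal, so it is orthogonal to \<open>v\<close> and to \<open>w\<close>, hence to itself. With \<open>W\<close> the
vertical space of a submersion, this shows that the differential vanishes on \<open>VM\<close>.\<close>

lemma (in orthogonal_splitting) VM_subset_complement:
  assumes x: "x \<in> S" and W: "subspace W" "W \<subseteq> T x"
    and HM: "HM x = {\<xi> \<in> T x. \<forall>\<eta>\<in>W. m x \<xi> \<eta> = 0}"
  shows "VM x \<subseteq> W"
proof
  fix v assume v: "v \<in> VM x"
  note vT = VM_tangent[OF x v]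
  obtain w where w: "w \<in> W" "\<And>s. s \<in> W \<Longrightarrow> s \<bullet> g x (v - w) = 0"
    using metric_projection_exists[OF W(1) g_positive[OF x]] by metis
  have wT: "w \<in> T x" using w W by blast
  have dT: "v - w \<in> T x" by (rule subspace_diff[OF subspace_tangent_space[OF x] vT wT])
  have "m x (v - w) \<eta> = 0" if "\<eta> \<in> W" for \<eta>
    using w(2)[OF that] m_eq[OF x dT, of \<eta>] g_commute[OF x, of "v - w" \<eta>] that W(2) by auto
  then have "v - w \<in> HM x" using HM dT by auto
  then have "(v - w) \<bullet> g x v = 0" by (rule HM_VM_orthogonal(1)[OF x _ v])
  moreover have "(v - w) \<bullet> g x w = 0" using w(2)[OF w(1)] g_commute[OF x, of "v - w" w] by simp
  ultimately have "(v - w) \<bullet> g x (v - w) = 0" by (simp add: blinfun.diff_right inner_diff_right)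
  then have "v - w = 0" using g_positive[OF x, of "v - w"] by fastforce
  then show "v \<in> W" using w(1) by simp
qed

section \<open>Connections on open subsets of a linear subspace\<close>

locale affine_connection_on =
  fixes S :: "'a::euclidean_space set" and nab
  assumes affine: "affine_connection S nab"
    and subspace_tangent: "x \<in> S \<Longrightarrow> subspace (tangent_space S x)"
begin

lemmas axioms_unfolded = affine[unfolded affine_connection_def]

lemma nab_vector_field: "vector_field S X \<Longrightarrow> vector_field S Y \<Longrightarrow> vector_field S (nab X Y)"
  using conjunct1[OF axioms_unfolded, rule_format] by simp

lemma nab_add_left:
  "vector_field S X \<Longrightarrow> vector_field S X' \<Longrightarrow> vector_field S Y \<Longrightarrow> x \<in> S \<Longrightarrow>
   nab (\<lambda>y. X y + X' y) Y x = nab X Y x + nab X' Y x"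
  using conjunct1[OF conjunct2[OF axioms_unfolded], rule_format] by simp

lemma nab_scale_left:
  fixes f :: "'a \<Rightarrow> real"
  shows "vector_field S X \<Longrightarrow> vector_field S Y \<Longrightarrow> smooth_map S f \<Longrightarrow> x \<in> S \<Longrightarrow>
   nab (\<lambda>y. f y *\<^sub>R X y) Y x = f x *\<^sub>R nab X Y x"
  using conjunct1[OF conjunct2[OF conjunct2[OF axioms_unfolded]], rule_format] by simp

lemma nab_add_right:
  "vector_field S X \<Longrightarrow> vector_field S Y \<Longrightarrow> vector_field S Y' \<Longrightarrow> x \<in> S \<Longrightarrow>
   nab X (\<lambda>y. Y y + Y' y) x = nab X Y x + nab X Y' x"
  using conjunct1[OF conjunct2[OF conjunct2[OF conjunct2[OF axioms_unfolded]]], rule_format] by simp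

lemma nab_scale_right:
  fixes f :: "'a \<Rightarrow> real"
  shows "vector_field S X \<Longrightarrow> vector_field S Y \<Longrightarrow> smooth_map S f \<Longrightarrow> x \<in> S \<Longrightarrow>
   nab X (\<lambda>y. f y *\<^sub>R Y y) x = f x *\<^sub>R nab X Y x + dir_deriv S f x (X x) *\<^sub>R Y x"
  using conjunct2[OF conjunct2[OF conjunct2[OF conjunct2[OF axioms_unfolded]]], rule_format] by simp

lemma vector_field_cong:
  assumes "vector_field S X" "\<And>y. y \<in> S \<Longrightarrow> X y = X' y"
  shows "vector_field S X'"
  using assms smooth_map_cong[of S X X', OF assms(2)] unfolding vector_field_def by auto

lemma vector_field_add: "vector_field S X \<Longrightarrow> vector_field S Y \<Longrightarrow> vector_field S (\<lambda>y. X y + Y y)"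
  unfolding vector_field_def by (auto intro: smooth_map_add subspace_add[OF subspace_tangent])

lemma vector_field_scale:
  fixes f :: "'a \<Rightarrow> real"
  shows "smooth_map S f \<Longrightarrow> vector_field S X \<Longrightarrow> vector_field S (\<lambda>y. f y *\<^sub>R X y)"
  unfolding vector_field_def
  by (auto intro: smooth_map_bilinear[OF bounded_bilinear_scaleR] subspace_scale[OF subspace_tangent])

lemma vector_field_zero: "vector_field S (\<lambda>y. 0)"
  unfolding vector_field_def by (auto intro: smooth_map_const subspace_0[OF subspace_tangent])

lemma vector_field_sum:
  "(\<And>i. i \<in> I \<Longrightarrow> vector_field S (X i)) \<Longrightarrow> vector_field S (\<lambda>y. \<Sum>i\<in>I. X i y)"
proof (induction I rule: infinite_finite_induct)
  case (insert i I)
  then show ?case using vector_field_add[of "X i" "\<lambda>y. \<Sum>i\<in>I. X i y"] by simp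
qed (simp_all add: vector_field_zero)

text \<open>The connection acts on functions that are arbitrary outside \<open>S\<close>. A field vanishing on \<open>S\<close> equals its
product with the indicator function of the complement of \<open>S\<close>, which is smooth on \<open>S\<close> because it is zero
there.\<close>

lemma nab_zero:
  assumes d: "vector_field S d" "\<And>y. y \<in> S \<Longrightarrow> d y = 0" and Y: "vector_field S Y" and x: "x \<in> S"
  shows "nab d Y x = 0" "nab Y d x = 0"
proof -
  define f :: "'a \<Rightarrow> real" where "f y = (if y \<in> S then 0 else 1)" for y
  have f: "smooth_map S f" using smooth_map_cong[of S "\<lambda>_. 0" f] smooth_map_const[of S "0::real"] by (simp add: f_def)
  have d_eq: "d = (\<lambda>y. f y *\<^sub>R d y)" using d(2) by (auto simp: f_def fun_eq_iff)
  show "nab d Y x = 0" using nab_scale_left[OF d(1) Y f x] x d_eq by (simp add: f_def)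
  show "nab Y d x = 0" using nab_scale_right[OF Y d(1) f x] x d_eq d(2) by (simp add: f_def)
qed

lemma nab_cong:
  assumes X: "vector_field S X" "\<And>y. y \<in> S \<Longrightarrow> X y = X' y" and Y: "vector_field S Y" and x: "x \<in> S"
  shows "nab X Y x = nab X' Y x" "nab Y X x = nab Y X' x"
proof -
  note X' = vector_field_cong[OF X]
  have d: "vector_field S (\<lambda>y. X y - X' y)" by (rule vector_field_cong[OF vector_field_zero]) (simp add: X)
  have 0: "X y - X' y = 0" if "y \<in> S" for y using X(2)[OF that] by simp
  show "nab X Y x = nab X' Y x" using nab_add_left[OF X' d Y x] nab_zero(1)[OF d 0 Y x] by simp
  show "nab Y X x = nab Y X' x" using nab_add_right[OF Y X' d x] nab_zero(2)[OF d 0 Y x] by simp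
qed

lemma nab_sum_left:
  fixes f :: "'i \<Rightarrow> 'a \<Rightarrow> real"
  assumes "finite I" "\<And>i. i \<in> I \<Longrightarrow> smooth_map S (f i)" "\<And>i. i \<in> I \<Longrightarrow> vector_field S (e i)"
    and Y: "vector_field S Y" and x: "x \<in> S"
  shows "nab (\<lambda>y. \<Sum>i\<in>I. f i y *\<^sub>R e i y) Y x = (\<Sum>i\<in>I. f i x *\<^sub>R nab (e i) Y x)"
  using assms(1-3)
proof (induction I rule: finite_induct)
  case empty
  then show ?case by (simp add: nab_zero(1)[OF vector_field_zero _ Y x])
next
  case (insert i I)
  have i: "vector_field S (\<lambda>y. f i y *\<^sub>R e i y)" by (rule vector_field_scale) (use insert in auto)
  have I: "vector_field S (\<lambda>y. \<Sum>i\<in>I. f i y *\<^sub>R e i y)"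
    by (rule vector_field_sum, rule vector_field_scale) (use insert in auto)
  show ?case
    using nab_add_left[OF i I Y x] nab_scale_left[of "e i" Y "f i" x] insert Y x by simp
qed

lemma nab_sum_right:
  fixes f :: "'i \<Rightarrow> 'a \<Rightarrow> real"
  assumes "finite I" "\<And>i. i \<in> I \<Longrightarrow> smooth_map S (f i)" "\<And>i. i \<in> I \<Longrightarrow> vector_field S (e i)"
    and X: "vector_field S X" and x: "x \<in> S"
  shows "nab X (\<lambda>y. \<Sum>i\<in>I. f i y *\<^sub>R e i y) x =
    (\<Sum>i\<in>I. f i x *\<^sub>R nab X (e i) x + dir_deriv S (f i) x (X x) *\<^sub>R e i x)"
  using assms(1-3)
proof (induction I rule: finite_induct)
  case empty
  then show ?case by (simp add: nab_zero(2)[OF vector_field_zero _ X x])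
next
  case (insert i I)
  have i: "vector_field S (\<lambda>y. f i y *\<^sub>R e i y)" by (rule vector_field_scale) (use insert in auto)
  have I: "vector_field S (\<lambda>y. \<Sum>i\<in>I. f i y *\<^sub>R e i y)"
    by (rule vector_field_sum, rule vector_field_scale) (use insert in auto)
  show ?case
    using nab_add_right[OF X i I x] nab_scale_right[of X "e i" "f i" x] insert X x by simp
qed

end

lemma projection_expand:
  fixes \<pi> :: "'a::euclidean_space \<Rightarrow>\<^sub>L 'b::real_normed_vector"
  shows "(\<Sum>i\<in>Basis. (u \<bullet> i) *\<^sub>R \<pi> i) = \<pi> u"
proof -
  have "\<pi> (\<Sum>i\<in>Basis. (u \<bullet> i) *\<^sub>R i) = (\<Sum>i\<in>Basis. (u \<bullet> i) *\<^sub>R \<pi> i)"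
    by (simp add: blinfun.sum_right blinfun.scaleR_right)
  then show ?thesis by (simp add: euclidean_representation)
qed

text \<open>Vector fields on \<open>N\<close> are combinations of the constant fields \<open>\<pi> i\<close> with smooth coefficients, so the
connection is determined by its values on these fields, and they are the Christoffel symbols.\<close>

lemma christoffel_function_exists:
  fixes N :: "'f::euclidean_space set"
  assumes affine: "affine_connection N nab" and L: "subspace L" "\<And>y. y \<in> N \<Longrightarrow> tangent_space N y = L"
    and \<pi>: "\<And>v. blinfun_apply \<pi> v \<in> L" "\<And>v. v \<in> L \<Longrightarrow> \<pi> v = v"
  obtains \<Gamma>B where "christoffel_function N nab \<Gamma>B"
proof -
  interpret affine_connection_on N nab
    by unfold_locales (use assms in auto)
  have c: "vector_field N (\<lambda>_. \<pi> i)" for i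
    unfolding vector_field_def using \<pi>(1) L(2) by (simp add: smooth_map_const)
  define \<Gamma>B where "\<Gamma>B y = (\<Sum>i\<in>Basis. rank_one i (\<Sum>j\<in>Basis. rank_one j (nab (\<lambda>_. \<pi> i) (\<lambda>_. \<pi> j) y)))" for y
  have "smooth_map N \<Gamma>B"
    unfolding \<Gamma>B_def[abs_def]
    by (intro smooth_map_sum smooth_map_bounded_linear[OF bounded_linear_rank_one])
      (use nab_vector_field[OF c c] in \<open>simp add: vector_field_def\<close>)
  moreover have "nab X Y x = dir_deriv N Y x (X x) + \<Gamma>B x (X x) (Y x)"
    if X: "vector_field N X" and Y: "vector_field N Y" and x: "x \<in> N" for X Y x
  proof -
    have XL: "X y \<in> L" "Y y \<in> L" if "y \<in> N" for y using X Y L(2) that unfolding vector_field_def by auto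
    have coord: "smooth_map N (\<lambda>y. X y \<bullet> i)" "smooth_map N (\<lambda>y. Y y \<bullet> i)" for i
      using X Y smooth_map_bounded_linear[OF bounded_linear_inner_left] unfolding vector_field_def by auto
    have dY: "Y differentiable (at x within N)"
      using Y x smooth_map_differentiable unfolding vector_field_def by blast
    have Xx: "X x \<in> tangent_space N x" using XL x L(2) by simp
    have "nab X Y x = nab (\<lambda>y. \<Sum>i\<in>Basis. (X y \<bullet> i) *\<^sub>R \<pi> i) Y x"
      by (rule nab_cong(1)[OF X _ Y x]) (simp add: projection_expand \<pi>(2) XL)
    also have "\<dots> = (\<Sum>i\<in>Basis. (X x \<bullet> i) *\<^sub>R nab (\<lambda>_. \<pi> i) Y x)"
      by (rule nab_sum_left[OF finite_Basis coord(1) c Y x])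
    also have "\<dots> = (\<Sum>i\<in>Basis. (X x \<bullet> i) *\<^sub>R
        (\<pi> (dir_deriv N Y x (\<pi> i)) + (\<Sum>j\<in>Basis. (Y x \<bullet> j) *\<^sub>R nab (\<lambda>_. \<pi> i) (\<lambda>_. \<pi> j) x)))"
    proof (rule sum.cong[OF refl])
      fix i :: 'f
      have pi_i: "\<pi> i \<in> tangent_space N x" using \<pi>(1) L(2)[OF x] by simp
      have "nab (\<lambda>_. \<pi> i) Y x = nab (\<lambda>_. \<pi> i) (\<lambda>y. \<Sum>j\<in>Basis. (Y y \<bullet> j) *\<^sub>R \<pi> j) x"
        by (rule nab_cong(2)[OF Y _ c x]) (simp add: projection_expand \<pi>(2) XL)
      also have "\<dots> = (\<Sum>j\<in>Basis. (Y x \<bullet> j) *\<^sub>R nab (\<lambda>_. \<pi> i) (\<lambda>_. \<pi> j) x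
          + dir_deriv N (\<lambda>y. Y y \<bullet> j) x (\<pi> i) *\<^sub>R \<pi> j)"
        by (rule nab_sum_right[OF finite_Basis coord(2) c c x])
      also have "\<dots> = (\<Sum>j\<in>Basis. (Y x \<bullet> j) *\<^sub>R nab (\<lambda>_. \<pi> i) (\<lambda>_. \<pi> j) x)
          + (\<Sum>j\<in>Basis. (dir_deriv N Y x (\<pi> i) \<bullet> j) *\<^sub>R \<pi> j)"
        by (simp add: sum.distrib dir_deriv_bounded_linear[OF bounded_linear_inner_left dY pi_i])
      finally show "(X x \<bullet> i) *\<^sub>R nab (\<lambda>_. \<pi> i) Y x = (X x \<bullet> i) *\<^sub>R
          (\<pi> (dir_deriv N Y x (\<pi> i)) + (\<Sum>j\<in>Basis. (Y x \<bullet> j) *\<^sub>R nab (\<lambda>_. \<pi> i) (\<lambda>_. \<pi> j) x))"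
        by (simp add: projection_expand add.commute)
    qed
    also have "\<dots> = (\<Sum>i\<in>Basis. (X x \<bullet> i) *\<^sub>R \<pi> (dir_deriv N Y x (\<pi> i))) + \<Gamma>B x (X x) (Y x)"
      by (simp add: \<Gamma>B_def blinfun.sum_left blinfun.scaleR_left scaleR_add_right sum.distrib)
    also have "(\<Sum>i\<in>Basis. (X x \<bullet> i) *\<^sub>R \<pi> (dir_deriv N Y x (\<pi> i))) = \<pi> (dir_deriv N Y x (X x))"
    proof -
      have lin: "linear (dir_deriv N Y x)"
        by (rule bounded_linear.linear[OF bounded_linear_dir_deriv[OF dY]])
      have "X x = (\<Sum>i\<in>Basis. (X x \<bullet> i) *\<^sub>R \<pi> i)" by (simp add: projection_expand \<pi>(2) XL x)
      then have "dir_deriv N Y x (X x) = dir_deriv N Y x (\<Sum>i\<in>Basis. (X x \<bullet> i) *\<^sub>R \<pi> i)" by simp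
      also have "\<dots> = (\<Sum>i\<in>Basis. (X x \<bullet> i) *\<^sub>R dir_deriv N Y x (\<pi> i))"
        by (simp add: linear_sum[OF lin] linear_scale[OF lin])
      finally show ?thesis by (simp add: blinfun.sum_right blinfun.scaleR_right)
    qed
    also have "\<pi> (dir_deriv N Y x (X x)) = dir_deriv N Y x (X x)"
    proof -
      have "dir_deriv N (\<lambda>y. \<pi> (Y y)) x = dir_deriv N Y x"
        by (rule dir_deriv_cong[OF _ x]) (simp add: \<pi>(2) XL)
      then show ?thesis
        using dir_deriv_bounded_linear[OF blinfun.bounded_linear_right dY Xx, of \<pi>] by simp
    qed
    finally show ?thesis .
  qed
  ultimately show ?thesis using that[of \<Gamma>B] unfolding christoffel_function_def by simp
qed

lemma inner_product_on_sum_left: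
  assumes b: "inner_product_on T b" and T: "subspace T" and "finite I" "\<And>i. i \<in> I \<Longrightarrow> e i \<in> T" "w \<in> T"
  shows "b (\<Sum>i\<in>I. c i *\<^sub>R e i) w = (\<Sum>i\<in>I. c i * b (e i) w)"
proof -
  have add: "b (u + v) w = b u w + b v w" if "u \<in> T" "v \<in> T" for u v
    using b that assms(5) unfolding inner_product_on_def by simp
  have scale: "b (a *\<^sub>R u) w = a * b u w" if "u \<in> T" for a u
    using b that assms(5) unfolding inner_product_on_def by simp
  show ?thesis
    using assms(3,4)
  proof (induction I rule: finite_induct)
    case empty
    then show ?case using scale[OF subspace_0[OF T], of 0] by simp
  next
    case (insert i I)
    have "(\<Sum>i\<in>I. c i *\<^sub>R e i) \<in> T" by (rule subspace_sum[OF T], rule subspace_scale[OF T]) (use insert in auto)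
    then show ?case using insert add[of "c i *\<^sub>R e i"] scale[of "e i"] subspace_scale[OF T, of "e i"] by simp
  qed
qed

text \<open>The Gram matrix of the constant fields \<open>\<pi> i\<close> represents the metric by a smooth operator field.\<close>

lemma metric_operator_exists:
  fixes N :: "'f::euclidean_space set"
  assumes metric: "riemannian_metric N mB" and L: "subspace L" "\<And>y. y \<in> N \<Longrightarrow> tangent_space N y = L"
    and \<pi>: "\<And>v. blinfun_apply \<pi> v \<in> L" "\<And>v. v \<in> L \<Longrightarrow> \<pi> v = v"
  obtains G where "smooth_map N G" "\<And>y u v. y \<in> N \<Longrightarrow> u \<in> L \<Longrightarrow> v \<in> L \<Longrightarrow> mB y u v = u \<bullet> blinfun_apply (G y) v"
proof -
  have c: "vector_field N (\<lambda>_. \<pi> i)" for i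
    unfolding vector_field_def using \<pi>(1) L(2) by (simp add: smooth_map_const)
  have ip: "inner_product_on L (mB y)" if "y \<in> N" for y
    using metric L(2) that unfolding riemannian_metric_def by auto
  have smooth: "smooth_map N (\<lambda>y. mB y (\<pi> i) (\<pi> j))" for i j
    using conjunct2[OF metric[unfolded riemannian_metric_def], rule_format, OF conjI[OF c c]] .
  define G where "G y = (\<Sum>j\<in>Basis. rank_one j (\<Sum>i\<in>Basis. mB y (\<pi> i) (\<pi> j) *\<^sub>R i))" for y
  show ?thesis
  proof (rule that[of G])
    show "smooth_map N G"
      unfolding G_def[abs_def]
      by (intro smooth_map_sum smooth_map_bounded_linear[OF bounded_linear_rank_one]
          smooth_map_bounded_linear[OF bounded_linear_scaleR_left] smooth)
    fix y u v assume y: "y \<in> N" and u: "u \<in> L" and v: "v \<in> L"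
    have sym: "mB y s t = mB y t s" if "s \<in> L" "t \<in> L" for s t
      using ip[OF y] that unfolding inner_product_on_def by blast
    have expand: "mB y u' t = (\<Sum>i\<in>Basis. (u' \<bullet> i) * mB y (\<pi> i) t)" if "u' \<in> L" "t \<in> L" for u' t
      using inner_product_on_sum_left[OF ip[OF y] L(1) finite_Basis \<pi>(1) that(2), of "\<lambda>i. u' \<bullet> i" "\<lambda>i. i"]
      by (simp add: projection_expand \<pi>(2) that(1))
    have "mB y u v = (\<Sum>j\<in>Basis. (v \<bullet> j) * mB y u (\<pi> j))"
      using expand[OF v u] by (simp add: sym[OF u] v \<pi>(1))
    also have "\<dots> = (\<Sum>j\<in>Basis. (v \<bullet> j) * (\<Sum>i\<in>Basis. (u \<bullet> i) * mB y (\<pi> i) (\<pi> j)))"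
      by (simp add: expand[OF u \<pi>(1)])
    also have "\<dots> = u \<bullet> G y v"
      by (simp add: G_def blinfun.sum_left inner_sum_right mult.commute)
    finally show "mB y u v = u \<bullet> G y v" .
  qed
qed

lemma levi_civita_open_in_subspace:
  fixes N :: "'f::euclidean_space set"
  assumes L: "subspace L" "\<And>y. y \<in> N \<Longrightarrow> tangent_space N y = L"
    and metric: "riemannian_metric N mB" and lc: "levi_civita N mB nabB"
  obtains \<pi> G \<Gamma>B where "levi_civita_submanifold N (\<lambda>_. \<pi>) mB G nabB \<Gamma>B"
proof -
  obtain \<pi> :: "'f \<Rightarrow>\<^sub>L 'f" where \<pi>: "\<And>v. \<pi> v \<in> L" "\<And>v. v \<in> L \<Longrightarrow> \<pi> v = v"
    using subspace_projectionE[OF L(1)] by metis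
  obtain \<Gamma>B where \<Gamma>B: "christoffel_function N nabB \<Gamma>B"
    using christoffel_function_exists[OF conjunct1[OF lc[unfolded levi_civita_def]] L \<pi>] by metis
  obtain G where G: "smooth_map N G"
    "\<And>y u v. y \<in> N \<Longrightarrow> u \<in> L \<Longrightarrow> v \<in> L \<Longrightarrow> mB y u v = u \<bullet> blinfun_apply (G y) v"
    using metric_operator_exists[OF metric L \<pi>] by metis
  have "levi_civita_submanifold N (\<lambda>_. \<pi>) mB G nabB \<Gamma>B"
    by unfold_locales (simp_all add: smooth_map_const L(2) \<pi> G lc \<Gamma>B)
  then show ?thesis by (rule that)
qed

section \<open>The horizontal curvature of an orthogonal bundle decomposition\<close>

theorem theorem5p4:
  fixes M :: "'a::euclidean_space set"
    and m :: "'a \<Rightarrow> 'a \<Rightarrow> 'a \<Rightarrow> real"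
    and g :: "'a \<Rightarrow> 'a \<Rightarrow>\<^sub>L 'a"
    and HM VM :: "'a \<Rightarrow> 'a set"
    and P H V :: "'a \<Rightarrow> 'a \<Rightarrow>\<^sub>L 'a"
    and nab :: "('a \<Rightarrow> 'a) \<Rightarrow> ('a \<Rightarrow> 'a) \<Rightarrow> 'a \<Rightarrow> 'a"
    and \<Gamma> \<Gamma>0 \<Gamma>H \<Gamma>V :: "'a \<Rightarrow> 'a \<Rightarrow>\<^sub>L 'a \<Rightarrow>\<^sub>L 'a"
    and B :: "'b topology"
    and L :: "'f::euclidean_space set"
    and charts :: "('b, 'f) chart set"
    and mB :: "('b, 'f) chart \<Rightarrow> 'f \<Rightarrow> 'f \<Rightarrow> 'f \<Rightarrow> real"
    and nabB :: "('b, 'f) chart \<Rightarrow> ('f \<Rightarrow> 'f) \<Rightarrow> ('f \<Rightarrow> 'f) \<Rightarrow> 'f \<Rightarrow> 'f"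
    and q :: "'a \<Rightarrow> 'b"
  assumes ambient: "embedded_ambient_structure M m g"
    and decomposition: "orthogonal_decomposition M m HM VM"
    and projP: "projection_field M g (tangent_space M) P"
    and projH: "projection_field M g HM H"
    and projV: "projection_field M g VM V"
    and levi_civita: "levi_civita M m nab"
    and christoffel: "christoffel_function M nab \<Gamma>"
    and smooth_\<Gamma>0: "smooth_map M \<Gamma>0"
    and smooth_\<Gamma>H: "smooth_map M \<Gamma>H"
    and smooth_\<Gamma>V: "smooth_map M \<Gamma>V"
    and \<Gamma>0: "\<And>x \<xi> \<omega>. x \<in> M \<Longrightarrow> \<xi> \<in> tangent_space M x \<Longrightarrow>
        \<Gamma>0 x \<xi> \<omega> = dir_deriv M P x \<xi> \<omega> + \<Gamma> x \<xi> \<omega>"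
    and \<Gamma>H: "\<And>x \<xi> \<omega>. x \<in> M \<Longrightarrow> \<xi> \<in> tangent_space M x \<Longrightarrow>
        \<Gamma>H x \<xi> \<omega> = - dir_deriv M H x \<xi> \<omega> + H x (\<Gamma>0 x \<xi> \<omega>)"
    and \<Gamma>V: "\<And>x \<xi> \<omega>. x \<in> M \<Longrightarrow> \<xi> \<in> tangent_space M x \<Longrightarrow>
        \<Gamma>V x \<xi> \<omega> = - dir_deriv M V x \<xi> \<omega> + V x (\<Gamma>0 x \<xi> \<omega>)"
  defines "A \<equiv> oneill_A M nab H V"
    and "A_adj \<equiv> oneill_A_adj M g nab H V"
    and "RH \<equiv> horizontal_curvature M g nab H V \<Gamma>H"
    and "RM \<equiv> curvature_tensor M nab"
  shows
    "(\<forall>x\<in>M. \<forall>\<xi>\<in>HM x. \<forall>\<eta>\<in>HM x. \<forall>\<phi>\<in>HM x.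
        (\<forall>\<omega>. A x \<xi> \<omega> = \<Gamma>V x \<xi> (H x \<omega>)) \<and>
        (\<forall>\<omega>\<in>tangent_space M x.
            A_adj x \<xi> \<omega> = - H x (cov_deriv_at M nab x \<xi> (\<lambda>y. V y \<omega>)) \<and>
            A_adj x \<xi> \<omega> = - \<Gamma>H x \<xi> (V x \<omega>)) \<and>
        RH x \<xi> \<eta> \<phi> \<in> HM x \<and>
        RH x \<xi> \<eta> \<phi> = H x (RM x \<xi> \<eta> \<phi>) + 2 *\<^sub>R A_adj x \<phi> (A x \<xi> \<eta>)
          - A_adj x \<xi> (A x \<eta> \<phi>) + A_adj x \<eta> (A x \<xi> \<phi>) \<and>
        RH x \<xi> \<eta> \<phi> = 2 *\<^sub>R A_adj x \<phi> (A x \<xi> \<eta>)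
          - dir_deriv M (\<lambda>y. H y (\<Gamma>0 y \<eta> \<phi>)) x \<xi> + dir_deriv M (\<lambda>y. H y (\<Gamma>0 y \<xi> \<phi>)) x \<eta>
          - \<Gamma>H x \<xi> (\<Gamma>H x \<eta> \<phi>) + \<Gamma>H x \<eta> (\<Gamma>H x \<xi> \<phi>)) \<and>
     (riemannian_manifold B L charts mB \<and> levi_civita_charts charts mB nabB \<and>
      riemannian_submersion M m B L charts mB q \<and>
      (\<forall>x\<in>M. HM x = horizontal_space M m charts q x) \<longrightarrow>
        (\<forall>x\<in>M. \<forall>\<xi>\<in>HM x. \<forall>\<eta>\<in>HM x. \<forall>\<phi>\<in>HM x.
           is_horizontal_lift M m charts q x
             (curvature_charts nabB (q x) (differential_charts M q x \<xi>)
                (differential_charts M q x \<eta>) (differential_charts M q x \<phi>))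
             (RH x \<xi> \<eta> \<phi>)))"
proof -
  note amb_def = ambient[unfolded embedded_ambient_structure_def]
  have amb: "smooth_map M g"
    "\<And>x u w. x \<in> M \<Longrightarrow> u \<bullet> g x w = g x u \<bullet> w" "\<And>x u. x \<in> M \<Longrightarrow> u \<noteq> 0 \<Longrightarrow> u \<bullet> g x u > 0"
    "\<And>x \<xi> \<eta>. x \<in> M \<Longrightarrow> \<xi> \<in> tangent_space M x \<Longrightarrow> \<eta> \<in> tangent_space M x \<Longrightarrow> m x \<xi> \<eta> = \<xi> \<bullet> g x \<eta>"
  proof -
    show "smooth_map M g" using amb_def by (elim conjE)
    fix x assume "x \<in> M"
    with amb_def have *: "(\<forall>u w. u \<bullet> g x w = g x u \<bullet> w) \<and> (\<forall>u. u \<noteq> 0 \<longrightarrow> u \<bullet> g x u > 0) \<and>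
        (\<forall>\<xi>\<in>tangent_space M x. \<forall>\<eta>\<in>tangent_space M x. \<xi> \<bullet> g x \<eta> = m x \<xi> \<eta>)"
      by (elim conjE) (erule bspec)
    show "u \<bullet> g x w = g x u \<bullet> w" for u w using * by blast
    show "u \<noteq> 0 \<Longrightarrow> u \<bullet> g x u > 0" for u using * by blast
    show "\<xi> \<in> tangent_space M x \<Longrightarrow> \<eta> \<in> tangent_space M x \<Longrightarrow> m x \<xi> \<eta> = \<xi> \<bullet> g x \<eta>" for \<xi> \<eta>
      using * by metis
  qed
  have projP': "smooth_map M P" "\<And>x w. x \<in> M \<Longrightarrow> P x w \<in> tangent_space M x"
    "\<And>x w s. x \<in> M \<Longrightarrow> s \<in> tangent_space M x \<Longrightarrow> s \<bullet> g x (w - P x w) = 0"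
    using projP unfolding projection_field_def by simp_all
  \<comment> \<open>As the sum of two subspaces, the tangent space contains the difference of a tangent vector and its projection.\<close>
  have P_ident: "P x v = v" if x: "x \<in> M" and v: "v \<in> tangent_space M x" for x v
  proof -
    obtain h w where hw: "v = h + w" "h \<in> HM x" "w \<in> VM x"
      using decomposition x v unfolding orthogonal_decomposition_def by auto
    obtain h' w' where hw': "P x v = h' + w'" "h' \<in> HM x" "w' \<in> VM x"
      using decomposition x projP'(2)[OF x, of v] unfolding orthogonal_decomposition_def by auto
    have "subspace (HM x)" "subspace (VM x)" "tangent_space M x = {h + v | h v. h \<in> HM x \<and> v \<in> VM x}"
      using decomposition x unfolding orthogonal_decomposition_def by auto
    moreover have "v - P x v = (h - h') + (w - w')" using hw hw' by simp
    ultimately have "v - P x v \<in> tangent_space M x"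
      using hw hw' subspace_diff[of "HM x" h h'] subspace_diff[of "VM x" w w'] by blast
    then have "(v - P x v) \<bullet> g x (v - P x v) = 0" by (rule projP'(3)[OF x])
    then have "v - P x v = 0" using amb(3)[OF x, of "v - P x v"] by fastforce
    then show ?thesis by simp
  qed
  interpret orthogonal_splitting M P m g nab \<Gamma> HM VM H V \<Gamma>0 \<Gamma>H \<Gamma>V
    by unfold_locales
      (assumption | rule amb projP' P_ident levi_civita christoffel decomposition projH projV
        smooth_\<Gamma>0 smooth_\<Gamma>H \<Gamma>0 \<Gamma>H \<Gamma>V)+
  have part1: "(\<forall>\<omega>. A x \<xi> \<omega> = \<Gamma>V x \<xi> (H x \<omega>)) \<and>
      (\<forall>\<omega>\<in>tangent_space M x.
          A_adj x \<xi> \<omega> = - H x (cov_deriv_at M nab x \<xi> (\<lambda>y. V y \<omega>)) \<and>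
          A_adj x \<xi> \<omega> = - \<Gamma>H x \<xi> (V x \<omega>)) \<and>
      RH x \<xi> \<eta> \<phi> \<in> HM x \<and>
      RH x \<xi> \<eta> \<phi> = H x (RM x \<xi> \<eta> \<phi>) + 2 *\<^sub>R A_adj x \<phi> (A x \<xi> \<eta>)
        - A_adj x \<xi> (A x \<eta> \<phi>) + A_adj x \<eta> (A x \<xi> \<phi>) \<and>
      RH x \<xi> \<eta> \<phi> = 2 *\<^sub>R A_adj x \<phi> (A x \<xi> \<eta>)
        - dir_deriv M (\<lambda>y. H y (\<Gamma>0 y \<eta> \<phi>)) x \<xi> + dir_deriv M (\<lambda>y. H y (\<Gamma>0 y \<xi> \<phi>)) x \<eta>
        - \<Gamma>H x \<xi> (\<Gamma>H x \<eta> \<phi>) + \<Gamma>H x \<eta> (\<Gamma>H x \<xi> \<phi>)"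
    if x: "x \<in> M" and h: "\<xi> \<in> HM x" "\<eta> \<in> HM x" "\<phi> \<in> HM x" for x \<xi> \<eta> \<phi>
  proof -
    note t = HM_tangent[OF x h(1)] HM_tangent[OF x h(2)]
    have "horizontal_curvature M g nab H V \<Gamma>H x \<xi> \<eta> \<phi> =
        2 *\<^sub>R oneill_A_adj M g nab H V x \<phi> (oneill_A M nab H V x \<xi> \<eta>)
        - dir_deriv M (\<lambda>y. H y (\<Gamma>0 y \<eta> \<phi>)) x \<xi> + dir_deriv M (\<lambda>y. H y (\<Gamma>0 y \<xi> \<phi>)) x \<eta>
        - \<Gamma>H x \<xi> (\<Gamma>H x \<eta> \<phi>) + \<Gamma>H x \<eta> (\<Gamma>H x \<xi> \<phi>)"
      unfolding RH_eq[OF x t] dir_deriv_H_Gamma0[OF x t] by simp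
    then show ?thesis
      unfolding A_def A_adj_def RH_def RM_def
      using A_eq[OF x t(1)] A_adj_eq_cov[OF x t(1)] A_adj_eq[OF x t(1)] RH_horizontal[OF x t h(3)]
        oneill_equation[OF x t h(3)] by blast
  qed
  have part2: "is_horizontal_lift M m charts q x
       (curvature_charts nabB (q x) (differential_charts M q x \<xi>)
          (differential_charts M q x \<eta>) (differential_charts M q x \<phi>)) (RH x \<xi> \<eta> \<phi>)"
    if B: "riemannian_manifold B L charts mB" and lcB: "levi_civita_charts charts mB nabB"
      and sub: "riemannian_submersion M m B L charts mB q"
      and HM: "\<forall>x\<in>M. HM x = horizontal_space M m charts q x"
      and x: "x \<in> M" and h: "\<xi> \<in> HM x" "\<eta> \<in> HM x" "\<phi> \<in> HM x" for x \<xi> \<eta> \<phi>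
  proof -
    have RH_in: "RH x \<xi> \<eta> \<phi> \<in> HM x"
      unfolding RH_def by (rule RH_horizontal[OF x HM_tangent[OF x h(1)] HM_tangent[OF x h(2)] h(3)])
    have atlas: "smooth_atlas B L charts" using B unfolding riemannian_manifold_def by simp
    have L: "subspace L" using atlas unfolding smooth_atlas_def by simp
    have chart: "openin B U" "openin (top_of_set L) (c ` U)" "riemannian_metric (c ` U) (mB (U, c))"
      "levi_civita (c ` U) (mB (U, c)) (nabB (U, c))" "smooth_map (M \<inter> q -` U) (c \<circ> q)"
      if "(U, c) \<in> charts" for U c
      using atlas B lcB sub that
      unfolding smooth_atlas_def riemannian_manifold_def levi_civita_charts_def riemannian_submersion_def by auto
    have sub': "(\<lambda>\<xi>. dir_deriv M (c \<circ> q) y \<xi>) ` tangent_space M y = L"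
      "\<And>\<xi> \<eta>. \<xi> \<in> horizontal_space M m charts q y \<Longrightarrow> \<eta> \<in> horizontal_space M m charts q y \<Longrightarrow>
        mB (U, c) (c (q y)) (dir_deriv M (c \<circ> q) y \<xi>) (dir_deriv M (c \<circ> q) y \<eta>) = m y \<xi> \<eta>"
      if "y \<in> M" "(U, c) \<in> charts" "q y \<in> U" for y U c
    proof -
      have *: "(\<lambda>\<xi>. dir_deriv M (c \<circ> q) y \<xi>) ` tangent_space M y = L \<and>
        (\<forall>\<xi>\<in>horizontal_space M m charts q y. \<forall>\<eta>\<in>horizontal_space M m charts q y.
          mB (U, c) (c (q y)) (dir_deriv M (c \<circ> q) y \<xi>) (dir_deriv M (c \<circ> q) y \<eta>) = m y \<xi> \<eta>)"
        using bspec[OF bspec[OF conjunct2[OF conjunct2[OF sub[unfolded riemannian_submersion_def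
              differential_charts_def]]] that(1)] that(2)] that(3) by simp
      then show "(\<lambda>\<xi>. dir_deriv M (c \<circ> q) y \<xi>) ` tangent_space M y = L" by (rule conjunct1)
      show "mB (U, c) (c (q y)) (dir_deriv M (c \<circ> q) y \<xi>) (dir_deriv M (c \<circ> q) y \<eta>) = m y \<xi> \<eta>"
        if "\<xi> \<in> horizontal_space M m charts q y" "\<eta> \<in> horizontal_space M m charts q y" for \<xi> \<eta>
        by (rule bspec[OF bspec[OF conjunct2[OF *] that(1)] that(2)])
    qed
    have domain: "\<exists>\<Omega>. open \<Omega> \<and> M \<inter> q -` U = M \<inter> \<Omega>" if "(U, c) \<in> charts" for U c
    proof -
      have "continuous_map (top_of_set M) B q" using sub unfolding riemannian_submersion_def by simp
      then have "openin (top_of_set M) {y \<in> topspace (top_of_set M). q y \<in> U}"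
        using chart(1)[OF that] openin_continuous_map_preimage by blast
      moreover have "{y \<in> topspace (top_of_set M). q y \<in> U} = M \<inter> q -` U" by auto
      ultimately show ?thesis unfolding openin_open by auto
    qed
    have diff: "(c \<circ> q) differentiable (at y within M)"
      if y: "y \<in> M" "q y \<in> U" and Uc: "(U, c) \<in> charts" for y U c
    proof -
      obtain \<Omega> where \<Omega>: "open \<Omega>" "M \<inter> q -` U = M \<inter> \<Omega>" using domain[OF Uc] by blast
      then have "y \<in> M \<inter> \<Omega>" using y by auto
      then have "(c \<circ> q) differentiable (at y within M \<inter> \<Omega>)"
        using smooth_map_differentiable[OF chart(5)[OF Uc]] \<Omega>(2) by simp
      then show ?thesis using at_within_Int_open[OF \<Omega>(1), of y M] \<open>y \<in> M \<inter> \<Omega>\<close> by simp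
    qed
    \<comment> \<open>\<open>HM\<close> is the complement of the kernel of the differential; taking complements once more locates \<open>VM\<close>.\<close>
    have vertical: "VM y \<subseteq> vertical_space M charts q y" if y: "y \<in> M" for y
    proof (rule VM_subset_complement[OF y])
      have lin: "linear (dir_deriv M (c \<circ> q) y)" if "(U, c) \<in> charts" "q y \<in> U" for U c
        by (rule bounded_linear.linear[OF bounded_linear_dir_deriv[OF diff[OF y that(2,1)]]])
      show "subspace (vertical_space M charts q y)"
        unfolding subspace_def vertical_space_def differential_charts_def
        using subspace_tangent_space[OF y, unfolded subspace_def] linear_0[OF lin] linear_add[OF lin] linear_scale[OF lin]
        by (auto split: prod.splits)
      show "vertical_space M charts q y \<subseteq> T y" unfolding vertical_space_def by auto
      show "HM y = {\<xi> \<in> T y. \<forall>\<eta>\<in>vertical_space M charts q y. m y \<xi> \<eta> = 0}"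
        using HM y unfolding horizontal_space_def by simp
    qed
    have lift: "dir_deriv M (c \<circ> q) x (RH x \<xi> \<eta> \<phi>) = curvature_tensor (c ` U) (nabB (U, c)) (c (q x))
        (dir_deriv M (c \<circ> q) x \<xi>) (dir_deriv M (c \<circ> q) x \<eta>) (dir_deriv M (c \<circ> q) x \<phi>)"
      if Uc: "(U, c) \<in> charts" and qx: "q x \<in> U" for U c
    proof -
      obtain \<Omega> where \<Omega>: "open \<Omega>" "M \<inter> q -` U = M \<inter> \<Omega>" using domain[OF Uc] by blast
      have TN: "tangent_space (c ` U) y = L" if "y \<in> c ` U" for y
        by (rule tangent_space_open_in_subspace[OF L chart(2)[OF Uc] that])
      have ip: "inner_product_on L (mB (U, c) y)" if "y \<in> c ` U" for y
        using chart(3)[OF Uc] TN that unfolding riemannian_metric_def by auto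
      obtain \<pi> G \<Gamma>B where BB: "levi_civita_submanifold (c ` U) (\<lambda>_. \<pi>) (mB (U, c)) G (nabB (U, c)) \<Gamma>B"
        using levi_civita_open_in_subspace[OF L TN chart(3)[OF Uc] chart(4)[OF Uc]] by metis
      have inU: "q y \<in> U" if "y \<in> M \<inter> \<Omega>" for y using \<Omega>(2) that by auto
      interpret S: submersion_chart M P m g nab \<Gamma> HM VM H V \<Gamma>0 \<Gamma>H \<Gamma>V "c ` U" \<pi> "mB (U, c)" G "nabB (U, c)" \<Gamma>B
        L \<Omega> "c \<circ> q"
      proof (intro submersion_chart.intro submersion_chart_axioms.intro orthogonal_splitting_axioms BB \<Omega>(1) L TN)
        show "smooth_map (M \<inter> \<Omega>) (c \<circ> q)" using chart(5)[OF Uc] \<Omega>(2) by simp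
        show "(c \<circ> q) y \<in> c ` U" if "y \<in> M \<inter> \<Omega>" for y using inU[OF that] by simp
        show "0 < mB (U, c) y u u" if "y \<in> c ` U" "u \<in> L" "u \<noteq> 0" for y u
          using ip[OF that(1)] that unfolding inner_product_on_def by simp
        show "mB (U, c) y u v = mB (U, c) y v u" if "y \<in> c ` U" "u \<in> L" "v \<in> L" for y u v
          using ip[OF that(1)] that unfolding inner_product_on_def by blast
        show "dir_deriv M (c \<circ> q) y ` tangent_space M y = L" if "y \<in> M \<inter> \<Omega>" for y
          using sub'(1)[OF _ Uc inU[OF that]] that by simp
        show "dir_deriv M (c \<circ> q) y v = 0" if "y \<in> M \<inter> \<Omega>" "v \<in> VM y" for y v
          using vertical[of y] that Uc inU[OF that(1)] unfolding vertical_space_def differential_charts_def by auto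
        show "mB (U, c) ((c \<circ> q) y) (dir_deriv M (c \<circ> q) y \<xi>) (dir_deriv M (c \<circ> q) y \<eta>) = m y \<xi> \<eta>"
          if "y \<in> M \<inter> \<Omega>" "\<xi> \<in> HM y" "\<eta> \<in> HM y" for y \<xi> \<eta>
          using sub'(2)[OF _ Uc inU[OF that(1)], of \<xi> \<eta>] that HM by simp
      qed
      have xS: "x \<in> M \<inter> \<Omega>" using \<Omega>(2) x qx by auto
      show ?thesis
        using S.horizontal_lift_curvature[OF xS h] RH_in h HM_tangent[OF x]
        by (simp add: S.dF_tangent[OF xS] RH_def)
    qed
    have "RH x \<xi> \<eta> \<phi> \<in> horizontal_space M m charts q x" using RH_in HM x by simp
    then show ?thesis
      unfolding is_horizontal_lift_def curvature_charts_def differential_charts_def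
      using lift by auto
  qed
  show ?thesis using part1 part2 by blast
qed

end
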